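(* Let $k\ge1$, $\Gamma=\mathbb{Z}^k$, and let $G$ be the nilpotent Lie group defined in the context. The deformation space $\mathcal{T}(\Gamma,G;\mathbb{R}^{k+1})$ contains a smooth manifold $\mathcal{T}'$ as its open dense subset, where the dimension of $\mathcal{T}'$ is given by $$\dim\mathcal{T}'=\begin{cases}2k^2-1&(k \text{ even}),\\ 2k^2-2&(k\text{ odd},\ k\ge3),\\ 2&(k=1).\end{cases}$$
   Context: $G$ is the group of real $(k+2)\times(k+2)$ matrices $\begin{pmatrix} I_k&\vec x&\vec y\\0&1&z\\0&0&1\end{pmatrix}$ with $\vec x,\vec y\in\mathbb{R}^k$, $z\in\mathbb{R}$, and $H\subset G$ is the subgroup with $\vec y=\vec 0$, $z=0$. The homogeneous space $G/H$ is identified with $\mathbb{R}^{k+1}$; $G$ acts on $\mathbb{R}^{k+1}=\mathbb{R}^k\oplus\mathbb{R}$ by the affine maps $(\vec\xi,\xi_{k+1})\mapsto(\vec\xi+\xi_{k+1}\vec x+\vec y,\ \xi_{k+1}+z)$, and $H$ is the stabilizer of the origin. $\operatorname{Hom}(\Gamma,G)$ is the set of group homomorphisms, with the topology induced from the embedding into $G\times\cdots\times G$ ($k$ factors), $\varphi\mapsto(\varphi(e_1),\dots,\varphi(e_k))$, where $e_1,\dots,e_k$ is the standard basis of $\mathbb{Z}^k$. $R(\Gamma,G;\mathbb{R}^{k+1})$ is the subset of those $\varphi\in\operatorname{Hom}(\Gamma,G)$ such that $\varphi$ is injective and $\varphi(\Gamma)$ acts properly discontinuously and freely on $\mathbb{R}^{k+1}$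 (properly discontinuously: $\varphi(\Gamma)$ is discrete in $G$ and for every compact $S\subset\mathbb{R}^{k+1}$ the set $\{\gamma\in\varphi(\Gamma):\gamma S\cap S\ne\emptyset\}$ is finite). $G$ acts on $R(\Gamma,G;\mathbb{R}^{k+1})$ by conjugation, $(h\cdot\varphi)(\gamma)=h\varphi(\gamma)h^{-1}$, and the deformation space is the quotient $\mathcal{T}(\Gamma,G;\mathbb{R}^{k+1})=R(\Gamma,G;\mathbb{R}^{k+1})/G$, with the quotient topology.
   Formalization: The manifold T' may have components of different dimensions, and dim T' means the largest of them; a single dimension is impossible for k ≥ 2, since homomorphisms with z ≠ 0 give an open part of the deformation space of dimension k²+k. *)

theory Defs
  imports "HOL-Analysis.Analysis" "HOL-Algebra.Group"
begin

section \<open>The group and its affine action\<close>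

text \<open>The number \<open>k\<close> is \<open>CARD('k)\<close>, which is at least 1 for every finite type. Rows and columns of
  a \<open>(k+2) \<times> (k+2)\<close> matrix are indexed by \<open>'k + bool\<close>: \<open>Inl a\<close> are the first \<open>k\<close> indices,
  \<open>Inr False\<close> is the index \<open>k+1\<close>, and \<open>Inr True\<close> is the index \<open>k+2\<close>.\<close>

type_synonym 'k sqmat = "real ^ ('k + bool) ^ ('k + bool)"

definition G_mat :: "real ^ 'k::finite \<Rightarrow> real ^ 'k \<Rightarrow> real \<Rightarrow> 'k sqmat" where
  "G_mat x y z = (\<chi> i j. case i of
      Inl a \<Rightarrow> (case j of
          Inl b \<Rightarrow> if a = b then 1 else 0
        | Inr t \<Rightarrow> if t then y $ a else x $ a)
    | Inr s \<Rightarrow> (case j of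
          Inl b \<Rightarrow> 0
        | Inr t \<Rightarrow> if s = t then 1 else if t then z else 0))"

definition x_part :: "'k::finite sqmat \<Rightarrow> real ^ 'k" where
  "x_part g = (\<chi> a. g $ Inl a $ Inr False)"

definition y_part :: "'k::finite sqmat \<Rightarrow> real ^ 'k" where
  "y_part g = (\<chi> a. g $ Inl a $ Inr True)"

definition z_part :: "'k::finite sqmat \<Rightarrow> real" where
  "z_part g = g $ Inr False $ Inr True"

definition G_group :: "'k::finite sqmat monoid" where
  "G_group = \<lparr>carrier = {G_mat x y z | x y z. True}, monoid.mult = (**), one = mat 1\<rparr>"

definition G_act :: "'k::finite sqmat \<Rightarrow> (real ^ 'k) \<times> real \<Rightarrow> (real ^ 'k) \<times> real" where
  "G_act g p = (fst p + snd p *\<^sub>R x_part g + y_part g, snd p + z_part g)"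

lemma G_mat_parts [simp]:
  "x_part (G_mat x y z) = x" "y_part (G_mat x y z) = y" "z_part (G_mat x y z) = z"
  by (simp_all add: x_part_def y_part_def z_part_def G_mat_def vec_eq_iff)

lemma sum_UNIV_Plus_bool:
  "(\<Sum>i\<in>(UNIV :: ('k::finite + bool) set). f i) =
    (\<Sum>a\<in>UNIV. f (Inl a)) + f (Inr False) + (f (Inr True) :: real)"
  unfolding UNIV_Plus_UNIV [symmetric]
  by (subst sum.Plus) (simp_all add: UNIV_bool)

lemma G_mat_mult: "G_mat x y z ** G_mat x' y' z' = G_mat (x + x') (y + y' + z' *\<^sub>R x) (z + z')"
  unfolding vec_eq_iff
proof (intro allI)
  fix i j
  show "(G_mat x y z ** G_mat x' y' z') $ i $ j =
      G_mat (x + x') (y + y' + z' *\<^sub>R x) (z + z') $ i $ j"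
    by (cases i; cases j)
       (auto simp: G_mat_def matrix_matrix_mult_def sum_UNIV_Plus_bool
          if_distrib [of "\<lambda>c. c * _"] if_distrib [of "\<lambda>c. _ * c"] cong: if_cong)
qed

lemma G_mat_one: "mat 1 = G_mat 0 0 0"
  unfolding vec_eq_iff
proof (intro allI)
  fix i j :: "'a + bool"
  show "mat 1 $ i $ j = (G_mat 0 0 0 :: 'a sqmat) $ i $ j"
    by (cases i; cases j) (auto simp: mat_def G_mat_def)
qed

lemma group_G_group: "group (G_group :: 'k::finite sqmat monoid)"
proof (rule groupI)
  fix g :: "'k sqmat" assume "g \<in> carrier G_group"
  then obtain x y z where g: "g = G_mat x y z" by (auto simp: G_group_def)
  have "G_mat (- x) (z *\<^sub>R x - y) (- z) \<otimes>\<^bsub>G_group\<^esub> g = \<one>\<^bsub>G_group\<^esub>"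
    by (simp add: G_group_def g G_mat_mult G_mat_one)
  then show "\<exists>h\<in>carrier G_group. h \<otimes>\<^bsub>G_group\<^esub> g = \<one>\<^bsub>G_group\<^esub>"
    by (auto simp: G_group_def)
qed (auto simp: G_group_def G_mat_mult G_mat_one matrix_mul_assoc [symmetric], blast+)

lemma G_act_mult:
  "g \<in> carrier G_group \<Longrightarrow> h \<in> carrier G_group \<Longrightarrow> G_act (g \<otimes>\<^bsub>G_group\<^esub> h) p = G_act g (G_act h p)"
  by (auto simp: G_group_def G_mat_mult G_act_def algebra_simps)

lemma G_act_stabilizer_origin: "G_act (G_mat x y z) 0 = 0 \<longleftrightarrow> y = 0 \<and> z = 0"
  by (simp add: G_act_def zero_prod_def)

section \<open>The deformation space\<close>

definition Zk_group :: "(int ^ 'k::finite) monoid" where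
  "Zk_group = \<lparr>carrier = UNIV, monoid.mult = (+), one = 0\<rparr>"

definition Hom_top :: "(int ^ 'k::finite \<Rightarrow> 'k sqmat) topology" where
  "Hom_top = pullback_topology (hom Zk_group G_group) (\<lambda>\<phi> j. \<phi> (axis j 1))
     (product_topology (\<lambda>j. top_of_set (carrier G_group)) UNIV)"

definition acts_properly_discontinuously :: "'k::finite sqmat set \<Rightarrow> bool" where
  "acts_properly_discontinuously D \<longleftrightarrow> discrete D \<and>
     (\<forall>S. compact S \<longrightarrow> finite {\<gamma>\<in>D. G_act \<gamma> ` S \<inter> S \<noteq> {}})"

definition acts_freely :: "'k::finite sqmat set \<Rightarrow> bool" where
  "acts_freely D \<longleftrightarrow> (\<forall>\<gamma>\<in>D. \<forall>p. G_act \<gamma> p = p \<longrightarrow> \<gamma> = \<one>\<^bsub>G_group\<^esub>)"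

definition R_set :: "(int ^ 'k::finite \<Rightarrow> 'k sqmat) set" where
  "R_set = {\<phi> \<in> hom Zk_group G_group. inj \<phi> \<and>
     acts_properly_discontinuously (range \<phi>) \<and> acts_freely (range \<phi>)}"

definition conj_act :: "'k::finite sqmat \<Rightarrow> (int ^ 'k \<Rightarrow> 'k sqmat) \<Rightarrow> (int ^ 'k \<Rightarrow> 'k sqmat)" where
  "conj_act h \<phi> = (\<lambda>v. h \<otimes>\<^bsub>G_group\<^esub> \<phi> v \<otimes>\<^bsub>G_group\<^esub> inv\<^bsub>G_group\<^esub> h)"

definition conj_orbit :: "(int ^ 'k::finite \<Rightarrow> 'k sqmat) \<Rightarrow> (int ^ 'k \<Rightarrow> 'k sqmat) set" where
  "conj_orbit \<phi> = {conj_act h \<phi> | h. h \<in> carrier G_group}"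

definition quotient_topology :: "'a topology \<Rightarrow> ('a \<Rightarrow> 'b) \<Rightarrow> 'b topology" where
  "quotient_topology X q =
     topology (\<lambda>W. W \<subseteq> q ` topspace X \<and> openin X {x \<in> topspace X. q x \<in> W})"

lemma openin_quotient_topology:
  "openin (quotient_topology X q) W \<longleftrightarrow>
     W \<subseteq> q ` topspace X \<and> openin X {x \<in> topspace X. q x \<in> W}"
proof -
  have "istopology (\<lambda>W. W \<subseteq> q ` topspace X \<and> openin X {x \<in> topspace X. q x \<in> W})"
    unfolding istopology_def
  proof (rule conjI; clarify)
    fix S T assume "openin X {x \<in> topspace X. q x \<in> S}" "openin X {x \<in> topspace X. q x \<in> T}"
    then have "openin X ({x \<in> topspace X. q x \<in> S} \<inter> {x \<in> topspace X. q x \<in> T})"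
      by (rule openin_Int)
    moreover have "{x \<in> topspace X. q x \<in> S} \<inter> {x \<in> topspace X. q x \<in> T} =
        {x \<in> topspace X. q x \<in> S \<inter> T}" by auto
    moreover assume "S \<subseteq> q ` topspace X"
    ultimately show "S \<inter> T \<subseteq> q ` topspace X \<and> openin X {x \<in> topspace X. q x \<in> S \<inter> T}" by auto
  next
    fix \<K> assume K: "\<forall>K\<in>\<K>. K \<subseteq> q ` topspace X \<and> openin X {x \<in> topspace X. q x \<in> K}"
    then have "openin X (\<Union>K\<in>\<K>. {x \<in> topspace X. q x \<in> K})" by blast
    moreover have "(\<Union>K\<in>\<K>. {x \<in> topspace X. q x \<in> K}) = {x \<in> topspace X. q x \<in> \<Union>\<K>}" by auto
    ultimately show "\<Union>\<K> \<subseteq> q ` topspace X \<and> openin X {x \<in> topspace X. q x \<in> \<Union>\<K>}"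
      using K by auto
  qed
  then show ?thesis
    by (simp add: quotient_topology_def topology_inverse')
qed

lemma quotient_map_quotient_topology: "quotient_map X (quotient_topology X q) q"
proof -
  have "{x \<in> topspace X. q x \<in> q ` topspace X} = topspace X" by auto
  then have "topspace (quotient_topology X q) = q ` topspace X"
    by (metis openin_quotient_topology openin_subset openin_topspace subset_antisym subset_refl)
  then show ?thesis
    by (simp add: quotient_map_def openin_quotient_topology)
qed

definition deformation_space :: "(int ^ 'k::finite \<Rightarrow> 'k sqmat) set topology" where
  "deformation_space = quotient_topology (subtopology Hom_top R_set) conj_orbit"

section \<open>Smooth manifolds\<close>

text \<open>Model spaces are the library's \<open>Euclidean_space m\<close>, whose points are the \<open>p :: nat \<Rightarrow> real\<close> with
  \<open>p i = 0\<close> for all \<open>i \<ge> m\<close>. A real function is \<open>C\<^sup>r\<close> on an open subset \<open>U\<close> of it iff all partial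
  derivatives up to order \<open>r\<close> exist and are continuous on \<open>U\<close>.\<close>

primrec C_diff_on :: "nat \<Rightarrow> nat \<Rightarrow> (nat \<Rightarrow> real) set \<Rightarrow> ((nat \<Rightarrow> real) \<Rightarrow> real) \<Rightarrow> bool" where
  "C_diff_on 0 m U f \<longleftrightarrow> continuous_map (subtopology (Euclidean_space m) U) euclideanreal f"
| "C_diff_on (Suc r) m U f \<longleftrightarrow>
     continuous_map (subtopology (Euclidean_space m) U) euclideanreal f \<and>
     (\<exists>D. \<forall>i<m. (\<forall>p\<in>U. ((\<lambda>t. f (p(i := t))) has_real_derivative D i p) (at (p i))) \<and>
        C_diff_on r m U (D i))"

definition smooth_map_on ::
  "nat \<Rightarrow> nat \<Rightarrow> (nat \<Rightarrow> real) set \<Rightarrow> ((nat \<Rightarrow> real) \<Rightarrow> (nat \<Rightarrow> real)) \<Rightarrow> bool" where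
  "smooth_map_on m n U F \<longleftrightarrow>
     F ` U \<subseteq> topspace (Euclidean_space n) \<and> (\<forall>j<n. \<forall>r. C_diff_on r m U (\<lambda>p. F p j))"

text \<open>A chart \<open>(m, U, \<phi>)\<close> maps the open set \<open>U\<close> homeomorphically onto an open subset of
  \<open>Euclidean_space m\<close>.\<close>

type_synonym 'a chart = "nat \<times> 'a set \<times> ('a \<Rightarrow> nat \<Rightarrow> real)"

definition is_chart :: "'a topology \<Rightarrow> 'a chart \<Rightarrow> bool" where
  "is_chart X = (\<lambda>(m, U, \<phi>). U \<noteq> {} \<and> openin X U \<and> openin (Euclidean_space m) (\<phi> ` U) \<and>
     homeomorphic_map (subtopology X U) (subtopology (Euclidean_space m) (\<phi> ` U)) \<phi>)"

definition smooth_atlas :: "'a topology \<Rightarrow> 'a chart set \<Rightarrow> bool" where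
  "smooth_atlas X \<A> \<longleftrightarrow>
     (\<forall>c\<in>\<A>. is_chart X c) \<and>
     (\<Union>(m, U, \<phi>)\<in>\<A>. U) = topspace X \<and>
     (\<forall>(m, U, \<phi>)\<in>\<A>. \<forall>(n, V, \<psi>)\<in>\<A>. smooth_map_on m n (\<phi> ` (U \<inter> V)) (\<psi> \<circ> inv_into U \<phi>))"

definition second_countable_space :: "'a topology \<Rightarrow> bool" where
  "second_countable_space X \<longleftrightarrow> (\<exists>\<B>. countable \<B> \<and> (\<forall>V\<in>\<B>. openin X V) \<and>
     (\<forall>U x. openin X U \<and> x \<in> U \<longrightarrow> (\<exists>V\<in>\<B>. x \<in> V \<and> V \<subseteq> U)))"

text \<open>The connected components of a manifold are not required to have equal dimension; the dimension
  of the manifold is the largest dimension of a component. Charts have nonempty domain and, by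
  invariance of domain, the dimension of a chart around a point depends only on that point.\<close>

definition smooth_manifold_of_dim :: "'a topology \<Rightarrow> nat \<Rightarrow> bool" where
  "smooth_manifold_of_dim X d \<longleftrightarrow> Hausdorff_space X \<and> second_countable_space X \<and>
     (\<exists>\<A>. smooth_atlas X \<A> \<and> (\<forall>(m, U, \<phi>)\<in>\<A>. m \<le> d) \<and> (\<exists>(m, U, \<phi>)\<in>\<A>. m = d))"

end

theory Submission
  imports Defs
begin

text \<open>
  Writing \<open>\<phi>(n) = exp (X n, W n, z \<cdot> n)\<close> identifies \<open>Hom(\<Gamma>, G)\<close> with the triples \<open>(X, W, z)\<close> of two
  \<open>k \<times> k\<close> matrices and a vector such that the columns satisfy \<open>z\<^sub>i X\<^sub>j = z\<^sub>j X\<^sub>i\<close>; hence \<open>z = 0\<close> or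
  \<open>X = x z\<^sup>T\<close>. The action is free and properly discontinuous iff no \<open>W + t X\<close> has a nonzero kernel
  vector orthogonal to \<open>z\<close>, and conjugation by \<open>(a, b, c)\<close> replaces \<open>W\<close> by \<open>W + a z\<^sup>T - c X\<close>.

  The manifold is a disjoint union of at most two open pieces, each covered by one global chart. Where
  \<open>z\<^sub>b \<noteq> 0\<close> one normalises column \<open>b\<close> of \<open>W\<close> to zero, which leaves \<open>k\<^sup>2 + k\<close> parameters. Where \<open>X\<close> has
  rank at least two, \<open>z = 0\<close> and \<open>W + t X\<close> is invertible for all real \<open>t\<close>. For even \<open>k\<close> the generic such
  \<open>X\<close> is invertible, and normalising one entry of \<open>W\<close> leaves \<open>2k\<^sup>2 - 1\<close> parameters. For odd \<open>k\<close> the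
  matrix \<open>X\<close> is singular because \<open>det (W + t X)\<close> has no real zero, which costs one more parameter.
  Density: as long as \<open>0\<close> is a multiple eigenvalue of \<open>W\<^sup>-\<^sup>1 X\<close>, a small rank-two perturbation of \<open>X\<close>
  multiplies \<open>det (W + t X)\<close> by \<open>1 + \<delta> t\<^sup>2\<close> with \<open>\<delta> > 0\<close>, and the degree in \<open>t\<close> is at most \<open>k\<close>.
\<close>

section \<open>Homomorphisms in coordinates\<close>

text \<open>Parity: the degree of \<open>det (W + t X)\<close> in \<open>t\<close> is
  \<open>k\<close> minus the multiplicity of the eigenvalue 0 of \<open>W^-1 X\<close>. A polynomial
  without real zeros has even degree, so degree \<open>k\<close> (invertible \<open>X\<close>) is
  possible only for even \<open>k\<close>, and degree \<open>k - 1\<close> (a simple eigenvalue 0)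
  only for odd \<open>k\<close>. These are the generic cases, and they are reached by maximising the
  degree over a small ball around \<open>X\<close>. The obstacle is openness: having no real zero is
  not an open condition on \<open>(X, W)\<close>, since a zero can come in from
  \<open>t = infinity\<close>. Homogeneous parameters \<open>(s, t)\<close> on a compact half circle
  repair this; the point \<open>s = 0\<close> contributes exactly the genericity condition, once the
  factor \<open>s\<close> forced by a singular \<open>X\<close> is divided out. Fixing nonzero
  entries such as \<open>z $ b\<close> or \<open>X $ a $ a\<close> shrinks each piece until one
  normal form serves as a chart on all of it. The pieces are disjoint, so charts overlap only with
  themselves and the transition maps are identities. For \<open>k >= 2\<close> the piece with
  \<open>z $ b \<noteq> 0\<close> has the smaller dimension but is open, so density forces it to be
  kept.\<close>

definition real_vec :: "int ^ 'k::finite \<Rightarrow> real ^ 'k" where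
  "real_vec n = (\<chi> i. of_int (n $ i))"

definition outer :: "real ^ 'k::finite \<Rightarrow> real ^ 'k \<Rightarrow> real ^ 'k ^ 'k" where
  "outer a b = (\<chi> i j. a $ i * b $ j)"

type_synonym 'k par = "(real ^ 'k ^ 'k) \<times> (real ^ 'k ^ 'k) \<times> (real ^ 'k)"

text \<open>The exponential of the nilpotent matrix with entries \<open>X n\<close>,
  \<open>W n\<close> and \<open>z \<bullet> n\<close>: half the product comes from the quadratic
  term, and the cube vanishes. In the logarithm all data are linear in \<open>n\<close>.\<close>

definition hom_of :: "'k::finite par \<Rightarrow> int ^ 'k \<Rightarrow> 'k sqmat" where
  "hom_of = (\<lambda>(X, W, z) n. G_mat (X *v real_vec n)
     (W *v real_vec n + (z \<bullet> real_vec n / 2) *\<^sub>R (X *v real_vec n)) (z \<bullet> real_vec n))"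

definition par_of :: "(int ^ 'k::finite \<Rightarrow> 'k sqmat) \<Rightarrow> 'k par" where
  "par_of \<phi> = ((\<chi> i j. x_part (\<phi> (axis j 1)) $ i),
     (\<chi> i j. y_part (\<phi> (axis j 1)) $ i - z_part (\<phi> (axis j 1)) / 2 * x_part (\<phi> (axis j 1)) $ i),
     (\<chi> j. z_part (\<phi> (axis j 1))))"

text \<open>By \<open>G_mat_mult\<close>, two elements of the group commute iff
  \<open>z' x = z x'\<close>; here this is required of the images of each pair of standard basis
  vectors.\<close>

definition commuting :: "real ^ 'k::finite ^ 'k \<Rightarrow> real ^ 'k \<Rightarrow> bool" where
  "commuting X z \<longleftrightarrow> (\<forall>i j l. z $ i * X $ l $ j = z $ j * X $ l $ i)"

lemma outer_mult_vec: "outer a b *v v = (b \<bullet> v) *\<^sub>R a"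
  by (simp add: outer_def vec_eq_iff matrix_vector_mult_def inner_vec_def sum_distrib_left
      mult_ac)

lemma commuting_iff:
  "commuting X z \<longleftrightarrow> (\<forall>u v. (z \<bullet> u) *\<^sub>R (X *v v) = (z \<bullet> v) *\<^sub>R (X *v u))"
proof
  assume c: "commuting X z"
  show "\<forall>u v. (z \<bullet> u) *\<^sub>R (X *v v) = (z \<bullet> v) *\<^sub>R (X *v u)"
  proof (intro allI, unfold vec_eq_iff, intro allI)
    fix u v l
    have "(\<Sum>i\<in>UNIV. \<Sum>j\<in>UNIV. (z $ i * u $ i) * (X $ l $ j * v $ j)) =
        (\<Sum>i\<in>UNIV. \<Sum>j\<in>UNIV. (z $ j * v $ j) * (X $ l $ i * u $ i))"
    proof (intro sum.cong refl)
      fix i j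
      have "z $ i * X $ l $ j = z $ j * X $ l $ i" using c by (simp add: commuting_def)
      then have "(z $ i * X $ l $ j) * (u $ i * v $ j) = (z $ j * X $ l $ i) * (u $ i * v $ j)" by simp
      then show "(z $ i * u $ i) * (X $ l $ j * v $ j) = (z $ j * v $ j) * (X $ l $ i * u $ i)"
        by (simp only: mult_ac)
    qed
    also have "\<dots> = (\<Sum>j\<in>UNIV. \<Sum>i\<in>UNIV. (z $ j * v $ j) * (X $ l $ i * u $ i))"
      by (rule sum.swap)
    finally show "((z \<bullet> u) *\<^sub>R (X *v v)) $ l = ((z \<bullet> v) *\<^sub>R (X *v u)) $ l"
      by (simp add: inner_vec_def matrix_vector_mult_def sum_product)
  qed
next
  assume a: "\<forall>u v. (z \<bullet> u) *\<^sub>R (X *v v) = (z \<bullet> v) *\<^sub>R (X *v u)"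
  show "commuting X z"
    unfolding commuting_def
  proof (intro allI)
    fix i j l
    from a have "((z \<bullet> axis i 1) *\<^sub>R (X *v axis j 1)) $ l = ((z \<bullet> axis j 1) *\<^sub>R (X *v axis i 1)) $ l"
      by simp
    then show "z $ i * X $ l $ j = z $ j * X $ l $ i"
      by (simp add: inner_axis inner_axis' matrix_vector_mul_component)
  qed
qed

lemma real_vec_add: "real_vec (m + n) = real_vec m + real_vec n"
  by (simp add: real_vec_def vec_eq_iff)

lemma real_vec_axis: "real_vec (axis j 1) = axis j 1"
  by (simp add: real_vec_def vec_eq_iff axis_def)

lemma real_vec_eq_0_iff: "real_vec n = 0 \<longleftrightarrow> n = 0"
  by (simp add: real_vec_def vec_eq_iff)

lemma finite_real_vec_bounded: "finite {n :: int ^ 'k::finite. norm (real_vec n) \<le> C}"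
proof -
  have "{n :: int ^ 'k. norm (real_vec n) \<le> C} \<subseteq> vec_lambda ` (PiE UNIV (\<lambda>_. {-\<lceil>C\<rceil>..\<lceil>C\<rceil>}))"
  proof
    fix n :: "int ^ 'k" assume "n \<in> {n. norm (real_vec n) \<le> C}"
    then have *: "\<bar>real_of_int (n $ i)\<bar> \<le> C" for i
      using component_le_norm_cart [of "real_vec n" i] by (simp add: real_vec_def)
    have "n $ i \<in> {-\<lceil>C\<rceil>..\<lceil>C\<rceil>}" for i
    proof -
      have "\<bar>real_of_int (n $ i)\<bar> \<le> of_int \<lceil>C\<rceil>" using * [of i] le_of_int_ceiling order_trans by blast
      then have "\<bar>n $ i\<bar> \<le> \<lceil>C\<rceil>" by linarith
      then show ?thesis by auto
    qed
    then have "vec_nth n \<in> PiE UNIV (\<lambda>_. {-\<lceil>C\<rceil>..\<lceil>C\<rceil>})" by (auto simp: PiE_def)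
    then show "n \<in> vec_lambda ` (PiE UNIV (\<lambda>_. {-\<lceil>C\<rceil>..\<lceil>C\<rceil>}))"
      by (metis image_eqI vec_nth_inverse)
  qed
  then show ?thesis by (rule finite_subset) (simp add: finite_PiE)
qed

lemma additive_int_expansion:
  fixes g :: "int \<Rightarrow> 'a::real_vector"
  assumes "\<And>m n. g (m + n) = g m + g n"
  shows "g c = of_int c *\<^sub>R g 1"
proof -
  have g0: "g 0 = 0" using assms [of 0 0] by simp
  have gm: "g (m - 1) = g m - g 1" for m using assms [of "m - 1" 1] by simp
  show ?thesis
    by (induction c rule: int_induct [where k = 0])
       (auto simp: g0 assms gm algebra_simps)
qed

lemma additive_int_vec_expansion:
  fixes f :: "int ^ 'k::finite \<Rightarrow> 'a::real_vector"
  assumes add: "\<And>m n. f (m + n) = f m + f n"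
  shows "f n = (\<Sum>j\<in>UNIV. real_vec n $ j *\<^sub>R f (axis j 1))"
proof -
  interpret additive f by standard (rule add)
  have "f n = f (\<Sum>j\<in>UNIV. axis j (n $ j))"
    by (rule arg_cong [of _ _ f]) (simp add: vec_eq_iff axis_def)
  also have "\<dots> = (\<Sum>j\<in>UNIV. f (axis j (n $ j)))" by (rule sum)
  also have "\<dots> = (\<Sum>j\<in>UNIV. real_vec n $ j *\<^sub>R f (axis j 1))"
  proof (rule sum.cong [OF refl])
    fix j
    have "axis j (a + b) = axis j a + (axis j b :: int ^ 'k)" for a b
      by (simp add: vec_eq_iff axis_def)
    then show "f (axis j (n $ j)) = real_vec n $ j *\<^sub>R f (axis j 1)"
      using additive_int_expansion [of "\<lambda>c. f (axis j c)" "n $ j"] by (simp add: add real_vec_def)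
  qed
  finally show ?thesis .
qed

lemma hom_of_hom:
  assumes "commuting X z"
  shows "hom_of (X, W, z) \<in> hom Zk_group G_group"
proof (rule homI)
  fix m n :: "int ^ 'a"
  let ?m = "real_vec m" and ?n = "real_vec n"
  have "(z \<bullet> ?m) *\<^sub>R (X *v ?n) = (z \<bullet> ?n) *\<^sub>R (X *v ?m)"
    using assms by (simp add: commuting_iff)
  \<comment> \<open>By commutativity the two mixed halves of the quadratic term agree; together they
    make up the twist \<open>(z \<bullet> n) X m\<close> of the group law.\<close>
  then have "((z \<bullet> ?m) / 2) *\<^sub>R (X *v ?n) = ((z \<bullet> ?n) / 2) *\<^sub>R (X *v ?m)"
    by (metis (no_types, lifting) divide_inverse_commute scaleR_scaleR)
  moreover have "((z \<bullet> ?n) / 2) *\<^sub>R (X *v ?m) + ((z \<bullet> ?n) / 2) *\<^sub>R (X *v ?m) = (z \<bullet> ?n) *\<^sub>R (X *v ?m)"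
    by (simp flip: scaleR_left_distrib)
  ultimately have "((z \<bullet> ?m) / 2) *\<^sub>R (X *v ?n) + ((z \<bullet> ?n) / 2) *\<^sub>R (X *v ?m) = (z \<bullet> ?n) *\<^sub>R (X *v ?m)"
    by simp
  then have "((z \<bullet> ?m + z \<bullet> ?n) / 2) *\<^sub>R (X *v ?m + X *v ?n) =
      ((z \<bullet> ?m) / 2) *\<^sub>R (X *v ?m) + ((z \<bullet> ?n) / 2) *\<^sub>R (X *v ?n) + (z \<bullet> ?n) *\<^sub>R (X *v ?m)"
    by (simp add: add_divide_distrib scaleR_add_left scaleR_add_right add_ac)
  then show "hom_of (X, W, z) (m \<otimes>\<^bsub>Zk_group\<^esub> n) =
      hom_of (X, W, z) m \<otimes>\<^bsub>G_group\<^esub> hom_of (X, W, z) n"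
    by (simp add: Zk_group_def G_group_def hom_of_def G_mat_mult real_vec_add
        matrix_vector_right_distrib inner_add_right add_ac)
qed (auto simp: G_group_def hom_of_def)

lemma par_of_hom_of: "par_of (hom_of p) = p"
  by (cases p) (simp add: par_of_def hom_of_def real_vec_axis vec_eq_iff inner_axis
      matrix_vector_mul_component column_def row_def)

lemma hom_is_hom_of:
  assumes \<phi>: "\<phi> \<in> hom Zk_group (G_group :: 'k::finite sqmat monoid)"
    and p: "par_of \<phi> = (X, W, z)"
  shows "commuting X z" "\<phi> = hom_of (X, W, z)"
proof -
  define x y s where "x n = x_part (\<phi> n)" and "y n = y_part (\<phi> n)" and "s n = z_part (\<phi> n)" for n
  have G: "\<phi> n = G_mat (x n) (y n) (s n)" for n
  proof -
    have "\<phi> n \<in> carrier G_group" using \<phi> by (auto simp: hom_def Zk_group_def)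
    then show ?thesis by (auto simp: G_group_def x_def y_def s_def)
  qed
  have mult: "\<phi> (m + n) = \<phi> m ** \<phi> n" for m n
    using \<phi> by (auto simp: hom_def Zk_group_def G_group_def)
  have eq: "G_mat (x (m + n)) (y (m + n)) (s (m + n)) =
      G_mat (x m + x n) (y m + y n + s n *\<^sub>R x m) (s m + s n)" for m n
    using mult [of m n] by (simp add: G G_mat_mult)
  have inj: "a = a' \<and> b = b' \<and> c = c'" if "G_mat a b c = G_mat a' b' c'"
    for a b a' b' :: "real ^ 'k" and c c'
    using that by (metis G_mat_parts)
  have xa: "x (m + n) = x m + x n" and ya: "y (m + n) = y m + y n + s n *\<^sub>R x m"
    and sa: "s (m + n) = s m + s n" for m n
    using inj [OF eq [of m n]] by auto
  have com: "s n *\<^sub>R x m = s m *\<^sub>R x n" for m n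
    using ya [of m n] ya [of n m] by (simp add: add.commute)
  \<comment> \<open>\<open>y\<close> is additive only up to the twist \<open>s n *R x m\<close>,
    which \<open>com\<close> makes symmetric in \<open>m\<close> and \<open>n\<close>. Subtracting
    half of \<open>s n *R x n\<close> removes it, so that \<open>w\<close> is given by a
    matrix.\<close>
  define w where "w n = y n - (s n / 2) *\<^sub>R x n" for n
  have wa: "w (m + n) = w m + w n" for m n
  proof -
    have "(s n / 2) *\<^sub>R x m = (s m / 2) *\<^sub>R x n"
      using com [of n m] by (metis (no_types, lifting) divide_inverse_commute scaleR_scaleR)
    moreover have "(s n / 2) *\<^sub>R x m + (s n / 2) *\<^sub>R x m = s n *\<^sub>R x m"
      by (simp flip: scaleR_left_distrib)
    ultimately show ?thesis
      by (simp add: w_def ya xa sa add_divide_distrib scaleR_add_left scaleR_add_right algebra_simps)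
  qed
  have X: "X = (\<chi> i j. x (axis j 1) $ i)" and W: "W = (\<chi> i j. w (axis j 1) $ i)"
    and z: "z = (\<chi> j. s (axis j 1))"
    using p by (auto simp: par_of_def x_def y_def s_def w_def)
  show "commuting X z"
    unfolding commuting_def X z
  proof (intro allI)
    fix i j l
    show "(\<chi> j. s (axis j 1)) $ i * (\<chi> i j. x (axis j 1) $ i) $ l $ j =
       (\<chi> j. s (axis j 1)) $ j * (\<chi> i j. x (axis j 1) $ i) $ l $ i"
      using arg_cong [OF com [of "axis i 1" "axis j 1"], of "\<lambda>u. u $ l"] by simp
  qed
  have Xn: "X *v real_vec n = x n" and Wn: "W *v real_vec n = w n" and zn: "z \<bullet> real_vec n = s n" for n
  proof -
    show "X *v real_vec n = x n"
      by (subst additive_int_vec_expansion [of x, OF xa])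
         (simp add: X vec_eq_iff matrix_vector_mult_def mult.commute)
    show "W *v real_vec n = w n"
      by (subst additive_int_vec_expansion [of w, OF wa])
         (simp add: W vec_eq_iff matrix_vector_mult_def mult.commute)
    show "z \<bullet> real_vec n = s n"
      by (subst additive_int_vec_expansion [of s, OF sa])
         (simp add: z inner_vec_def mult.commute)
  qed
  show "\<phi> = hom_of (X, W, z)"
    by (rule ext) (simp add: hom_of_def Xn Wn zn w_def G)
qed

section \<open>Proper discontinuity\<close>

lemma continuous_on_matrix_vector_mult [continuous_intros]:
  fixes f :: "'a::topological_space \<Rightarrow> real ^ 'n::finite ^ 'm::finite"
  assumes "continuous_on S f" "continuous_on S g"
  shows "continuous_on S (\<lambda>x. f x *v g x)"
  unfolding matrix_vector_mult_def by (intro continuous_intros assms)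

lemma continuous_on_det [continuous_intros]:
  fixes f :: "'a::topological_space \<Rightarrow> real ^ 'n::finite ^ 'n"
  assumes "continuous_on S f"
  shows "continuous_on S (\<lambda>x. det (f x))"
  unfolding det_def by (intro continuous_intros assms)

text \<open>For a nonzero lattice vector \<open>v\<close> this says that
  \<open>hom_of (X, W, z) v\<close> fixes no point at height \<open>t\<close>. Quantifying over real
  \<open>v\<close> strengthens freeness to proper discontinuity, since the points of every real line
  lie within bounded distance of the lattice.\<close>

definition admissible :: "real ^ 'k::finite ^ 'k \<Rightarrow> real ^ 'k ^ 'k \<Rightarrow> real ^ 'k \<Rightarrow> bool" where
  "admissible X W z \<longleftrightarrow> (\<forall>t v. (W + t *\<^sub>R X) *v v = 0 \<and> z \<bullet> v = 0 \<longrightarrow> v = 0)"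

lemma pencil_mult_vec:
  fixes W X :: "real ^ 'k::finite ^ 'k"
  shows "(W + t *\<^sub>R X) *v v = W *v v + t *\<^sub>R (X *v v)"
  by (simp add: matrix_vector_mult_add_rdistrib scaleR_matrix_vector_assoc)

text \<open>The quadratic term of \<open>hom_of\<close> becomes evaluation of the pencil at the
  midpoint of the old and the new height.\<close>

lemma G_act_hom_of:
  "G_act (hom_of (X, W, z) n) p =
    (fst p + (W + (snd p + z \<bullet> real_vec n / 2) *\<^sub>R X) *v real_vec n, snd p + z \<bullet> real_vec n)"
  by (simp add: G_act_def hom_of_def pencil_mult_vec) (simp add: scaleR_add_left)

text \<open>For \<open>\<tau>\<close> in a compact interval and unit vectors \<open>v\<close> the
  right-hand side is positive by admissibility and attains its minimum; homogeneity in
  \<open>v\<close> does the rest.\<close>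

lemma admissible_lower_bound:
  fixes X W :: "real ^ 'k::finite ^ 'k"
  assumes "admissible X W z"
  obtains \<delta> where "\<delta> > 0"
    "\<And>\<tau> v. \<bar>\<tau>\<bar> \<le> T \<Longrightarrow> \<delta> * norm v \<le> norm ((W + \<tau> *\<^sub>R X) *v v) + \<bar>z \<bullet> v\<bar>"
proof (cases "T \<ge> 0")
  case True
  define K where "K = {-T..T} \<times> sphere (0 :: real ^ 'k) 1"
  define f where "f = (\<lambda>(\<tau>, v). norm ((W + \<tau> *\<^sub>R X) *v v) + \<bar>z \<bullet> v\<bar>)"
  have "compact K" by (simp add: K_def compact_Times)
  have "(0, axis undefined 1) \<in> K" using True by (simp add: K_def)
  then have "K \<noteq> {}" by blast
  have "continuous_on K f"
    unfolding f_def case_prod_beta by (intro continuous_intros)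
  with \<open>compact K\<close> \<open>K \<noteq> {}\<close> obtain q where q: "q \<in> K" "\<And>r. r \<in> K \<Longrightarrow> f q \<le> f r"
    by (meson continuous_attains_inf)
  obtain \<tau>0 v0 where q0: "q = (\<tau>0, v0)" by fastforce
  have "f q > 0"
  proof -
    have "v0 \<noteq> 0" using q(1) by (auto simp: q0 K_def)
    then have "(W + \<tau>0 *\<^sub>R X) *v v0 \<noteq> 0 \<or> z \<bullet> v0 \<noteq> 0"
      using assms by (auto simp: admissible_def)
    then show ?thesis
      by (simp add: f_def q0) (smt (verit) norm_ge_zero zero_less_norm_iff)
  qed
  show ?thesis
  proof (rule that [OF \<open>f q > 0\<close>])
    fix \<tau> :: real and v :: "real ^ 'k" assume \<tau>: "\<bar>\<tau>\<bar> \<le> T"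
    show "f q * norm v \<le> norm ((W + \<tau> *\<^sub>R X) *v v) + \<bar>z \<bullet> v\<bar>"
    proof (cases "v = 0")
      case False
      define u where "u = v /\<^sub>R norm v"
      have v: "v = norm v *\<^sub>R u" using False by (simp add: u_def)
      have "(\<tau>, u) \<in> K" using \<tau> False by (auto simp: K_def u_def)
      then have "f q \<le> norm ((W + \<tau> *\<^sub>R X) *v u) + \<bar>z \<bullet> u\<bar>"
        using q(2) [of "(\<tau>, u)"] by (simp add: f_def)
      then have "norm v * f q \<le> norm v * (norm ((W + \<tau> *\<^sub>R X) *v u) + \<bar>z \<bullet> u\<bar>)"
        by (rule mult_left_mono) simp
      also have "\<dots> = norm ((W + \<tau> *\<^sub>R X) *v (norm v *\<^sub>R u)) + \<bar>z \<bullet> (norm v *\<^sub>R u)\<bar>"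
        by (simp add: matrix_vector_mult_scaleR abs_mult distrib_left)
      finally show ?thesis using v by (simp add: mult.commute)
    qed simp
  qed
next
  case False
  then show ?thesis by (intro that [of 1]) auto
qed

lemma admissible_proper:
  fixes X W :: "real ^ 'k::finite ^ 'k"
  assumes adm: "admissible X W z" and "compact S"
  shows "finite {n. G_act (hom_of (X, W, z) n) ` S \<inter> S \<noteq> {}}"
proof -
  obtain C where C: "\<And>p. p \<in> S \<Longrightarrow> norm p \<le> C"
    using \<open>compact S\<close> by (meson bounded_iff compact_imp_bounded)
  obtain \<delta> where \<delta>: "\<delta> > 0"
    "\<And>\<tau> v. \<bar>\<tau>\<bar> \<le> C \<Longrightarrow> \<delta> * norm v \<le> norm ((W + \<tau> *\<^sub>R X) *v v) + \<bar>z \<bullet> v\<bar>"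
    using admissible_lower_bound [OF adm] by blast
  have "{n. G_act (hom_of (X, W, z) n) ` S \<inter> S \<noteq> {}} \<subseteq> {n. norm (real_vec n) \<le> 4 * C / \<delta>}"
  proof (intro subsetI CollectI)
    fix n assume "n \<in> {n. G_act (hom_of (X, W, z) n) ` S \<inter> S \<noteq> {}}"
    then obtain p where "p \<in> S" and q: "G_act (hom_of (X, W, z) n) p \<in> S" by blast
    define s where "s = z \<bullet> real_vec n"
    define \<tau> where "\<tau> = snd p + s / 2"
    have p1: "norm (fst p) \<le> C" "\<bar>snd p\<bar> \<le> C"
      using C [OF \<open>p \<in> S\<close>] norm_fst_le [of "fst p" "snd p"] norm_snd_le [of "snd p" "fst p"] by auto
    have "norm (fst p + (W + \<tau> *\<^sub>R X) *v real_vec n, snd p + s) \<le> C"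
      using C [OF q] by (simp add: G_act_hom_of \<tau>_def s_def)
    then have p2: "norm (fst p + (W + \<tau> *\<^sub>R X) *v real_vec n) \<le> C" "\<bar>snd p + s\<bar> \<le> C"
      using norm_fst_le [of "fst p + (W + \<tau> *\<^sub>R X) *v real_vec n" "snd p + s"]
        norm_snd_le [of "snd p + s" "fst p + (W + \<tau> *\<^sub>R X) *v real_vec n"] by auto
    \<comment> \<open>\<open>\<tau>\<close> is the midpoint of the heights \<open>snd p\<close> and
      \<open>snd p + s\<close>, both bounded by \<open>C\<close>.\<close>
    have "\<bar>\<tau>\<bar> \<le> C" using p1 p2 unfolding \<tau>_def by linarith
    moreover have "norm ((W + \<tau> *\<^sub>R X) *v real_vec n) \<le> 2 * C"
      using p1(1) p2(1) norm_triangle_ineq4 [of "fst p + (W + \<tau> *\<^sub>R X) *v real_vec n" "fst p"] by simp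
    moreover have "\<bar>z \<bullet> real_vec n\<bar> \<le> 2 * C" using p1 p2 unfolding s_def by linarith
    ultimately have "\<delta> * norm (real_vec n) \<le> 4 * C" using \<delta>(2) [of \<tau> "real_vec n"] by linarith
    then show "norm (real_vec n) \<le> 4 * C / \<delta>" using \<delta>(1) by (simp add: field_simps)
  qed
  then show ?thesis using finite_real_vec_bounded finite_subset by blast
qed

lemma properly_discontinuous_imp_discrete:
  fixes D :: "'k::finite sqmat set"
  assumes "\<And>S. compact S \<Longrightarrow> finite {\<gamma>\<in>D. G_act \<gamma> ` S \<inter> S \<noteq> {}}"
  shows "discrete D"
proof (rule discreteI)
  fix x assume "x \<in> D"
  \<comment> \<open>The orbit map at the origin is continuous, so this set is compact; as it
    contains the origin, every element of \<open>D\<close> within distance 1 of \<open>x\<close>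
    moves a point of \<open>S\<close> into \<open>S\<close>.\<close>
  define S where "S = insert 0 ((\<lambda>\<gamma>. G_act \<gamma> 0) ` cball x 1)"
  have "continuous_on (cball x 1) (\<lambda>\<gamma> :: 'k sqmat. G_act \<gamma> 0)"
    unfolding G_act_def x_part_def y_part_def z_part_def by (intro continuous_intros)
  then have "compact S" unfolding S_def by (intro compact_insert compact_continuous_image) auto
  then have "finite {\<gamma>\<in>D. G_act \<gamma> ` S \<inter> S \<noteq> {}}" by (rule assms)
  moreover have "D \<inter> ball x 1 \<subseteq> {\<gamma>\<in>D. G_act \<gamma> ` S \<inter> S \<noteq> {}}"
    by (auto simp: S_def)
  ultimately have "finite (D \<inter> ball x 1)" by (rule rev_finite_subset)
  then show "x isolated_in D"
    using \<open>x \<in> D\<close> zero_less_one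
    by (auto simp: isolated_in_islimpt_iff islimpt_eq_infinite_ball simp del: zero_less_one)
qed

lemma admissible_fixed_point:
  assumes "admissible X W z" "G_act (hom_of (X, W, z) n) p = p"
  shows "n = 0"
proof -
  have "(W + (snd p + z \<bullet> real_vec n / 2) *\<^sub>R X) *v real_vec n = 0" "z \<bullet> real_vec n = 0"
    using assms(2) unfolding G_act_hom_of prod_eq_iff fst_conv snd_conv
    by (metis add_cancel_left_right)+
  then have "real_vec n = 0" using assms(1) unfolding admissible_def by blast
  then show ?thesis by (simp add: real_vec_eq_0_iff)
qed

text \<open>Rounding the multiples of a real kernel vector to integer vectors produces infinitely many
  group elements of bounded displacement.\<close>

lemma proper_imp_admissible:
  fixes X W :: "real ^ 'k::finite ^ 'k"
  assumes fin: "\<And>S. compact S \<Longrightarrow> finite {n. G_act (hom_of (X, W, z) n) ` S \<inter> S \<noteq> {}}"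
  shows "admissible X W z"
  unfolding admissible_def
proof (intro allI impI, elim conjE)
  fix t v assume v: "(W + t *\<^sub>R X) *v v = 0" "z \<bullet> v = 0"
  show "v = 0"
  proof (rule ccontr)
    assume "v \<noteq> 0"
    define c where "c = real CARD('k)"
    define nn :: "nat \<Rightarrow> int ^ 'k" where "nn m = (\<chi> i. \<lfloor>real m * v $ i\<rfloor>)" for m
    define r where "r m = real m *\<^sub>R v - real_vec (nn m)" for m
    have rn: "real_vec (nn m) = real m *\<^sub>R v - r m" for m by (simp add: r_def)
    have r: "norm (r m) \<le> c" for m
    proof -
      have "norm (r m) \<le> (\<Sum>i\<in>UNIV. \<bar>r m $ i\<bar>)" by (rule norm_le_l1_cart)
      also have "\<dots> \<le> (\<Sum>i\<in>(UNIV :: 'k set). 1)"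
        by (rule sum_mono) (simp add: r_def nn_def real_vec_def, linarith)
      finally show ?thesis by (simp add: c_def)
    qed
    have "bounded_linear ((*v) (W + t *\<^sub>R X))" by simp
    then obtain B where B: "\<And>u. norm ((W + t *\<^sub>R X) *v u) \<le> norm u * B" "B > 0"
      using bounded_linear.pos_bounded by blast
    \<comment> \<open>Room for the height \<open>t\<close>, for its shift by
      \<open>z \<bullet> real_vec (nn m)\<close> and for the displacement; the last two see only the
      rounding error \<open>r m\<close>.\<close>
    define C where "C = \<bar>t\<bar> + norm z * c + c * B"
    have "c \<ge> 0" by (simp add: c_def)
    have in_S: "G_act (hom_of (X, W, z) (nn m)) ` cball 0 C \<inter> cball 0 C \<noteq> {}" for m
    proof -
      define s where "s = z \<bullet> real_vec (nn m)"
      have "s = - (z \<bullet> r m)" by (simp add: s_def rn inner_diff_right v)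
      then have s: "\<bar>s\<bar> \<le> norm z * c"
        using Cauchy_Schwarz_ineq2 [of z "r m"] mult_left_mono [OF r [of m], of "norm z"] by simp
      have d: "(W + t *\<^sub>R X) *v real_vec (nn m) = - ((W + t *\<^sub>R X) *v r m)"
        by (simp only: rn matrix_vector_mult_diff_distrib matrix_vector_mult_scaleR v) simp
      have dn: "norm ((W + t *\<^sub>R X) *v real_vec (nn m)) \<le> c * B"
        unfolding d norm_minus_cancel
        using B(1) [of "r m"] mult_right_mono [OF r [of m], of B] B(2) by linarith
      \<comment> \<open>Height \<open>t - s / 2\<close> puts the midpoint of the motion at
        \<open>t\<close>, where the pencil annihilates \<open>v\<close>.\<close>
      define p :: "(real ^ 'k) \<times> real" where "p = (0, t - s / 2)"
      have q: "G_act (hom_of (X, W, z) (nn m)) p = ((W + t *\<^sub>R X) *v real_vec (nn m), t + s / 2)"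
        by (simp add: G_act_hom_of p_def flip: s_def)
      have "c * B \<ge> 0" "norm z * c \<ge> 0" using B(2) \<open>c \<ge> 0\<close> by auto
      then have "norm p \<le> C" unfolding p_def C_def norm_Pair1 norm_Pair2
        using s by (simp add: norm_Pair2)
      moreover have "norm (G_act (hom_of (X, W, z) (nn m)) p) \<le> C"
        unfolding q using norm_Pair_le [of "(W + t *\<^sub>R X) *v real_vec (nn m)" "t + s / 2"] dn s
        by (simp add: C_def)
      ultimately have "p \<in> cball 0 C" "G_act (hom_of (X, W, z) (nn m)) p \<in> cball 0 C" by auto
      then show ?thesis by blast
    qed
    then have "finite (range nn)"
      using fin [of "cball 0 C"] by (auto intro: rev_finite_subset)
    then have "finite ((\<lambda>n. norm (real_vec n)) ` range nn)" by simp
    then obtain M where M: "\<And>m. norm (real_vec (nn m)) \<le> M"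
      by (meson bdd_above.unfold bdd_above_finite rangeI imageI)
    obtain m :: nat where "real m > (M + c) / norm v" using reals_Archimedean2 by blast
    then have "real m * norm v > M + c" using \<open>v \<noteq> 0\<close> by (simp add: field_simps)
    moreover have "real m * norm v \<le> norm (real_vec (nn m)) + norm (r m)"
      using norm_triangle_ineq [of "real_vec (nn m)" "r m"] by (simp add: r_def)
    ultimately show False using M [of m] r [of m] by linarith
  qed
qed

lemma hom_of_in_R_set_iff:
  assumes "commuting X z"
  shows "hom_of (X, W, z) \<in> R_set \<longleftrightarrow> admissible X W z"
proof
  assume R: "hom_of (X, W, z) \<in> R_set"
  show "admissible X W z"
  proof (rule proper_imp_admissible)
    fix S :: "((real ^ 'a) \<times> real) set" assume "compact S"
    then have "finite {\<gamma> \<in> range (hom_of (X, W, z)). G_act \<gamma> ` S \<inter> S \<noteq> {}}"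
      using R by (auto simp: R_set_def acts_properly_discontinuously_def)
    moreover have "inj (hom_of (X, W, z))" using R by (auto simp: R_set_def)
    \<comment> \<open>Injectivity turns finiteness for group elements into finiteness for lattice
      vectors.\<close>
    ultimately have "finite (hom_of (X, W, z) -` {\<gamma> \<in> range (hom_of (X, W, z)). G_act \<gamma> ` S \<inter> S \<noteq> {}})"
      by (rule finite_vimageI)
    then show "finite {n. G_act (hom_of (X, W, z) n) ` S \<inter> S \<noteq> {}}"
      by (simp add: vimage_def)
  qed
next
  assume adm: "admissible X W z"
  let ?\<phi> = "hom_of (X, W, z)"
  have hom: "?\<phi> \<in> hom Zk_group G_group" using assms by (rule hom_of_hom)
  have pd: "finite {\<gamma> \<in> range ?\<phi>. G_act \<gamma> ` S \<inter> S \<noteq> {}}" if "compact S" for S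
  proof -
    have "{\<gamma> \<in> range ?\<phi>. G_act \<gamma> ` S \<inter> S \<noteq> {}} = ?\<phi> ` {n. G_act (?\<phi> n) ` S \<inter> S \<noteq> {}}" by auto
    then show ?thesis using admissible_proper [OF adm that] by simp
  qed
  have one: "?\<phi> 0 = \<one>\<^bsub>G_group\<^esub>"
    by (simp add: hom_of_def G_group_def G_mat_one real_vec_def flip: zero_vec_def)
  have "inj ?\<phi>"
  proof (rule injI)
    fix m n assume eq: "?\<phi> m = ?\<phi> n"
    have car: "?\<phi> i \<in> carrier G_group" for i by (auto simp: hom_of_def G_group_def)
    have "?\<phi> (m - n) \<otimes>\<^bsub>G_group\<^esub> ?\<phi> n = ?\<phi> n"
      using hom_mult [OF hom, of "m - n" n] eq by (simp add: Zk_group_def)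
    \<comment> \<open>The element belonging to \<open>m - n\<close> fixes a point, and admissibility
      allows this for the zero vector only.\<close>
    then have "G_act (?\<phi> (m - n)) (G_act (?\<phi> n) 0) = G_act (?\<phi> n) 0"
      using G_act_mult [OF car car] by metis
    then show "m = n" using admissible_fixed_point [OF adm] by fastforce
  qed
  moreover have "acts_freely (range ?\<phi>)"
    unfolding acts_freely_def using admissible_fixed_point [OF adm] one by blast
  moreover have "acts_properly_discontinuously (range ?\<phi>)"
    unfolding acts_properly_discontinuously_def
    using properly_discontinuous_imp_discrete [of "range ?\<phi>"] pd by blast
  ultimately show "?\<phi> \<in> R_set" using hom by (simp add: R_set_def)
qed

section \<open>The quotient map from coordinates\<close>

definition R_par :: "'k::finite par set" where
  "R_par = {(X, W, z). commuting X z \<and> admissible X W z}"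

lemma continuous_on_if_const:
  "(b \<Longrightarrow> continuous_on S f) \<Longrightarrow> (\<not> b \<Longrightarrow> continuous_on S g) \<Longrightarrow>
    continuous_on S (\<lambda>x. if b then f x else g x)"
  by (cases b) auto

text \<open>Moves the whole problem into a subset of a Euclidean space. The topology of
  \<open>Hom_top\<close> is pulled back from the values on generators, so continuity is checked
  there in both directions.\<close>

lemma homeomorphic_maps_R_par:
  "homeomorphic_maps (top_of_set (R_par :: 'k::finite par set)) (subtopology Hom_top R_set) hom_of par_of"
  unfolding homeomorphic_maps_def
proof (intro conjI)
  have R_hom: "R_set \<subseteq> hom Zk_group (G_group :: 'k sqmat monoid)" by (auto simp: R_set_def)
  have top: "topspace (Hom_top :: (int ^ 'k \<Rightarrow> 'k sqmat) topology) = hom Zk_group G_group"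
    by (auto simp: Hom_top_def topspace_pullback_topology PiE_UNIV_domain hom_def Zk_group_def)
  have mem: "hom_of p \<in> R_set" if "p \<in> R_par" for p :: "'k par"
    using that by (auto simp: R_par_def hom_of_in_R_set_iff)
  have mem': "par_of \<phi> \<in> R_par \<and> hom_of (par_of \<phi>) = \<phi>" if "\<phi> \<in> R_set"
    for \<phi> :: "int ^ 'k \<Rightarrow> 'k sqmat"
  proof -
    obtain X W z where p: "par_of \<phi> = (X, W, z)" by (metis surj_pair)
    have "commuting X z" "\<phi> = hom_of (X, W, z)"
      using hom_is_hom_of [OF _ p] that R_hom by auto
    then show ?thesis using that p by (auto simp: R_par_def hom_of_in_R_set_iff)
  qed
  show "\<forall>x\<in>topspace (top_of_set R_par). par_of (hom_of x) = x" by (simp add: par_of_hom_of)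
  show "\<forall>y\<in>topspace (subtopology Hom_top R_set). hom_of (par_of y) = (y :: int ^ 'k \<Rightarrow> 'k sqmat)"
    using mem' by auto
  show "continuous_map (top_of_set R_par) (subtopology Hom_top R_set) (hom_of :: 'k par \<Rightarrow> _)"
    unfolding continuous_map_in_subtopology
  proof
    show "continuous_map (top_of_set R_par) Hom_top (hom_of :: 'k par \<Rightarrow> _)"
      unfolding Hom_top_def
    proof (rule continuous_map_pullback')
      show "topspace (top_of_set R_par) \<subseteq> hom_of -` hom Zk_group (G_group :: 'k sqmat monoid)"
        using mem R_hom by (simp add: subset_iff)
      have "continuous_map (top_of_set R_par) (top_of_set (carrier G_group))
          (\<lambda>p :: 'k par. hom_of p (axis j 1))" for j
      proof -
        have "continuous_on R_par (\<lambda>p :: 'k par. hom_of p (axis j 1))"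
          unfolding hom_of_def case_prod_beta G_mat_def
        proof (intro continuous_on_vec_lambda)
          fix i l :: "'k + bool"
          show "continuous_on R_par (\<lambda>p :: 'k par. case i of
             Inl a \<Rightarrow> (case l of Inl b \<Rightarrow> if a = b then 1 else 0
               | Inr t \<Rightarrow> if t then (fst (snd p) *v real_vec (axis j 1) +
                   (snd (snd p) \<bullet> real_vec (axis j 1) / 2) *\<^sub>R (fst p *v real_vec (axis j 1))) $ a
                 else (fst p *v real_vec (axis j 1)) $ a)
             | Inr s \<Rightarrow> (case l of Inl b \<Rightarrow> 0
               | Inr t \<Rightarrow> if s = t then 1 else if t then snd (snd p) \<bullet> real_vec (axis j 1) else 0))"
            by (cases i; cases l) (auto intro!: continuous_on_if_const continuous_intros)
        qed
        then show ?thesis by (auto simp: hom_of_def G_group_def)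
      qed
      then show "continuous_map (top_of_set R_par)
          (product_topology (\<lambda>j. top_of_set (carrier G_group)) UNIV)
          ((\<lambda>\<phi> j. \<phi> (axis j 1)) \<circ> (hom_of :: 'k par \<Rightarrow> _))"
        by (simp add: continuous_map_componentwise_UNIV o_def)
    qed
    show "hom_of \<in> topspace (top_of_set R_par) \<rightarrow> (R_set :: (int ^ 'k \<Rightarrow> 'k sqmat) set)"
      using mem by auto
  qed
  show "continuous_map (subtopology Hom_top R_set) (top_of_set R_par) (par_of :: _ \<Rightarrow> 'k par)"
    unfolding continuous_map_in_subtopology
  proof
    have coord: "continuous_map (Hom_top :: (int ^ 'k \<Rightarrow> 'k sqmat) topology) euclidean
        ((\<lambda>f. f j) \<circ> (\<lambda>\<phi> j. \<phi> (axis j 1)))" for j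
      unfolding Hom_top_def
    proof (rule continuous_map_pullback)
      show "continuous_map (product_topology (\<lambda>j :: 'k. top_of_set (carrier (G_group :: 'k sqmat monoid))) UNIV)
          euclidean (\<lambda>f. f j)"
        using continuous_map_product_projection [of j UNIV "\<lambda>j. top_of_set (carrier (G_group :: 'k sqmat monoid))"]
        by (auto simp: continuous_map_in_subtopology)
    qed
    define h :: "('k \<Rightarrow> 'k sqmat) \<Rightarrow> 'k par" where
      "h f = ((\<chi> i j. x_part (f j) $ i), (\<chi> i j. y_part (f j) $ i - z_part (f j) / 2 * x_part (f j) $ i),
          (\<chi> j. z_part (f j)))" for f
    have hc: "continuous_map euclidean euclidean h"
      unfolding h_def x_part_def y_part_def z_part_def
      by (simp, intro continuous_intros continuous_on_product_coordinates continuous_on_subset [OF continuous_on_product_coordinates]) auto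
    have "continuous_map (Hom_top :: (int ^ 'k \<Rightarrow> 'k sqmat) topology) euclidean (\<lambda>\<phi> j. \<phi> (axis j 1))"
      unfolding euclidean_product_topology [symmetric] continuous_map_componentwise_UNIV
      using coord by (simp add: o_def)
    from continuous_map_compose [OF this hc]
    have "continuous_map Hom_top euclidean (par_of :: _ \<Rightarrow> 'k par)"
      by (simp add: o_def h_def par_of_def [abs_def])
    then show "continuous_map (subtopology Hom_top R_set) euclidean (par_of :: _ \<Rightarrow> 'k par)"
      by (rule continuous_map_from_subtopology)
    show "par_of \<in> topspace (subtopology Hom_top R_set) \<rightarrow> (R_par :: 'k par set)"
      using mem' by auto
  qed
qed

text \<open>\<open>b\<close> drops out because the elements \<open>G_mat 0 b 0\<close> are
  central.\<close>

lemma conj_act_hom_of: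
  "conj_act (G_mat a b c) (hom_of (X, W, z)) = hom_of (X, W + outer a z - c *\<^sub>R X, z)"
proof
  fix n
  have inv: "inv\<^bsub>G_group\<^esub> (G_mat a b c) = G_mat (- a) (c *\<^sub>R a - b) (- c)"
    by (rule group.inv_equality [OF group_G_group])
       (auto simp: G_group_def G_mat_mult G_mat_one)
  show "conj_act (G_mat a b c) (hom_of (X, W, z)) n = hom_of (X, W + outer a z - c *\<^sub>R X, z) n"
    unfolding conj_act_def inv
    by (simp add: hom_of_def G_group_def G_mat_mult matrix_vector_mult_add_rdistrib
        matrix_vector_mult_diff_rdistrib outer_mult_vec algebra_simps
        flip: scaleR_matrix_vector_assoc)
qed

definition orbit_of :: "'k::finite par \<Rightarrow> (int ^ 'k \<Rightarrow> 'k sqmat) set" where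
  "orbit_of p = conj_orbit (hom_of p)"

lemma orbit_of_eq: "orbit_of (X, W, z) = {hom_of (X, W + outer a z - c *\<^sub>R X, z) | a c. True}"
proof -
  have "orbit_of (X, W, z) = {conj_act (G_mat a b c) (hom_of (X, W, z)) | a b c. True}"
    unfolding orbit_of_def conj_orbit_def G_group_def by auto
  then show ?thesis unfolding conj_act_hom_of by blast
qed

lemma orbit_of_eq_iff:
  "orbit_of (X, W, z) = orbit_of (X', W', z') \<longleftrightarrow>
     X' = X \<and> z' = z \<and> (\<exists>a c. W' = W + outer a z - c *\<^sub>R X)"
proof
  assume eq: "orbit_of (X, W, z) = orbit_of (X', W', z')"
  have "hom_of (X', W' + outer 0 z' - 0 *\<^sub>R X', z') \<in> orbit_of (X', W', z')"
    unfolding orbit_of_eq by blast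
  moreover have "outer 0 z' = 0" by (simp add: outer_def vec_eq_iff)
  ultimately have "hom_of (X', W', z') \<in> orbit_of (X, W, z)" using eq by simp
  then obtain a c where "hom_of (X', W', z') = hom_of (X, W + outer a z - c *\<^sub>R X, z)"
    unfolding orbit_of_eq by blast
  then have "(X', W', z') = (X, W + outer a z - c *\<^sub>R X, z)" by (metis par_of_hom_of)
  then show "X' = X \<and> z' = z \<and> (\<exists>a c. W' = W + outer a z - c *\<^sub>R X)" by auto
next
  assume "X' = X \<and> z' = z \<and> (\<exists>a c. W' = W + outer a z - c *\<^sub>R X)"
  then obtain a c where "X' = X" "z' = z" and W': "W' = W + outer a z - c *\<^sub>R X" by blast
  have o: "outer (a + b) z = outer a z + outer b z" "outer (a - b) z = outer a z - outer b z" for a b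
    by (auto simp: outer_def vec_eq_iff algebra_simps)
  have 1: "W' + outer a' z - c' *\<^sub>R X = W + outer (a + a') z - (c + c') *\<^sub>R X" for a' c'
    by (simp add: W' o algebra_simps)
  have 2: "W + outer a' z - c' *\<^sub>R X = W' + outer (a' - a) z - (c' - c) *\<^sub>R X" for a' c'
    by (simp add: W' o algebra_simps)
  show "orbit_of (X, W, z) = orbit_of (X', W', z')"
    unfolding orbit_of_eq \<open>X' = X\<close> \<open>z' = z\<close> using 1 2 by (metis (no_types, lifting))
qed

lemma quotient_map_orbit_of:
  "quotient_map (top_of_set (R_par :: 'k::finite par set)) deformation_space orbit_of"
proof -
  have "quotient_map (top_of_set (R_par :: 'k par set)) (subtopology Hom_top R_set) hom_of"
    using homeomorphic_maps_R_par homeomorphic_map_maps homeomorphic_map_def by blast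
  then have "quotient_map (top_of_set (R_par :: 'k par set)) deformation_space (conj_orbit \<circ> hom_of)"
    unfolding deformation_space_def by (rule quotient_map_compose) (rule quotient_map_quotient_topology)
  then show ?thesis by (simp add: o_def orbit_of_def [abs_def])
qed

section \<open>Charts and smooth manifolds\<close>

lemma Euclidean_space_eq_top_of_set: "Euclidean_space m = top_of_set {x. \<forall>i\<ge>m. x i = 0}"
  by (simp add: Euclidean_space_def euclidean_product_topology)

lemma homeomorphic_maps_coordinate_subspace:
  fixes K :: "'e::euclidean_space set"
  assumes "K \<subseteq> Basis"
  obtains enc dec where
    "homeomorphic_maps (top_of_set {x. \<forall>i\<in>K. x \<bullet> i = 0}) (Euclidean_space (DIM('e) - card K)) enc dec"
proof -
  define B where "B = Basis - K"
  define m where "m = DIM('e) - card K"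
  have "finite B" by (simp add: B_def)
  have "card B = m" using assms by (simp add: B_def m_def card_Diff_subset finite_subset)
  then obtain e where e: "bij_betw e {..<m} B"
    using ex_bij_betw_nat_finite [OF \<open>finite B\<close>] by (auto simp: atLeast0LessThan)
  have eB: "e n \<in> Basis" "e n \<notin> K" if "n < m" for n
    using bij_betwE [OF e] that by (auto simp: B_def)
  have ee: "e n \<bullet> e n' = (if n = n' then 1 else 0)" if "n < m" "n' < m" for n n'
    using that eB inner_Basis bij_betw_imp_inj_on [OF e] by (auto simp: inj_on_def inner_Basis)
  define enc where "enc x = (\<lambda>n. if n < m then x \<bullet> e n else 0)" for x :: 'e
  define dec where "dec p = (\<Sum>n<m. p n *\<^sub>R e n)" for p
  have "homeomorphic_maps (top_of_set {x. \<forall>i\<in>K. x \<bullet> i = 0}) (Euclidean_space m) enc dec"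
    unfolding homeomorphic_maps_def Euclidean_space_eq_top_of_set
  proof (intro conjI)
    have "continuous_on UNIV enc"
      unfolding enc_def
    proof (rule continuous_on_coordinatewise_then_product)
      show "continuous_on UNIV (\<lambda>x. if n < m then x \<bullet> e n else 0)" for n
        by (cases "n < m") (auto intro!: continuous_intros)
    qed
    then show "continuous_map (top_of_set {x. \<forall>i\<in>K. x \<bullet> i = 0}) (top_of_set {x. \<forall>i\<ge>m. x i = 0}) enc"
      by (auto simp: enc_def intro: continuous_on_subset)
    have "continuous_on UNIV dec"
      unfolding dec_def
      by (intro continuous_intros continuous_on_product_coordinates)
    moreover have "dec p \<bullet> i = 0" if "i \<in> K" for i p
      unfolding dec_def inner_sum_left
    proof (rule sum.neutral, safe)
      fix n assume "n < m"
      then have "e n \<noteq> i" "e n \<in> Basis" "i \<in> Basis" using that eB [of n] assms by auto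
      then show "p n *\<^sub>R e n \<bullet> i = 0" by (simp add: inner_Basis)
    qed
    ultimately show "continuous_map (top_of_set {x. \<forall>i\<ge>m. x i = 0}) (top_of_set {x. \<forall>i\<in>K. x \<bullet> i = 0}) dec"
      by (auto intro: continuous_on_subset)
    show "\<forall>x\<in>topspace (top_of_set {x. \<forall>i\<in>K. x \<bullet> i = 0}). dec (enc x) = x"
    proof
      fix x assume "x \<in> topspace (top_of_set {x :: 'e. \<forall>i\<in>K. x \<bullet> i = 0})"
      then have x: "\<forall>i\<in>K. x \<bullet> i = 0" by simp
      have "dec (enc x) = (\<Sum>n<m. (x \<bullet> e n) *\<^sub>R e n)" by (simp add: dec_def enc_def)
      also have "\<dots> = (\<Sum>i\<in>B. (x \<bullet> i) *\<^sub>R i)"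
        by (rule sum.reindex_bij_betw [OF e, of "\<lambda>i. (x \<bullet> i) *\<^sub>R i"])
      also have "\<dots> = (\<Sum>i\<in>Basis. (x \<bullet> i) *\<^sub>R i)"
        by (rule sum.mono_neutral_left) (auto simp: B_def x)
      finally show "dec (enc x) = x" by (simp add: euclidean_representation)
    qed
    show "\<forall>y\<in>topspace (top_of_set {x. \<forall>i\<ge>m. x i = 0}). enc (dec y) = y"
    proof
      fix y :: "nat \<Rightarrow> real" assume "y \<in> topspace (top_of_set {x. \<forall>i\<ge>m. x i = 0})"
      then have y: "y i = 0" if "i \<ge> m" for i using that by simp
      have "dec y \<bullet> e n = y n" if "n < m" for n
      proof -
        have "dec y \<bullet> e n = (\<Sum>l<m. y l * (e l \<bullet> e n))" by (simp add: dec_def inner_sum_left)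
        also have "\<dots> = (\<Sum>l<m. if l = n then y n else 0)"
          using that by (intro sum.cong) (auto simp: ee)
        finally show ?thesis using that by simp
      qed
      then show "enc (dec y) = y" by (auto simp: enc_def y)
    qed
  qed
  then show ?thesis using that by (simp add: m_def)
qed

text \<open>\<open>F\<close> computes a normal form that is constant on the fibres of
  \<open>Q\<close>, and \<open>S\<close> picks a representative for each normal form. Restricted to
  an open saturated set, \<open>Q\<close> is still a quotient map, so \<open>F\<close> descends to a
  homeomorphism with inverse \<open>Q \<circ> S\<close>. \<open>K\<close> collects the coordinates
  that the normal form fixes at zero.\<close>

lemma chart_of_section:
  fixes Q :: "'p::topological_space \<Rightarrow> 'd" and K :: "'e::euclidean_space set"
  assumes Q: "quotient_map (top_of_set R) D Q"
    and R': "openin (top_of_set R) R'" "R' \<noteq> {}"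
    and saturated: "\<And>p p'. p \<in> R' \<Longrightarrow> p' \<in> R \<Longrightarrow> Q p = Q p' \<Longrightarrow> p' \<in> R'"
    and K: "K \<subseteq> Basis"
    and V: "openin (top_of_set {x. \<forall>i\<in>K. x \<bullet> i = 0}) V"
    and F: "continuous_on R' F" "F ` R' \<subseteq> V"
      "\<And>p p'. p \<in> R' \<Longrightarrow> p' \<in> R' \<Longrightarrow> Q p = Q p' \<Longrightarrow> F p = F p'"
    and S: "continuous_on V S" "S ` V \<subseteq> R'" "\<And>v. v \<in> V \<Longrightarrow> F (S v) = v"
      "\<And>p. p \<in> R' \<Longrightarrow> Q (S (F p)) = Q p"
  shows "\<exists>\<phi>. is_chart D (DIM('e) - card K, Q ` R', \<phi>)"
proof -
  define L where "L = {x. \<forall>i\<in>K. x \<bullet> i = 0}"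
  define m where "m = DIM('e) - card K"
  define U where "U = Q ` R'"
  have "R' \<subseteq> R" using R'(1) openin_imp_subset by blast
  have "V \<subseteq> L" using openin_imp_subset [OF V] by (simp add: L_def)
  have pre: "{x \<in> topspace (top_of_set R). Q x \<in> U} = R'"
    using \<open>R' \<subseteq> R\<close> saturated by (auto simp: U_def)
  have "U \<subseteq> topspace D" using Q \<open>R' \<subseteq> R\<close> by (auto simp: U_def quotient_map_def)
  then have "openin D U"
    using Q R'(1) unfolding quotient_map_def by (metis pre)
  have QU: "quotient_map (top_of_set R') (subtopology D U) Q"
    using quotient_map_restriction [OF Q pre] \<open>openin D U\<close> \<open>R' \<subseteq> R\<close>
    by (simp add: subtopology_subtopology inf.absorb2)
  \<comment> \<open>Any representative may be chosen: \<open>F(3)\<close> makes the value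
    independent of it.\<close>
  define G where "G u = F (SOME p. p \<in> R' \<and> Q p = u)" for u
  have GQ: "G (Q p) = F p" if "p \<in> R'" for p
  proof -
    have "(SOME q. q \<in> R' \<and> Q q = Q p) \<in> R' \<and> Q (SOME q. q \<in> R' \<and> Q q = Q p) = Q p"
      by (rule someI [where x = p]) (simp add: that)
    then show ?thesis unfolding G_def using F(3) that by blast
  qed
  have G: "homeomorphic_maps (subtopology D U) (top_of_set V) G (Q \<circ> S)"
    unfolding homeomorphic_maps_def
  proof (intro conjI)
    have "continuous_map (top_of_set R') (top_of_set V) (G \<circ> Q)"
    proof (rule continuous_map_eq)
      show "continuous_map (top_of_set R') (top_of_set V) F" using F(1,2) by auto
    qed (simp add: GQ)
    then show "continuous_map (subtopology D U) (top_of_set V) G"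
      by (rule continuous_compose_quotient_map [OF QU])
    have "continuous_map (top_of_set V) (top_of_set R') S" using S(1,2) by auto
    then show "continuous_map (top_of_set V) (subtopology D U) (Q \<circ> S)"
      by (rule continuous_map_compose) (rule quotient_imp_continuous_map [OF QU])
    have "(Q \<circ> S) (G (Q p)) = Q p" if "p \<in> R'" for p using S(4) GQ that by simp
    then show "\<forall>x\<in>topspace (subtopology D U). (Q \<circ> S) (G x) = x"
      unfolding U_def topspace_subtopology by blast
    show "\<forall>y\<in>topspace (top_of_set V). G ((Q \<circ> S) y) = y"
      using S(2,3) GQ by (simp add: image_subset_iff)
  qed
  obtain enc dec where ed: "homeomorphic_maps (top_of_set L) (Euclidean_space m) enc dec"
    unfolding L_def m_def by (rule homeomorphic_maps_coordinate_subspace [OF K])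
  then have encL: "homeomorphic_map (top_of_set L) (Euclidean_space m) enc"
    using homeomorphic_map_maps by blast
  have "enc ` L = topspace (Euclidean_space m)"
    using homeomorphic_imp_surjective_map [OF encL] by simp
  then have "enc ` V \<subseteq> topspace (Euclidean_space m)" using \<open>V \<subseteq> L\<close> by blast
  then have "homeomorphic_map (subtopology (top_of_set L) V) (subtopology (Euclidean_space m) (enc ` V)) enc"
    using \<open>V \<subseteq> L\<close> by (intro homeomorphic_map_subtopologies [OF encL]) (simp add: inf.absorb2)
  then have encV: "homeomorphic_map (top_of_set V) (subtopology (Euclidean_space m) (enc ` V)) enc"
    using \<open>V \<subseteq> L\<close> by (simp add: subtopology_subtopology inf.absorb2)
  have "homeomorphic_map (subtopology D U) (top_of_set V) G"
    using G homeomorphic_map_maps by blast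
  then have chart: "homeomorphic_map (subtopology D U) (subtopology (Euclidean_space m) (enc ` V)) (enc \<circ> G)"
    using encV by (rule homeomorphic_map_compose)
  have GU: "G ` U = V"
  proof -
    have "v \<in> F ` R'" if "v \<in> V" for v
      using S(2) S(3) [OF that] that by (metis image_eqI image_subset_iff)
    then have "F ` R' = V" using F(2) by blast
    then show ?thesis unfolding U_def image_image using GQ by simp
  qed
  have "openin (Euclidean_space m) (enc ` V)"
    using homeomorphic_map_openness [OF encL, of V] V \<open>V \<subseteq> L\<close> unfolding L_def [symmetric] by simp
  moreover have "(enc \<circ> G) ` U = enc ` V" by (metis GU image_comp)
  moreover have "U \<noteq> {}" using R'(2) by (simp add: U_def)
  ultimately have "is_chart D (m, U, enc \<circ> G)"
    unfolding is_chart_def using \<open>openin D U\<close> chart by simp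
  then show ?thesis by (auto simp: m_def U_def)
qed

lemma is_chart_subtopology:
  assumes "is_chart X (m, U, \<phi>)" "U \<subseteq> T"
  shows "is_chart (subtopology X T) (m, U, \<phi>)"
proof -
  have "openin X U" using assms(1) by (simp add: is_chart_def)
  then have "openin (subtopology X T) U"
    using assms(2) by (metis inf.absorb_iff2 openin_subtopology_Int2)
  then show ?thesis
    using assms by (simp add: is_chart_def subtopology_subtopology inf.absorb2)
qed

section \<open>Smoothness of identity transition maps\<close>

lemma C_diff_on_const: "C_diff_on r m U (\<lambda>_. c)"
proof (induction r arbitrary: c)
  case (Suc r)
  then show ?case by (auto intro!: exI [of _ "\<lambda>_ _. 0"])
qed simp

lemma C_diff_on_empty: "C_diff_on r m {} f"
  by (induction r arbitrary: f) auto

text \<open>Applied to the components of an identity transition map. Agreement is assumed on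
  \<open>U\<close> only, since such a map is arbitrary elsewhere.\<close>

lemma C_diff_on_coordinate:
  assumes U: "openin (Euclidean_space m) U" and f: "\<And>p. p \<in> U \<Longrightarrow> f p = p j"
  shows "C_diff_on r m U f"
proof -
  have cont: "continuous_map (subtopology (Euclidean_space m) U) euclideanreal f"
  proof (rule continuous_map_eq)
    show "continuous_map (subtopology (Euclidean_space m) U) euclideanreal (\<lambda>p. p j)"
      unfolding Euclidean_space_def
      by (intro continuous_map_from_subtopology continuous_map_product_projection) auto
  qed (simp add: f)
  show ?thesis
  proof (cases r)
    case (Suc r')
    obtain O' where O': "open O'" "U = {x. \<forall>i\<ge>m. x i = 0} \<inter> O'"
      using U by (auto simp: Euclidean_space_eq_top_of_set openin_open)
    \<comment> \<open>\<open>U\<close> is open only in the coordinate subspace, but varying a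
      coordinate \<open>i < m\<close> stays in that subspace, so the line through \<open>p\<close>
      remains in \<open>U\<close> for parameters near \<open>p i\<close>.\<close>
    have "((\<lambda>t. f (p(i := t))) has_real_derivative (if i = j then 1 else 0)) (at (p i))"
      if "p \<in> U" "i < m" for p i
    proof (rule has_field_derivative_transform_within_open)
      have "continuous_on UNIV (\<lambda>t. p(i := t))"
        by (rule continuous_on_coordinatewise_then_product)
           (auto simp: fun_upd_def intro!: continuous_on_if_const continuous_intros)
      then show "open ((\<lambda>t. p(i := t)) -` O')" using O'(1) by (rule open_vimage [rotated])
      show "p i \<in> (\<lambda>t. p(i := t)) -` O'" using that O' by simp
      show "((\<lambda>t. (p(i := t)) j) has_real_derivative (if i = j then 1 else 0)) (at (p i))"
        by (cases "i = j") (auto intro!: derivative_eq_intros)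
      show "(p(i := t)) j = f (p(i := t))" if "t \<in> (\<lambda>t. p(i := t)) -` O'" for t
      proof -
        have "p(i := t) \<in> U" using that \<open>p \<in> U\<close> \<open>i < m\<close> by (simp add: O'(2))
        then show ?thesis by (rule f [symmetric])
      qed
    qed
    then show ?thesis
      unfolding Suc C_diff_on.simps using cont
      by (intro conjI exI [of _ "\<lambda>i _. if i = j then 1 else 0"]) (auto intro: C_diff_on_const)
  qed (simp add: cont)
qed

section \<open>Separation and countability inherited from charts\<close>

lemma is_chart_inj_on: "is_chart X (m, U, \<phi>) \<Longrightarrow> inj_on \<phi> U"
proof -
  assume "is_chart X (m, U, \<phi>)"
  then have "openin X U" and
    "homeomorphic_map (subtopology X U) (subtopology (Euclidean_space m) (\<phi> ` U)) \<phi>"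
    by (simp_all add: is_chart_def)
  then show ?thesis
    using homeomorphic_imp_injective_map [of "subtopology X U"] openin_subset [of X U]
    by (simp add: inf.absorb2)
qed

lemma is_chart_Hausdorff:
  assumes "is_chart X (m, U, \<phi>)"
  shows "Hausdorff_space (subtopology X U)"
proof -
  have "Hausdorff_space (subtopology (Euclidean_space m) (\<phi> ` U))"
    unfolding Euclidean_space_eq_top_of_set
    by (intro Hausdorff_space_subtopology Hausdorff_space_euclidean)
  moreover have "subtopology X U homeomorphic_space subtopology (Euclidean_space m) (\<phi> ` U)"
    using assms homeomorphic_map_imp_homeomorphic_space unfolding is_chart_def by blast
  ultimately show ?thesis using homeomorphic_Hausdorff_space by blast
qed

lemma is_chart_countable_base:
  assumes c: "is_chart X (m, U, \<phi>)"
  obtains \<B> where "countable \<B>" "\<And>V. V \<in> \<B> \<Longrightarrow> openin X V"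
    "\<And>O' x. openin X O' \<Longrightarrow> x \<in> O' \<Longrightarrow> x \<in> U \<Longrightarrow> \<exists>V\<in>\<B>. x \<in> V \<and> V \<subseteq> O'"
proof -
  obtain B :: "(nat \<Rightarrow> real) set set" where B: "countable B" "topological_basis B"
    using ex_countable_basis by blast
  have U: "openin X U" "U \<subseteq> topspace X" and
    hom: "homeomorphic_map (subtopology X U) (subtopology (Euclidean_space m) (\<phi> ` U)) \<phi>"
    using c by (auto simp: is_chart_def openin_subset)
  define \<B> where "\<B> = (\<lambda>b. {x \<in> U. \<phi> x \<in> b}) ` B"
  have sub: "\<phi> ` U \<subseteq> {x. \<forall>i\<ge>m. x i = 0}"
    using c openin_subset [of "Euclidean_space m" "\<phi> ` U"]
    by (simp add: is_chart_def topspace_Euclidean_space)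
  have E: "openin (subtopology (Euclidean_space m) (\<phi> ` U)) (\<phi> ` U \<inter> b)" if "open b" for b
  proof -
    have "openin (Euclidean_space m) ({x. \<forall>i\<ge>m. x i = 0} \<inter> b)"
      unfolding Euclidean_space_eq_top_of_set using that by (rule openin_open_Int)
    then have "openin (subtopology (Euclidean_space m) (\<phi> ` U)) (\<phi> ` U \<inter> ({x. \<forall>i\<ge>m. x i = 0} \<inter> b))"
      by (rule openin_subtopology_Int2)
    moreover have "\<phi> ` U \<inter> ({x. \<forall>i\<ge>m. x i = 0} \<inter> b) = \<phi> ` U \<inter> b" using sub by blast
    ultimately show ?thesis by simp
  qed
  show ?thesis
  proof
    show "countable \<B>" using B(1) by (simp add: \<B>_def)
    show "openin X V" if "V \<in> \<B>" for V
    proof -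
      obtain b where b: "b \<in> B" "V = {x \<in> U. \<phi> x \<in> b}" using \<open>V \<in> \<B>\<close> by (auto simp: \<B>_def)
      then have "open b" using B(2) topological_basis_open by blast
      have "openin (subtopology X U) {x \<in> topspace (subtopology X U). \<phi> x \<in> \<phi> ` U \<inter> b}"
        using homeomorphic_imp_continuous_map [OF hom] E [OF \<open>open b\<close>]
        by (rule openin_continuous_map_preimage)
      moreover have "{x \<in> topspace (subtopology X U). \<phi> x \<in> \<phi> ` U \<inter> b} = V"
        using U(2) b by auto
      ultimately show ?thesis using U(1) openin_open_subtopology by metis
    qed
    show "\<exists>V\<in>\<B>. x \<in> V \<and> V \<subseteq> O'" if O': "openin X O'" "x \<in> O'" "x \<in> U" for O' x
    proof -
      have "openin (subtopology X U) (U \<inter> O')" using O'(1) by (simp add: openin_subtopology_Int2)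
      then have "openin (subtopology (Euclidean_space m) (\<phi> ` U)) (\<phi> ` (U \<inter> O'))"
        using homeomorphic_map_openness [OF hom, of "U \<inter> O'"] U(2) by auto
      then obtain T where "openin (Euclidean_space m) T" "\<phi> ` (U \<inter> O') = T \<inter> \<phi> ` U"
        by (auto simp: openin_subtopology)
      then obtain T' where T': "open T'" "\<phi> ` (U \<inter> O') = ({x. \<forall>i\<ge>m. x i = 0} \<inter> T') \<inter> \<phi> ` U"
        by (auto simp: Euclidean_space_eq_top_of_set openin_open)
      have "\<phi> x \<in> \<phi> ` (U \<inter> O')" using O' by blast
      then have "\<phi> x \<in> T'" using T' by auto
      then obtain b where b: "b \<in> B" "\<phi> x \<in> b" "b \<subseteq> T'"
        using topological_basisE [OF B(2) T'(1)] by metis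
      have "{y \<in> U. \<phi> y \<in> b} \<subseteq> O'"
      proof safe
        fix y assume y: "y \<in> U" "\<phi> y \<in> b"
        then have "\<phi> y \<in> \<phi> ` (U \<inter> O')" using T' b(3) sub by blast
        then show "y \<in> O'" using is_chart_inj_on [OF c] y(1) by (auto simp: inj_on_def)
      qed
      then show ?thesis using b O'(3) by (auto simp: \<B>_def)
    qed
  qed
qed

text \<open>Each transition map is an identity or has empty domain. Points in different charts are
  separated by the chart domains themselves, and finitely many countable bases are united.\<close>

lemma smooth_manifold_of_disjoint_charts:
  assumes "finite \<A>" and charts: "\<And>c. c \<in> \<A> \<Longrightarrow> is_chart X c"
    and cover: "(\<Union>(m, U, \<phi>)\<in>\<A>. U) = topspace X"
    and disjoint: "\<And>m U \<phi> n V \<psi>. (m, U, \<phi>) \<in> \<A> \<Longrightarrow> (n, V, \<psi>) \<in> \<A> \<Longrightarrow>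
      (m, U, \<phi>) \<noteq> (n, V, \<psi>) \<Longrightarrow> U \<inter> V = {}"
    and dim: "\<And>m U \<phi>. (m, U, \<phi>) \<in> \<A> \<Longrightarrow> m \<le> d" "(d, U0, \<phi>0) \<in> \<A>"
  shows "smooth_manifold_of_dim X d"
  unfolding smooth_manifold_of_dim_def
proof (intro conjI exI)
  show "Hausdorff_space X"
    unfolding Hausdorff_space_def
  proof (intro allI impI, elim conjE)
    fix x y assume xy: "x \<in> topspace X" "y \<in> topspace X" "x \<noteq> y"
    obtain m U \<phi> where c1: "(m, U, \<phi>) \<in> \<A>" "x \<in> U"
      using xy(1) unfolding cover [symmetric] by blast
    obtain n V \<psi> where c2: "(n, V, \<psi>) \<in> \<A>" "y \<in> V"
      using xy(2) unfolding cover [symmetric] by blast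
    note c = c1 c2
    have U: "openin X U" and V: "openin X V"
      using charts [OF c1(1)] charts [OF c2(1)] by (simp_all add: is_chart_def)
    show "\<exists>A B. openin X A \<and> openin X B \<and> x \<in> A \<and> y \<in> B \<and> disjnt A B"
    proof (cases "(m, U, \<phi>) = (n, V, \<psi>)")
      case True
      have "Hausdorff_space (subtopology X U)" using is_chart_Hausdorff [OF charts [OF c(1)]] .
      then obtain A B where "openin (subtopology X U) A" "openin (subtopology X U) B"
        "x \<in> A" "y \<in> B" "disjnt A B"
        using xy c True unfolding Hausdorff_space_def topspace_subtopology by blast
      then show ?thesis using openin_open_subtopology [OF U] by auto
    next
      case False
      then have "disjnt U V" using disjoint c by (simp add: disjnt_def)
      then show ?thesis using U V c by blast
    qed
  qed
  show "second_countable_space X"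
  proof -
    have "\<forall>c\<in>\<A>. \<exists>\<B>. countable \<B> \<and> (\<forall>V\<in>\<B>. openin X V) \<and>
        (\<forall>O' x. openin X O' \<longrightarrow> x \<in> O' \<longrightarrow> x \<in> fst (snd c) \<longrightarrow> (\<exists>V\<in>\<B>. x \<in> V \<and> V \<subseteq> O'))"
    proof
      fix c assume "c \<in> \<A>"
      obtain m U \<phi> where c: "c = (m, U, \<phi>)" by (metis surj_pair)
      have "is_chart X (m, U, \<phi>)" using charts \<open>c \<in> \<A>\<close> c by simp
      from is_chart_countable_base [OF this]
      show "\<exists>\<B>. countable \<B> \<and> (\<forall>V\<in>\<B>. openin X V) \<and>
        (\<forall>O' x. openin X O' \<longrightarrow> x \<in> O' \<longrightarrow> x \<in> fst (snd c) \<longrightarrow> (\<exists>V\<in>\<B>. x \<in> V \<and> V \<subseteq> O'))"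
        unfolding c fst_conv snd_conv by metis
    qed
    from bchoice [OF this] obtain \<B> where \<B>: "\<forall>c\<in>\<A>. countable (\<B> c) \<and> (\<forall>V\<in>\<B> c. openin X V) \<and>
        (\<forall>O' x. openin X O' \<longrightarrow> x \<in> O' \<longrightarrow> x \<in> fst (snd c) \<longrightarrow> (\<exists>V\<in>\<B> c. x \<in> V \<and> V \<subseteq> O'))" ..
    show ?thesis
      unfolding second_countable_space_def
    proof (intro exI [of _ "\<Union>c\<in>\<A>. \<B> c"] conjI allI impI)
      show "countable (\<Union>c\<in>\<A>. \<B> c)" using countable_finite [OF \<open>finite \<A>\<close>] \<B> by blast
      show "\<forall>V\<in>(\<Union>c\<in>\<A>. \<B> c). openin X V" using \<B> by blast
      fix U x assume Ux: "openin X U \<and> x \<in> U"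
      then have "x \<in> topspace X" using openin_subset by blast
      then obtain c where c: "c \<in> \<A>" "x \<in> fst (snd c)" unfolding cover [symmetric] by force
      then have "\<exists>V\<in>\<B> c. x \<in> V \<and> V \<subseteq> U" using \<B> Ux by blast
      then show "\<exists>V\<in>(\<Union>c\<in>\<A>. \<B> c). x \<in> V \<and> V \<subseteq> U" using c(1) by blast
    qed
  qed
  show "smooth_atlas X \<A>"
    unfolding smooth_atlas_def
  proof (intro conjI cover)
    show "\<forall>c\<in>\<A>. is_chart X c" using charts by blast
    have "smooth_map_on m n (\<phi> ` (U \<inter> V)) (\<psi> \<circ> inv_into U \<phi>)"
      if c: "(m, U, \<phi>) \<in> \<A>" "(n, V, \<psi>) \<in> \<A>" for m U \<phi> n V \<psi>
    proof (cases "(m, U, \<phi>) = (n, V, \<psi>)")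
      case True
      have op: "openin (Euclidean_space m) (\<phi> ` U)"
        using charts [OF c(1)] by (simp add: is_chart_def)
      have eq: "(\<phi> \<circ> inv_into U \<phi>) p = p" if "p \<in> \<phi> ` U" for p
        using that by (simp add: f_inv_into_f)
      have "(\<phi> \<circ> inv_into U \<phi>) ` \<phi> ` U = \<phi> ` U" using eq by (rule image_cong [of _ _ _ id, simplified, OF refl])
      then have "(\<phi> \<circ> inv_into U \<phi>) ` \<phi> ` U \<subseteq> topspace (Euclidean_space m)"
        using openin_subset [OF op] by simp
      then show ?thesis
        using True C_diff_on_coordinate [OF op, of "\<lambda>p. (\<phi> \<circ> inv_into U \<phi>) p j" j for j] eq
        by (simp add: smooth_map_on_def)
    next
      case False
      then have "U \<inter> V = {}" using disjoint c by blast
      then show ?thesis by (simp add: smooth_map_on_def C_diff_on_empty)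
    qed
    then show "\<forall>(m, U, \<phi>)\<in>\<A>. \<forall>(n, V, \<psi>)\<in>\<A>. smooth_map_on m n (\<phi> ` (U \<inter> V)) (\<psi> \<circ> inv_into U \<phi>)"
      by auto
  qed
  show "\<forall>(m, U, \<phi>)\<in>\<A>. m \<le> d" using dim(1) by auto
  show "\<exists>(m, U, \<phi>)\<in>\<A>. m = d" using dim(2) by force
qed

section \<open>Nonsingular pencils\<close>

definition replace_col :: "'k::finite \<Rightarrow> real ^ 'k \<Rightarrow> real ^ 'k ^ 'k \<Rightarrow> real ^ 'k ^ 'k" where
  "replace_col b u M = (\<chi> i j. if j = b then u $ i else M $ i $ j)"

lemma det_replace_col_mult: "det (replace_col b (M *v x) M) = x $ b * det M"
  unfolding replace_col_def by (rule cramer_lemma)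

lemma replace_col_replace_col [simp]: "replace_col b u (replace_col b w M) = replace_col b u M"
  by (simp add: replace_col_def vec_eq_iff)

lemma column_replace_col [simp]: "column b (replace_col b u M) = u"
  by (simp add: replace_col_def vec_eq_iff column_def)

lemma replace_col_column [simp]: "replace_col b (column b M) M = M"
  by (simp add: replace_col_def vec_eq_iff column_def)

lemma replace_col_mult_vec:
  "replace_col b u M *v w = M *v w + w $ b *\<^sub>R (u - column b M)"
proof -
  have "(\<Sum>j\<in>UNIV. (if j = b then u $ i else M $ i $ j) * w $ j) =
      (\<Sum>j\<in>UNIV. M $ i $ j * w $ j) + w $ b * (u $ i - M $ i $ b)" for i
  proof -
    have "(\<Sum>j\<in>UNIV. (if j = b then u $ i else M $ i $ j) * w $ j) =
       (\<Sum>j\<in>UNIV. M $ i $ j * w $ j + (if j = b then w $ b * (u $ i - M $ i $ b) else 0))"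
      by (rule sum.cong) (auto simp: algebra_simps)
    then show ?thesis by (simp add: sum.distrib)
  qed
  then show ?thesis by (simp add: vec_eq_iff matrix_vector_mult_def replace_col_def column_def)
qed

lemma det_replace_col_scaleR: "det (replace_col b (s *\<^sub>R u) M) = s * det (replace_col b u M)"
proof -
  have "replace_col b u M *v axis b s = s *\<^sub>R u"
    by (simp add: replace_col_mult_vec)
       (simp add: vec_eq_iff matrix_vector_mult_def axis_def column_def
         if_distrib [of "\<lambda>c. _ * c"] algebra_simps cong: if_cong)
  then show ?thesis using det_replace_col_mult [of b "replace_col b u M" "axis b s"] by simp
qed

lemma det_nonzero_iff_kernel:
  fixes A :: "real ^ 'k::finite ^ 'k"
  shows "det A \<noteq> 0 \<longleftrightarrow> (\<forall>x. A *v x = 0 \<longrightarrow> x = 0)"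
  by (metis invertible_det_nz invertible_left_inverse matrix_left_invertible_ker)

lemma det_scaleR:
  fixes A :: "real ^ 'k::finite ^ 'k"
  shows "det (s *\<^sub>R A) = s ^ CARD('k) * det A"
  by (simp add: det_def sum_distrib_left prod.distrib mult_ac)

text \<open>\<open>a\<close> is an eigenvector of the matrix with eigenvalue
  \<open>1 + g \<bullet> a\<close>, so Cramer's rule reduces the claim to the matrix with column
  \<open>b\<close> replaced by \<open>a\<close>, whose determinant is \<open>a $ b\<close> by column
  operations.\<close>

lemma det_mat_1_plus_outer:
  fixes a g :: "real ^ 'k::finite"
  shows "det (mat 1 + outer a g) = 1 + g \<bullet> a"
proof (cases "a = 0")
  case True
  then show ?thesis by (simp add: outer_def flip: zero_vec_def)
next
  case False
  then obtain b where b: "a $ b \<noteq> 0" by (auto simp: vec_eq_iff)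
  define M where "M = mat 1 + outer a g"
  \<comment> \<open>The column operations that add \<open>g $ j\<close> times column
    \<open>b\<close> to every other column \<open>j\<close>, as a matrix.\<close>
  define N :: "real ^ 'k ^ 'k" where
    "N = (\<chi> i. if i = b then (\<Sum>j\<in>UNIV. (if j = b then 1 else g $ j) *s row j (mat 1)) else row i (mat 1))"
  have "det N = 1"
    using cramer_lemma_transpose [of b "\<chi> j. if j = b then 1 else g $ j" "mat 1 :: real ^ 'k ^ 'k"]
    unfolding N_def vec_lambda_beta by simp
  have N: "N $ i $ j = (if i = b then (if j = b then 1 else g $ j) else if i = j then 1 else 0)" for i j
    by (simp add: N_def row_def mat_def if_distrib [of "\<lambda>c. _ * c"] cong: if_cong)
  have D: "det (replace_col b a (mat 1)) = a $ b"
    using det_replace_col_mult [of b "mat 1" a] by simp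
  have "replace_col b a M = replace_col b a (mat 1) ** N"
    unfolding vec_eq_iff
  proof (intro allI)
    fix i j
    have "(replace_col b a (mat 1) ** N) $ i $ j =
        (\<Sum>l\<in>UNIV. (if l = b then a $ i * N $ b $ j else 0) + (if l = i then (if i = b then 0 else N $ i $ j) else 0))"
      unfolding matrix_matrix_mult_def vec_lambda_beta
      by (rule sum.cong [OF refl]) (auto simp: replace_col_def mat_def)
    also have "\<dots> = a $ i * N $ b $ j + (if i = b then 0 else N $ i $ j)"
      by (simp add: sum.distrib)
    finally show "replace_col b a M $ i $ j = (replace_col b a (mat 1) ** N) $ i $ j"
      by (auto simp: N replace_col_def M_def outer_def mat_def)
  qed
  then have "det (replace_col b a M) = a $ b" using D \<open>det N = 1\<close> by (simp add: det_mul)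
  moreover have "M *v a = (1 + g \<bullet> a) *\<^sub>R a"
    by (simp add: M_def matrix_vector_mult_add_rdistrib outer_mult_vec scaleR_add_left)
  ultimately have "a $ b * det M = (1 + g \<bullet> a) * a $ b"
    using det_replace_col_mult [of b M a] by (metis det_replace_col_scaleR)
  then have "det M = 1 + g \<bullet> a" using b by auto
  then show ?thesis by (simp add: M_def)
qed

lemma det_mat_1_plus_outer2:
  fixes a b f g :: "real ^ 'k::finite"
  assumes "g \<bullet> a = 0"
  shows "det (mat 1 + outer a g + outer b f) = 1 + f \<bullet> b - (f \<bullet> a) * (g \<bullet> b)"
proof -
  \<comment> \<open>Since \<open>g \<bullet> a = 0\<close>, the inverse of
    \<open>mat 1 + outer a g\<close> is \<open>mat 1 - outer a g\<close>. Its value at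
    \<open>b\<close> splits the sum into two factors, each a rank-one update.\<close>
  define b' where "b' = b - (g \<bullet> b) *\<^sub>R a"
  have "mat 1 + outer a g + outer b f = (mat 1 + outer a g) ** (mat 1 + outer b' f)"
    unfolding matrix_eq
    by (simp add: matrix_vector_mult_add_rdistrib outer_mult_vec b'_def assms inner_diff_right
        inner_add_right algebra_simps flip: matrix_vector_mul_assoc)
  then have "det (mat 1 + outer a g + outer b f) = (1 + g \<bullet> a) * (1 + f \<bullet> b')"
    by (simp add: det_mul det_mat_1_plus_outer)
  then show ?thesis by (simp add: assms b'_def inner_diff_right algebra_simps)
qed

text \<open>On the plane spanned by \<open>v\<close> and \<open>u\<close> the matrix \<open>W\<^sup>-\<^sup>1 X\<close> is nilpotent; the perturbation turns it
  into one with a pair of purely imaginary eigenvalues and changes nothing modulo that plane.\<close>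

lemma det_pencil_perturb:
  fixes X W :: "real ^ 'k::finite ^ 'k"
  assumes v: "X *v v = 0" and u: "X *v u = c *\<^sub>R (W *v v)"
    and dual: "f \<bullet> v = 1" "f \<bullet> u = 0" "g \<bullet> v = 0" "g \<bullet> u = 1"
  shows "det (W + t *\<^sub>R (X + \<epsilon> *\<^sub>R (W ** (outer v g - outer u f)))) =
     det (W + t *\<^sub>R X) * (1 + t\<^sup>2 * (\<epsilon> * (c + \<epsilon>)))"
proof -
  \<comment> \<open>Solutions of \<open>(W + t X) a = t \<epsilon> W v\<close> and
    \<open>(W + t X) b = - t \<epsilon> W u\<close>, found from \<open>X v = 0\<close> and
    \<open>X u = c W v\<close>; with them the pencil factors out on the left.\<close>
  define a where "a = (t * \<epsilon>) *\<^sub>R v"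
  define b where "b = (- t * \<epsilon>) *\<^sub>R (u - (t * c) *\<^sub>R v)"
  have "W + t *\<^sub>R (X + \<epsilon> *\<^sub>R (W ** (outer v g - outer u f))) =
      (W + t *\<^sub>R X) ** (mat 1 + outer a g + outer b f)"
    unfolding matrix_eq
  proof
    fix x
    have "(W + t *\<^sub>R (X + \<epsilon> *\<^sub>R (W ** (outer v g - outer u f)))) *v x =
        W *v x + t *\<^sub>R (X *v x) + (t * \<epsilon>) *\<^sub>R (W *v ((g \<bullet> x) *\<^sub>R v - (f \<bullet> x) *\<^sub>R u))"
      unfolding pencil_mult_vec matrix_vector_mul_assoc [symmetric] matrix_vector_mult_diff_rdistrib
        outer_mult_vec
      by (simp add: scaleR_add_right)
    also have "\<dots> = (W + t *\<^sub>R X) *v (x + (g \<bullet> x) *\<^sub>R a + (f \<bullet> x) *\<^sub>R b)"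
      unfolding pencil_mult_vec a_def b_def
      by (simp add: matrix_vector_right_distrib matrix_vector_mult_diff_distrib
          matrix_vector_mult_scaleR u v algebra_simps)
    also have "\<dots> = ((W + t *\<^sub>R X) ** (mat 1 + outer a g + outer b f)) *v x"
      by (simp add: matrix_vector_mult_add_rdistrib [of "mat 1 + outer a g"]
          matrix_vector_mult_add_rdistrib [of "mat 1"] outer_mult_vec flip: matrix_vector_mul_assoc)
    finally show "(W + t *\<^sub>R (X + \<epsilon> *\<^sub>R (W ** (outer v g - outer u f)))) *v x =
        ((W + t *\<^sub>R X) ** (mat 1 + outer a g + outer b f)) *v x" .
  qed
  moreover have "det (mat 1 + outer a g + outer b f) = 1 + t\<^sup>2 * (\<epsilon> * (c + \<epsilon>))"
    by (subst det_mat_1_plus_outer2)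
       (simp_all add: a_def b_def dual inner_diff_right power2_eq_square algebra_simps)
  ultimately show ?thesis by (simp add: det_mul)
qed

lemma dual_functional:
  fixes v u :: "'a::real_inner"
  assumes "\<And>r. v \<noteq> r *\<^sub>R u"
  obtains f where "f \<bullet> v = 1" "f \<bullet> u = 0"
proof -
  \<comment> \<open>For \<open>u = 0\<close> division by zero gives 0, and
    \<open>w = v\<close>.\<close>
  define w where "w = v - (v \<bullet> u / (u \<bullet> u)) *\<^sub>R u"
  have "w \<noteq> 0" using assms by (simp add: w_def)
  have wu: "w \<bullet> u = 0" by (cases "u = 0") (simp_all add: w_def inner_diff_left)
  have "w \<bullet> w = w \<bullet> v - (v \<bullet> u / (u \<bullet> u)) * (w \<bullet> u)"
    by (subst (2) w_def) (simp add: inner_diff_right)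
  then have "w \<bullet> v = w \<bullet> w" by (simp add: wu)
  then show ?thesis
    using \<open>w \<noteq> 0\<close> wu by (intro that [of "w /\<^sub>R (w \<bullet> w)"]) auto
qed

section \<open>The determinant as a polynomial in the pencil parameter, by the Leibniz
  formula\<close>

definition pencil_poly :: "real ^ 'k::finite ^ 'k \<Rightarrow> real ^ 'k ^ 'k \<Rightarrow> real poly" where
  "pencil_poly W X =
    (\<Sum>p | p permutes UNIV. of_int (sign p) * (\<Prod>i\<in>UNIV. [:W $ i $ p i, X $ i $ p i:]))"

lemma poly_pencil_poly: "poly (pencil_poly W X) t = det (W + t *\<^sub>R X)"
  by (simp add: pencil_poly_def det_def poly_sum poly_prod mult.commute)

lemma degree_pencil_poly:
  fixes W X :: "real ^ 'k::finite ^ 'k"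
  shows "degree (pencil_poly W X) \<le> CARD('k)"
  unfolding pencil_poly_def
proof (rule degree_sum_le)
  fix p :: "'k \<Rightarrow> 'k"
  have "degree (\<Prod>i\<in>UNIV. [:W $ i $ p i, X $ i $ p i:]) \<le>
      (\<Sum>i\<in>(UNIV :: 'k set). (degree \<circ> (\<lambda>i. [:W $ i $ p i, X $ i $ p i:])) i)"
    by (rule degree_prod_sum_le) simp
  also have "\<dots> \<le> (\<Sum>i\<in>(UNIV :: 'k set). 1)" by (rule sum_mono) simp
  finally have "degree (\<Prod>i\<in>UNIV. [:W $ i $ p i, X $ i $ p i:]) \<le> CARD('k)" by simp
  moreover have "degree (of_int (sign p) * (\<Prod>i\<in>UNIV. [:W $ i $ p i, X $ i $ p i:])) \<le>
      degree (of_int (sign p) :: real poly) + degree (\<Prod>i\<in>UNIV. [:W $ i $ p i, X $ i $ p i:])"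
    by (rule degree_mult_le)
  moreover have "degree (of_int (sign p) :: real poly) = 0" by (simp add: of_int_poly)
  ultimately show "degree (of_int (sign p) * (\<Prod>i\<in>UNIV. [:W $ i $ p i, X $ i $ p i:])) \<le> CARD('k)"
    by simp
qed (simp add: finite_permutations)

definition nonsingular_pencil :: "real ^ 'k::finite ^ 'k \<Rightarrow> real ^ 'k ^ 'k \<Rightarrow> bool" where
  "nonsingular_pencil X W \<longleftrightarrow> (\<forall>t. det (W + t *\<^sub>R X) \<noteq> 0)"

text \<open>\<open>0\<close> is a simple eigenvalue of \<open>W\<^sup>-\<^sup>1 X\<close>, with eigenvector \<open>v\<close>.\<close>

definition simple_kernel :: "real ^ 'k::finite ^ 'k \<Rightarrow> real ^ 'k ^ 'k \<Rightarrow> real ^ 'k \<Rightarrow> bool" where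
  "simple_kernel X W v \<longleftrightarrow> v \<noteq> 0 \<and> X *v v = 0 \<and> (\<forall>u. X *v u = 0 \<longrightarrow> (\<exists>r. u = r *\<^sub>R v)) \<and>
     W *v v \<notin> range ((*v) X)"

text \<open>If 0 is not simple, then either the kernel contains some \<open>u\<close> independent of
  \<open>v\<close> (\<open>c = 0\<close>), or \<open>W v\<close> has a preimage \<open>u\<close>
  under \<open>X\<close> (\<open>c = 1\<close>), a Jordan chain. In both cases
  \<open>c \<ge> 0\<close>, so the factor \<open>1 + \<delta> t^2\<close> has no real zero and
  raises the degree by two.\<close>

lemma nonsingular_pencil_raise_degree:
  fixes X W :: "real ^ 'k::finite ^ 'k"
  assumes ns: "nonsingular_pencil X W" and sing: "det X = 0"
    and not_simple: "\<nexists>v. simple_kernel X W v" and "e > 0"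
  obtains X' where "dist X' X < e" "nonsingular_pencil X' W"
    "degree (pencil_poly W X') > degree (pencil_poly W X)"
proof -
  have W: "W *v v \<noteq> 0" if "v \<noteq> 0" for v
    using ns that det_nonzero_iff_kernel [of W]
    by (auto simp: nonsingular_pencil_def dest: spec [of _ 0])
  obtain v where v: "v \<noteq> 0" "X *v v = 0" using sing det_nonzero_iff_kernel [of X] by blast
  have "\<exists>u c. c \<ge> 0 \<and> X *v u = c *\<^sub>R (W *v v) \<and> (\<forall>r. u \<noteq> r *\<^sub>R v)"
  proof (cases "\<exists>u. X *v u = 0 \<and> (\<forall>r. u \<noteq> r *\<^sub>R v)")
    case True
    then show ?thesis by (metis order_refl scaleR_zero_left)
  next
    case False
    with v not_simple have "W *v v \<in> range ((*v) X)" unfolding simple_kernel_def by metis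
    then obtain u where u: "X *v u = W *v v" by auto
    have "u \<noteq> r *\<^sub>R v" for r
      using u W [OF v(1)] v(2) by (auto simp: matrix_vector_mult_scaleR)
    then show ?thesis using u by (intro exI [of _ u] exI [of _ 1]) auto
  qed
  then obtain u c where u: "c \<ge> 0" "X *v u = c *\<^sub>R (W *v v)" "\<And>r. u \<noteq> r *\<^sub>R v" by blast
  have vu: "v \<noteq> r *\<^sub>R u" for r
  proof
    assume r: "v = r *\<^sub>R u"
    then have "r \<noteq> 0" using v(1) by auto
    then have "u = (1 / r) *\<^sub>R v" using r by simp
    then show False using u(3) by blast
  qed
  obtain f where f: "f \<bullet> v = 1" "f \<bullet> u = 0" using dual_functional [of v u] vu by blast
  obtain g where g: "g \<bullet> u = 1" "g \<bullet> v = 0" using dual_functional [of u v] u(3) by blast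
  define B where "B = W ** (outer v g - outer u f)"
  \<comment> \<open>The added 1 avoids division by zero and makes the perturbation strictly shorter
    than \<open>e\<close>.\<close>
  define \<epsilon> where "\<epsilon> = e / (norm B + 1)"
  have "norm B + 1 > 0" using norm_ge_zero [of B] by linarith
  then have "\<epsilon> > 0" using \<open>e > 0\<close> by (simp add: \<epsilon>_def)
  define X' where "X' = X + \<epsilon> *\<^sub>R B"
  define \<delta> where "\<delta> = \<epsilon> * (c + \<epsilon>)"
  have "\<delta> > 0" using \<open>\<epsilon> > 0\<close> u(1) by (simp add: \<delta>_def)
  have det: "det (W + t *\<^sub>R X') = det (W + t *\<^sub>R X) * (1 + t\<^sup>2 * \<delta>)" for t
    unfolding X'_def B_def \<delta>_def
    by (rule det_pencil_perturb) (use v u f g in auto)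
  show ?thesis
  proof
    have "\<epsilon> * norm B < e"
      using \<open>e > 0\<close> \<open>norm B + 1 > 0\<close> by (simp add: \<epsilon>_def field_simps)
    then show "dist X' X < e" using \<open>\<epsilon> > 0\<close> by (simp add: X'_def dist_norm)
    have "1 + t\<^sup>2 * \<delta> > 0" for t :: real using \<open>\<delta> > 0\<close> by (simp add: add_pos_nonneg)
    then show "nonsingular_pencil X' W"
      using ns by (auto simp: nonsingular_pencil_def det) (metis less_irrefl)
    have "poly (pencil_poly W X') = poly (pencil_poly W X * [:1, 0, \<delta>:])"
      by (rule ext) (simp add: poly_pencil_poly det power2_eq_square algebra_simps)
    then have "pencil_poly W X' = pencil_poly W X * [:1, 0, \<delta>:]"
      by (simp add: poly_eq_poly_eq_iff)
    moreover have "pencil_poly W X \<noteq> 0"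
      using ns poly_pencil_poly [of W X 0] unfolding nonsingular_pencil_def by (metis poly_0)
    moreover have "[:1, 0, \<delta>:] \<noteq> 0" "degree [:1, 0, \<delta>:] = 2" using \<open>\<delta> > 0\<close> by simp_all
    ultimately show "degree (pencil_poly W X') > degree (pencil_poly W X)"
      by (metis degree_mult_eq less_add_same_cancel1 zero_less_numeral)
  qed
qed

text \<open>A pencil of greatest degree within the ball exists because degrees are bounded by
  \<open>CARD('k)\<close>. In the exceptional case its degree could be raised within the slack left
  to the radius \<open>e\<close>.\<close>

lemma generic_pencils_dense:
  fixes X W :: "real ^ 'k::finite ^ 'k"
  assumes "nonsingular_pencil X W" "e > 0"
  obtains X' where "dist X' X < e" "nonsingular_pencil X' W" "det X' \<noteq> 0 \<or> (\<exists>v. simple_kernel X' W v)"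
proof -
  define P where "P X' \<longleftrightarrow> dist X' X < e \<and> nonsingular_pencil X' W" for X'
  have "P X" using assms by (simp add: P_def)
  moreover have "\<forall>Y. P Y \<longrightarrow> degree (pencil_poly W Y) < Suc CARD('k)"
    using degree_pencil_poly [of W] by (simp add: less_Suc_eq_le)
  ultimately obtain X' where X': "P X'" "\<And>Y. P Y \<Longrightarrow> degree (pencil_poly W Y) \<le> degree (pencil_poly W X')"
    using ex_has_greatest_nat [of P X "\<lambda>Y. degree (pencil_poly W Y)"] by blast
  show ?thesis
  proof (cases "det X' \<noteq> 0 \<or> (\<exists>v. simple_kernel X' W v)")
    case True
    then show ?thesis using that X'(1) by (auto simp: P_def)
  next
    case False
    then obtain Y where Y: "dist Y X' < e - dist X' X" "nonsingular_pencil Y W"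
      "degree (pencil_poly W Y) > degree (pencil_poly W X')"
      using nonsingular_pencil_raise_degree [of X' W "e - dist X' X"] X'(1) by (auto simp: P_def)
    have "P Y" using Y(1,2) dist_triangle [of Y X X'] by (auto simp: P_def)
    then show ?thesis using X'(2) Y(3) by fastforce
  qed
qed

section \<open>Sign changes of the determinant and the parity of k\<close>

lemma sign_change_imp_zero:
  fixes f :: "real \<Rightarrow> real"
  assumes "continuous_on UNIV f" "\<And>s. s > 0 \<Longrightarrow> f s > 0" "\<And>s. s < 0 \<Longrightarrow> f s < 0"
  shows "f 0 = 0"
proof (rule ccontr)
  assume "f 0 \<noteq> 0"
  have c: "continuous_on {a..b} f" for a b using assms(1) continuous_on_subset by blast
  show False
  proof (cases "f 0 > 0")
    case True
    then obtain x where "-1 \<le> x" "x \<le> 0" "f x = 0"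
      using IVT' [of f "-1" 0 0] assms(3) [of "-1"] c by auto
    then show False using assms(3) [of x] \<open>f 0 \<noteq> 0\<close> by (cases "x = 0") auto
  next
    case False
    then obtain x where "0 \<le> x" "x \<le> 1" "f x = 0"
      using IVT' [of f 0 0 1] assms(2) [of 1] c by auto
    then show False using assms(2) [of x] \<open>f 0 \<noteq> 0\<close> by (cases "x = 0") auto
  qed
qed

text \<open>No zero means no sign change; the factor \<open>det W\<close> makes the constant sign
  positive.\<close>

lemma nonsingular_pencil_sign:
  fixes X W :: "real ^ 'k::finite ^ 'k"
  assumes "nonsingular_pencil X W"
  shows "det (W + t *\<^sub>R X) * det W > 0"
proof (rule ccontr)
  define f where "f t = det (W + t *\<^sub>R X) * det W" for t
  assume "\<not> det (W + t *\<^sub>R X) * det W > 0"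
  then have "f t \<le> 0" by (simp add: f_def)
  have f0: "f s \<noteq> 0" for s
    using assms by (auto simp: f_def nonsingular_pencil_def dest: spec [of _ 0])
  then have "f 0 > 0" by (simp add: f_def zero_less_mult_iff) (metis linorder_neqE_linordered_idom)
  have c: "continuous_on S f" for S unfolding f_def by (intro continuous_intros)
  show False
  proof (cases "t \<le> 0")
    case True
    then show False using IVT' [of f t 0 0] \<open>f t \<le> 0\<close> \<open>f 0 > 0\<close> c f0 by auto
  next
    case False
    then show False using IVT2' [of f t 0 0] \<open>f t \<le> 0\<close> \<open>f 0 > 0\<close> c f0 by auto
  qed
qed

lemma det_homogeneous_pencil:
  fixes X W :: "real ^ 'k::finite ^ 'k"
  assumes "s \<noteq> 0"
  shows "det (s *\<^sub>R W + t *\<^sub>R X) = s ^ CARD('k) * det (W + (t / s) *\<^sub>R X)"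
proof -
  have "s *\<^sub>R W + t *\<^sub>R X = s *\<^sub>R (W + (t / s) *\<^sub>R X)" using assms by (simp add: scaleR_add_right)
  then show ?thesis by (simp only: det_scaleR)
qed

text \<open>For \<open>s \<noteq> 0\<close>, \<open>det (s W + X) det W\<close> is
  \<open>s^k\<close> times a positive number. For odd \<open>k\<close> it changes sign with
  \<open>s\<close>, so it vanishes at \<open>s = 0\<close>.\<close>

lemma odd_pencil_singular:
  fixes X W :: "real ^ 'k::finite ^ 'k"
  assumes ns: "nonsingular_pencil X W" and "odd CARD('k)"
  shows "det X = 0"
proof -
  define f where "f s = det (s *\<^sub>R W + 1 *\<^sub>R X) * det W" for s
  have f: "f s = s ^ CARD('k) * (det (W + (1 / s) *\<^sub>R X) * det W)" if "s \<noteq> 0" for s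
    unfolding f_def det_homogeneous_pencil [OF that] by simp
  have "f 0 = 0"
  proof (rule sign_change_imp_zero)
    show "continuous_on UNIV f" unfolding f_def by (intro continuous_intros)
    show "f s > 0" if "s > 0" for s
      using that nonsingular_pencil_sign [OF ns] by (simp add: f)
    show "f s < 0" if "s < 0" for s
      using that nonsingular_pencil_sign [OF ns] \<open>odd CARD('k)\<close>
      by (simp add: f mult_neg_pos power_less_zero_eq)
  qed
  moreover have "det W \<noteq> 0" using ns by (auto simp: nonsingular_pencil_def dest: spec [of _ 0])
  ultimately show ?thesis by (simp add: f_def)
qed

text \<open>As \<open>v $ b \<noteq> 0\<close>, column \<open>b\<close> depends on the remaining
  ones, which therefore still span the range of \<open>X\<close>; a vector outside the range
  completes them to a basis.\<close>

lemma det_replace_col_kernel: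
  fixes X :: "real ^ 'k::finite ^ 'k"
  assumes ker: "\<And>w. X *v w = 0 \<Longrightarrow> \<exists>r. w = r *\<^sub>R v" and "v $ b \<noteq> 0" and u: "u \<notin> range ((*v) X)"
  shows "det (replace_col b u X) \<noteq> 0"
  unfolding det_nonzero_iff_kernel
proof (intro allI impI)
  fix w assume "replace_col b u X *v w = 0"
  then have w: "X *v w + w $ b *\<^sub>R (u - X *v axis b 1) = 0"
    by (simp add: replace_col_mult_vec matrix_vector_mult_basis)
  have "w $ b = 0"
  proof (rule ccontr)
    assume "w $ b \<noteq> 0"
    have "X *v (axis b 1 - (1 / w $ b) *\<^sub>R w) = u"
    proof -
      have "X *v w = - (w $ b *\<^sub>R (u - X *v axis b 1))" using w by (simp add: eq_neg_iff_add_eq_0)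
      then show ?thesis
        using \<open>w $ b \<noteq> 0\<close> by (simp only: matrix_vector_mult_diff_distrib matrix_vector_mult_scaleR) simp
    qed
    then show False using u by blast
  qed
  then have "X *v w = 0" using w by simp
  then obtain r where "w = r *\<^sub>R v" using ker by blast
  then show "w = 0" using \<open>w $ b = 0\<close> \<open>v $ b \<noteq> 0\<close> by auto
qed

text \<open>Cramer's rule at \<open>v\<close>, which the pencil maps to
  \<open>s *R (W *v v)\<close>. The right-hand side exhibits the factor \<open>s\<close>, so that it
  can be divided out even at \<open>s = 0\<close>.\<close>

lemma det_homogeneous_pencil_kernel:
  fixes X W :: "real ^ 'k::finite ^ 'k"
  assumes "X *v v = 0"
  shows "v $ b * det (s *\<^sub>R W + t *\<^sub>R X) = s * det (replace_col b (W *v v) (s *\<^sub>R W + t *\<^sub>R X))"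
proof -
  have "(s *\<^sub>R W + t *\<^sub>R X) *v v = s *\<^sub>R (W *v v)"
    using assms by (simp add: matrix_vector_mult_add_rdistrib flip: scaleR_matrix_vector_assoc)
  then show ?thesis using det_replace_col_mult [of b "s *\<^sub>R W + t *\<^sub>R X" v] by (simp add: det_replace_col_scaleR)
qed

text \<open>Dividing the homogeneous determinant by \<open>s\<close> leaves the odd power
  \<open>s^(k - 1)\<close>, hence a sign change and a zero at \<open>s = 0\<close>. There the
  quotient is, up to the factor \<open>v $ b\<close>, the determinant of \<open>X\<close> with
  column \<open>b\<close> replaced by \<open>W v\<close>, which is nonzero for a simple
  kernel.\<close>

lemma even_pencil_no_simple_kernel:
  fixes X W :: "real ^ 'k::finite ^ 'k"
  assumes ns: "nonsingular_pencil X W" and even: "even CARD('k)"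
  shows "\<not> simple_kernel X W v"
proof
  assume sk: "simple_kernel X W v"
  then obtain b where b: "v $ b \<noteq> 0" by (auto simp: simple_kernel_def vec_eq_iff)
  have "det (replace_col b (W *v v) X) \<noteq> 0"
    by (rule det_replace_col_kernel [where v = v]) (use sk b in \<open>auto simp: simple_kernel_def\<close>)
  define h where "h s = det (replace_col b (W *v v) (s *\<^sub>R W + 1 *\<^sub>R X))" for s
  \<comment> \<open>The factor \<open>v $ b * det W\<close> makes the coefficient of the odd power
    positive.\<close>
  define f where "f s = h s * (v $ b * det W)" for s
  have "X *v v = 0" using sk by (simp add: simple_kernel_def)
  have h: "h s = v $ b * s ^ (CARD('k) - 1) * det (W + (1 / s) *\<^sub>R X)" if "s \<noteq> 0" for s
  proof -
    have "s * h s = v $ b * (s ^ CARD('k) * det (W + (1 / s) *\<^sub>R X))"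
      unfolding h_def det_homogeneous_pencil_kernel [OF \<open>X *v v = 0\<close>, symmetric]
        det_homogeneous_pencil [OF that] ..
    also have "s ^ CARD('k) = s * s ^ (CARD('k) - 1)"
      by (metis One_nat_def Suc_pred zero_less_card_finite power_Suc)
    finally show ?thesis using that by simp
  qed
  have f: "f s = s ^ (CARD('k) - 1) * ((v $ b)\<^sup>2 * (det (W + (1 / s) *\<^sub>R X) * det W))" if "s \<noteq> 0" for s
    using h [OF that] by (simp add: f_def power2_eq_square mult_ac)
  have pos: "(v $ b)\<^sup>2 * (det (W + t *\<^sub>R X) * det W) > 0" for t
    using nonsingular_pencil_sign [OF ns] b by simp
  have "odd (CARD('k) - 1)" using even by simp
  have "f 0 = 0"
  proof (rule sign_change_imp_zero)
    show "continuous_on UNIV f" unfolding f_def h_def replace_col_def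
      by (intro continuous_intros continuous_on_if_const)
    show "f s > 0" if "s > 0" for s using that pos by (simp add: f)
    show "f s < 0" if "s < 0" for s
    proof -
      have "s ^ (CARD('k) - 1) < 0"
        using that \<open>odd (CARD('k) - 1)\<close> unfolding power_less_zero_eq by blast
      then show ?thesis unfolding f [OF less_imp_neq [OF that]] using pos by (rule mult_neg_pos)
    qed
  qed
  moreover have "det W \<noteq> 0" using ns by (auto simp: nonsingular_pencil_def dest: spec [of _ 0])
  ultimately show False using b \<open>det (replace_col b (W *v v) X) \<noteq> 0\<close> by (simp add: f_def h_def)
qed

section \<open>Density\<close>

lemma continuous_on_replace_col [continuous_intros]:
  assumes "continuous_on S f" "continuous_on S g"
  shows "continuous_on S (\<lambda>x. replace_col b (f x) (g x))"
  unfolding replace_col_def by (intro continuous_intros continuous_on_if_const assms)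

lemma continuous_on_outer [continuous_intros]:
  assumes "continuous_on S f" "continuous_on S g"
  shows "continuous_on S (\<lambda>x. outer (f x) (g x))"
  unfolding outer_def by (intro continuous_intros assms)

lemma continuous_on_matrix_mult [continuous_intros]:
  fixes f g :: "'a::topological_space \<Rightarrow> real ^ 'k::finite ^ 'k"
  assumes "continuous_on S f" "continuous_on S g"
  shows "continuous_on S (\<lambda>x. f x ** g x)"
  unfolding matrix_matrix_mult_def by (intro continuous_intros assms)

lemma continuous_on_column [continuous_intros]:
  assumes "continuous_on S f"
  shows "continuous_on S (\<lambda>x. column b (f x))"
  unfolding column_def by (intro continuous_intros assms)

text \<open>The form in which the explicit perturbations below yield density: a curve with parameter
  \<open>\<eta>\<close> tending to 0 through positive values.\<close>

lemma curve_start_in_closure: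
  fixes \<gamma> :: "real \<Rightarrow> 'a::topological_space"
  assumes "continuous_on UNIV \<gamma>" "\<forall>\<^sub>F \<eta> in at_right 0. \<gamma> \<eta> \<in> S"
  shows "\<gamma> 0 \<in> closure S"
proof -
  have "isCont \<gamma> 0" using assms(1) by (simp add: continuous_on_eq_continuous_at)
  then have "(\<gamma> \<longlongrightarrow> \<gamma> 0) (at_right 0)"
    by (simp add: isCont_def filterlim_at_split)
  moreover have "\<forall>\<^sub>F \<eta> in at_right 0. \<gamma> \<eta> \<in> closure S"
    using assms(2) by (rule eventually_mono) (use closure_subset in blast)
  ultimately show ?thesis
    by (intro Lim_in_closed_set [of "closure S" \<gamma> "at_right 0"]) auto
qed

lemma eventually_at_right_in_open:
  fixes \<gamma> :: "real \<Rightarrow> 'a::topological_space"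
  assumes "continuous_on UNIV \<gamma>" "open A" "\<gamma> 0 \<in> A"
  shows "\<forall>\<^sub>F \<eta> in at_right 0. \<gamma> \<eta> \<in> A"
proof -
  have "isCont \<gamma> 0" using assms(1) by (simp add: continuous_on_eq_continuous_at)
  then have "(\<gamma> \<longlongrightarrow> \<gamma> 0) (at_right 0)"
    by (simp add: isCont_def filterlim_at_split)
  then show ?thesis using assms(2,3) by (rule topological_tendstoD)
qed

lemma eventually_at_right_nonzero:
  fixes g :: "real \<Rightarrow> real"
  assumes "continuous_on UNIV g" "g 0 \<noteq> 0"
  shows "\<forall>\<^sub>F \<eta> in at_right 0. g \<eta> \<noteq> 0"
  using eventually_at_right_in_open [OF assms(1), of "- {0}"] assms(2) by (simp add: open_Compl)

lemma eventually_at_right_pos: "\<forall>\<^sub>F \<eta> in at_right 0. \<eta> > (0 :: real)"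
  by (simp add: eventually_at_filter)

text \<open>The exceptional \<open>p\<close> form the projection of a closed set along the compact
  \<open>K\<close>, which is closed.\<close>

lemma open_nonzero_on_compact:
  fixes f :: "'a::euclidean_space \<Rightarrow> 'b::euclidean_space \<Rightarrow> real"
  assumes "compact K" "continuous_on UNIV (\<lambda>(k, p). f k p)"
  shows "open {p. \<forall>k\<in>K. f k p \<noteq> 0}"
proof -
  have "closed ((\<lambda>(k, p). f k p) -` {0})"
    using assms(2) by (intro closed_vimage) auto
  then have "closed {p. \<exists>k. k \<in> K \<and> (k, p) \<in> (\<lambda>(k, p). f k p) -` {0}}"
    by (rule closed_compact_projection [OF assms(1)])
  then have "open (- {p. \<exists>k. k \<in> K \<and> (k, p) \<in> (\<lambda>(k, p). f k p) -` {0}})" by (rule open_Compl)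
  moreover have "- {p. \<exists>k. k \<in> K \<and> (k, p) \<in> (\<lambda>(k, p). f k p) -` {0}} = {p. \<forall>k\<in>K. f k p \<noteq> 0}"
    by auto
  ultimately show ?thesis by simp
qed

text \<open>Half of the unit circle: homogeneous coordinates \<open>(s, t)\<close> for the parameter \<open>t/s\<close> of a pencil,
  including \<open>t/s = \<infinity>\<close>.\<close>

definition half_circle :: "(real \<times> real) set" where
  "half_circle = sphere 0 1 \<inter> {st. snd st \<ge> 0}"

lemma compact_half_circle: "compact half_circle"
proof -
  have "closed {st :: real \<times> real. snd st \<ge> 0}"
    by (intro closed_Collect_le continuous_intros)
  then show ?thesis unfolding half_circle_def by (intro compact_Int_closed) auto
qed

lemma half_circle_0: "(0, t) \<in> half_circle \<longleftrightarrow> t = 1"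
  by (auto simp: half_circle_def norm_Pair)

text \<open>The point is \<open>(1, t)\<close> normalised to length one, with the sign that makes
  its second coordinate nonnegative.\<close>

lemma half_circle_slope:
  obtains s where "s \<noteq> 0" "(s, t * s) \<in> half_circle"
proof -
  define s where "s = 1 / sqrt (1 + t\<^sup>2)"
  have "1 + t\<^sup>2 > 0" by (simp add: add_pos_nonneg)
  then have "s > 0" by (simp add: s_def)
  have "norm (s, t * s) = s * sqrt (1 + t\<^sup>2)"
  proof -
    have "s\<^sup>2 + (t * s)\<^sup>2 = s\<^sup>2 * (1 + t\<^sup>2)" by (simp add: power_mult_distrib algebra_simps)
    then show ?thesis using \<open>s > 0\<close> by (simp add: norm_Pair real_sqrt_mult)
  qed
  then have n: "norm (s, t * s) = 1" using \<open>1 + t\<^sup>2 > 0\<close> by (simp add: s_def)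
  then have n': "norm (- s, - t * s) = 1" by (simp add: norm_Pair)
  show ?thesis
  proof (cases "t * s \<ge> 0")
    case True
    then show ?thesis using n \<open>s > 0\<close> by (intro that [of s]) (simp_all add: half_circle_def)
  next
    case False
    then show ?thesis using n' \<open>s > 0\<close> by (intro that [of "- s"]) (simp_all add: half_circle_def)
  qed
qed

text \<open>Points with \<open>s \<noteq> 0\<close> account for the finite parameter
  \<open>t / s\<close>, the point \<open>(0, 1)\<close> for \<open>det X\<close>.\<close>

lemma nonsingular_pencil_half_circle:
  fixes X W :: "real ^ 'k::finite ^ 'k"
  shows "nonsingular_pencil X W \<and> det X \<noteq> 0 \<longleftrightarrow>
    (\<forall>(s, t)\<in>half_circle. det (s *\<^sub>R W + t *\<^sub>R X) \<noteq> 0)"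
proof (intro iffI conjI)
  assume ns: "nonsingular_pencil X W \<and> det X \<noteq> 0"
  have "det (s *\<^sub>R W + t *\<^sub>R X) \<noteq> 0" if "(s, t) \<in> half_circle" for s t
  proof (cases "s = 0")
    case True
    then show ?thesis using that ns by (simp add: half_circle_0)
  next
    case False
    then show ?thesis using ns by (simp add: det_homogeneous_pencil nonsingular_pencil_def)
  qed
  then show "\<forall>(s, t)\<in>half_circle. det (s *\<^sub>R W + t *\<^sub>R X) \<noteq> 0" by auto
next
  assume h: "\<forall>(s, t)\<in>half_circle. det (s *\<^sub>R W + t *\<^sub>R X) \<noteq> 0"
  then show "det X \<noteq> 0" using half_circle_0 [of 1] by fastforce
  show "nonsingular_pencil X W"
    unfolding nonsingular_pencil_def
  proof
    fix t
    obtain s' where "s' \<noteq> 0" "(s', t * s') \<in> half_circle" by (rule half_circle_slope)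
    then have "det (s' *\<^sub>R W + (t * s') *\<^sub>R X) \<noteq> 0" using h by auto
    then show "det (W + t *\<^sub>R X) \<noteq> 0"
      using \<open>s' \<noteq> 0\<close> by (simp add: det_homogeneous_pencil)
  qed
qed

lemma open_nonsingular_pencils:
  "open {(X :: real ^ 'k::finite ^ 'k, W). nonsingular_pencil X W \<and> det X \<noteq> 0}"
proof -
  have "open {p :: (real ^ 'k ^ 'k) \<times> (real ^ 'k ^ 'k).
      \<forall>k\<in>half_circle. det (fst k *\<^sub>R snd p + snd k *\<^sub>R fst p) \<noteq> 0}"
    by (intro open_nonzero_on_compact compact_half_circle)
       (simp add: case_prod_beta, intro continuous_intros)
  moreover have "{p :: (real ^ 'k ^ 'k) \<times> (real ^ 'k ^ 'k).
      \<forall>k\<in>half_circle. det (fst k *\<^sub>R snd p + snd k *\<^sub>R fst p) \<noteq> 0} =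
      {(X, W). nonsingular_pencil X W \<and> det X \<noteq> 0}"
    unfolding nonsingular_pencil_half_circle by auto
  ultimately show ?thesis by simp
qed

section \<open>The open pieces in parameter space and their closures\<close>

lemma R_par_z0: "(X, W, 0) \<in> R_par \<longleftrightarrow> nonsingular_pencil X W"
  by (auto simp: R_par_def commuting_def admissible_def nonsingular_pencil_def det_nonzero_iff_kernel)

text \<open>A fixed index \<open>b\<close> instead of \<open>z \<noteq> 0\<close> gives one
  normalisation valid on the whole set, which is still dense among the points with
  \<open>z \<noteq> 0\<close>.\<close>

definition R_z_nonzero :: "'k::finite \<Rightarrow> 'k par set" where
  "R_z_nonzero b = {(X, W, z) \<in> R_par. z $ b \<noteq> 0}"

text \<open>The entry \<open>X $ b $ b\<close> is the pivot with which \<open>W - c X\<close> is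
  normalised.\<close>

definition R_even :: "'k::finite \<Rightarrow> 'k par set" where
  "R_even b = {(X, W, z) \<in> R_par. det X \<noteq> 0 \<and> X $ b $ b \<noteq> 0}"

definition hat :: "'k::finite \<Rightarrow> real ^ 'k ^ 'k \<Rightarrow> real ^ 'k ^ 'k" where
  "hat b X = replace_col b (axis b 1) X"

text \<open>By Cramer's rule this is the solution \<open>c\<close> of \<open>hat b X *v c = column b X\<close>.\<close>

definition col_coords :: "'k::finite \<Rightarrow> real ^ 'k ^ 'k \<Rightarrow> real ^ 'k" where
  "col_coords b X = (\<chi> j. det (replace_col j (column b X) (hat b X)) / det (hat b X))"

text \<open>For singular \<open>X\<close>, \<open>axis b 1 - col_coords b X\<close> is the kernel
  vector with entry 1 at \<open>b\<close>, so the first and last conditions together say that the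
  kernel is simple; stated by determinants, they are open. The entry \<open>X $ a $ a\<close> is the
  pivot for \<open>W\<close>.\<close>

definition R_odd :: "'k::finite \<Rightarrow> 'k \<Rightarrow> 'k par set" where
  "R_odd a b = {(X, W, z) \<in> R_par. det (hat b X) \<noteq> 0 \<and> X $ a $ a \<noteq> 0 \<and>
     det (replace_col b (W *v (axis b 1 - col_coords b X)) X) \<noteq> 0}"

lemma hat_mult_vec: "hat b X *v w = X *v w + w $ b *\<^sub>R (axis b 1 - column b X)"
  by (simp add: hat_def replace_col_mult_vec)

lemma hat_mult_eq_iff:
  assumes "det (hat b X) \<noteq> 0"
  shows "hat b X *v c = column b X \<longleftrightarrow> c = col_coords b X"
  unfolding col_coords_def replace_col_def [abs_def] using cramer [OF assms] by simp

lemma commuting_rank_one: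
  assumes "commuting X z" "z $ i \<noteq> 0"
  shows "X = outer ((1 / z $ i) *\<^sub>R column i X) z"
  unfolding vec_eq_iff
proof (intro allI)
  fix l j
  have "z $ i * X $ l $ j = z $ j * X $ l $ i" using assms(1) by (simp add: commuting_def)
  then show "X $ l $ j = outer ((1 / z $ i) *\<^sub>R column i X) z $ l $ j"
    using assms(2) by (simp add: outer_def column_def field_simps)
qed

text \<open>\<open>X\<close> vanishes on the vectors orthogonal to \<open>z\<close>, so the
  parameter \<open>t\<close> has no effect there.\<close>

lemma R_par_outer:
  "(outer x z, W, z) \<in> R_par \<longleftrightarrow> (\<forall>v. W *v v = 0 \<and> z \<bullet> v = 0 \<longrightarrow> v = 0)"
proof -
  have "commuting (outer x z) z" by (simp add: commuting_def outer_def)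
  moreover have "admissible (outer x z) W z \<longleftrightarrow> (\<forall>v. W *v v = 0 \<and> z \<bullet> v = 0 \<longrightarrow> v = 0)"
    unfolding admissible_def pencil_mult_vec outer_mult_vec by (metis add_0_right scaleR_zero_left scaleR_zero_right)
  ultimately show ?thesis by (simp add: R_par_def)
qed

lemma R_par_in_closure_R_z_nonzero:
  assumes R: "(X, W, z) \<in> R_par" and "z \<noteq> 0"
  shows "(X, W, z) \<in> closure (R_z_nonzero b)"
proof (cases "z $ b = 0")
  case False
  then have "(X, W, z) \<in> R_z_nonzero b" using R by (simp add: R_z_nonzero_def)
  then show ?thesis using closure_subset by blast
next
  case True
  obtain i where i: "z $ i \<noteq> 0" using \<open>z \<noteq> 0\<close> by (auto simp: vec_eq_iff)
  define x where "x = (1 / z $ i) *\<^sub>R column i X"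
  have X: "X = outer x z" using commuting_rank_one [OF _ i] R by (simp add: R_par_def x_def)
  have "admissible X W z" using R by (simp add: R_par_def)
  then obtain \<delta> where "\<delta> > 0"
    and lb: "\<And>\<tau> v. \<bar>\<tau>\<bar> \<le> 0 \<Longrightarrow> \<delta> * norm v \<le> norm ((W + \<tau> *\<^sub>R X) *v v) + \<bar>z \<bullet> v\<bar>"
    by (rule admissible_lower_bound [of X W z 0]) blast
  have \<delta>: "\<delta> > 0" "\<delta> * norm v \<le> norm (W *v v) + \<bar>z \<bullet> v\<bar>" for v
    using \<open>\<delta> > 0\<close> lb [of 0 v] by simp_all
  \<comment> \<open>\<open>X\<close> moves along with \<open>z\<close>, keeping the rank-one form
    that commutation demands.\<close>
  define \<gamma> where "\<gamma> \<eta> = (outer x (z + \<eta> *\<^sub>R axis b 1), W, z + \<eta> *\<^sub>R axis b 1)" for \<eta> :: real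
  have "\<gamma> 0 \<in> closure (R_z_nonzero b)"
  proof (rule curve_start_in_closure)
    show "continuous_on UNIV \<gamma>" unfolding \<gamma>_def by (intro continuous_intros)
    have in_R: "\<gamma> \<eta> \<in> R_z_nonzero b" if \<eta>: "0 < \<eta>" "\<eta> < \<delta>" for \<eta>
    proof -
      have "v = 0" if v: "W *v v = 0" "(z + \<eta> *\<^sub>R axis b 1) \<bullet> v = 0" for v
      proof -
        have "z \<bullet> v = - \<eta> * v $ b" using v(2) by (simp add: inner_add_left inner_axis' eq_neg_iff_add_eq_0)
        then have "\<bar>z \<bullet> v\<bar> \<le> \<eta> * norm v"
          using \<eta> component_le_norm_cart [of v b] by (simp add: abs_mult)
        \<comment> \<open>The lower bound at \<open>\<tau> = 0\<close> shows that admissibility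
          survives moves of \<open>z\<close> shorter than \<open>\<delta>\<close>.\<close>
        then have "\<delta> * norm v \<le> \<eta> * norm v" using \<delta>(2) [of v] v(1) by simp
        then show "v = 0" using \<eta> by (metis mult_le_cancel_right norm_eq_zero norm_ge_zero not_less order_antisym)
      qed
      then have "\<gamma> \<eta> \<in> R_par" unfolding \<gamma>_def R_par_outer by blast
      then show ?thesis using \<eta> True by (simp add: R_z_nonzero_def \<gamma>_def)
    qed
    show "\<forall>\<^sub>F \<eta> in at_right 0. \<gamma> \<eta> \<in> R_z_nonzero b"
      using eventually_at_right_less [of 0] eventually_at_right_real [OF \<delta>(1)]
      by eventually_elim (use in_R in auto)
  qed
  then show ?thesis by (simp add: \<gamma>_def X)
qed

text \<open>For \<open>k = 1\<close> oddness makes the 1 by 1 matrix \<open>X\<close> singular,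
  hence zero; every \<open>z\<close> then satisfies the commutation condition, so \<open>z\<close>
  can be switched on.\<close>

lemma z0_in_closure_R_z_nonzero:
  fixes X W :: "real ^ 'k::finite ^ 'k"
  assumes ns: "nonsingular_pencil X W" and card: "CARD('k) = 1"
  shows "(X, W, 0) \<in> closure (R_z_nonzero b)"
proof -
  obtain i :: 'k where i: "UNIV = {i}" using card by (metis card_1_singletonE)
  have "det X = 0" using odd_pencil_singular [OF ns] card by simp
  then obtain v where v: "v \<noteq> 0" "X *v v = 0" using det_nonzero_iff_kernel [of X] by blast
  have eq: "j = i" for j using i by blast
  have "X $ i $ i * v $ i = (X *v v) $ i" by (simp add: matrix_vector_mult_def i)
  then have "X $ i $ i * v $ i = 0" using v(2) by simp
  moreover have "v $ i \<noteq> 0" using v(1) eq by (metis vec_eq_iff zero_index)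
  ultimately have "X = 0" unfolding vec_eq_iff using eq by (metis mult_eq_0_iff zero_index)
  define \<gamma> :: "real \<Rightarrow> 'k par" where "\<gamma> \<eta> = (outer 0 (\<eta> *\<^sub>R axis b 1), W, \<eta> *\<^sub>R axis b 1)" for \<eta> :: real
  have "det W \<noteq> 0" using ns by (auto simp: nonsingular_pencil_def dest: spec [of _ 0])
  have "\<gamma> 0 \<in> closure (R_z_nonzero b)"
  proof (rule curve_start_in_closure)
    show "continuous_on UNIV \<gamma>" unfolding \<gamma>_def by (intro continuous_intros)
    have "\<gamma> \<eta> \<in> R_z_nonzero b" if "\<eta> > 0" for \<eta>
    proof -
      have "\<gamma> \<eta> \<in> R_par"
        unfolding \<gamma>_def R_par_outer using \<open>det W \<noteq> 0\<close> det_nonzero_iff_kernel [of W] by blast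
      then show ?thesis using that by (simp add: R_z_nonzero_def \<gamma>_def)
    qed
    then show "\<forall>\<^sub>F \<eta> in at_right 0. \<gamma> \<eta> \<in> R_z_nonzero b"
      using eventually_at_right_pos by (auto elim: eventually_mono)
  qed
  moreover have "outer 0 (0 :: real ^ 'k) = 0" by (simp add: outer_def vec_eq_iff)
  ultimately show ?thesis by (simp add: \<gamma>_def \<open>X = 0\<close>)
qed

lemma z0_in_closure_R_even:
  fixes X W :: "real ^ 'k::finite ^ 'k"
  assumes ns: "nonsingular_pencil X W" and "even CARD('k)"
  shows "(X, W, 0) \<in> closure (R_even b)"
proof -
  have step: "(X, W, 0) \<in> closure (R_even b)" if X: "nonsingular_pencil X W" "det X \<noteq> 0" for X
  proof (cases "X $ b $ b = 0")
    case False
    then have "(X, W, 0) \<in> R_even b" using X by (simp add: R_even_def R_par_z0)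
    then show ?thesis using closure_subset by blast
  next
    case True
    \<comment> \<open>Only the pivot entry moves; nonsingular pencils with invertible
      \<open>X\<close> form an open set.\<close>
    define Y where "Y \<eta> = X + \<eta> *\<^sub>R outer (axis b 1) (axis b 1)" for \<eta> :: real
    define \<gamma> :: "real \<Rightarrow> 'k par" where "\<gamma> \<eta> = (Y \<eta>, W, 0)" for \<eta>
    have Yc: "continuous_on UNIV (\<lambda>\<eta>. (Y \<eta>, W))" unfolding Y_def by (intro continuous_intros)
    have "\<gamma> 0 \<in> closure (R_even b)"
    proof (rule curve_start_in_closure)
      show "continuous_on UNIV \<gamma>" unfolding \<gamma>_def Y_def by (intro continuous_intros)
      have "\<forall>\<^sub>F \<eta> in at_right 0. (Y \<eta>, W) \<in> {(X, W). nonsingular_pencil X W \<and> det X \<noteq> 0}"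
        by (rule eventually_at_right_in_open [OF Yc open_nonsingular_pencils]) (simp add: Y_def X)
      then show "\<forall>\<^sub>F \<eta> in at_right 0. \<gamma> \<eta> \<in> R_even b"
        using eventually_at_right_pos
      proof eventually_elim
        case (elim \<eta>)
        have "Y \<eta> $ b $ b = \<eta>" using True by (simp add: Y_def outer_def)
        then show ?case using elim by (simp add: \<gamma>_def R_even_def R_par_z0)
      qed
    qed
    then show ?thesis by (simp add: \<gamma>_def Y_def)
  qed
  have "(X, W, 0) \<in> closure (closure (R_even b))"
    unfolding closure_approachable
  proof (intro allI impI)
    fix e :: real assume "e > 0"
    then obtain X' where X': "dist X' X < e" "nonsingular_pencil X' W"
      "det X' \<noteq> 0 \<or> (\<exists>v. simple_kernel X' W v)"
      using generic_pencils_dense [OF ns] by blast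
    then have "det X' \<noteq> 0" using even_pencil_no_simple_kernel \<open>even CARD('k)\<close> by blast
    then have "(X', W, 0) \<in> closure (R_even b)" using step X' by blast
    moreover have "dist (X', W, 0 :: real ^ 'k) (X, W, 0) < e" using X'(1) by (simp add: dist_Pair_Pair)
    ultimately show "\<exists>y\<in>closure (R_even b). dist y (X, W, 0) < e" by blast
  qed
  then show ?thesis by simp
qed

text \<open>Multiplying \<open>X\<close> and \<open>W\<close> by the same invertible matrix keeps a
  singular \<open>X\<close> singular and a simple kernel simple, which additive perturbations need
  not do. Such transformations carry the density proof for odd \<open>k\<close>.\<close>

lemma nonsingular_pencil_mult_left:
  assumes "nonsingular_pencil X W" "det Q \<noteq> 0"
  shows "nonsingular_pencil (Q ** X) (Q ** W)"
proof -
  have "Q ** W + t *\<^sub>R (Q ** X) = Q ** (W + t *\<^sub>R X)" for t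
    unfolding matrix_eq
    by (simp add: pencil_mult_vec matrix_vector_right_distrib matrix_vector_mult_scaleR
        flip: matrix_vector_mul_assoc)
  then show ?thesis using assms by (simp add: nonsingular_pencil_def det_mul)
qed

lemma nonsingular_pencil_mult_right:
  assumes "nonsingular_pencil X W" "det P \<noteq> 0"
  shows "nonsingular_pencil (X ** P) (W ** P)"
proof -
  have "W ** P + t *\<^sub>R (X ** P) = (W + t *\<^sub>R X) ** P" for t
    unfolding matrix_eq
    by (simp add: pencil_mult_vec flip: matrix_vector_mul_assoc)
  then show ?thesis using assms by (simp add: nonsingular_pencil_def det_mul)
qed

lemma simple_kernel_mult_left:
  assumes sk: "simple_kernel X W v" and "det Q \<noteq> 0"
  shows "simple_kernel (Q ** X) (Q ** W) v"
proof -
  have inj: "Q *v x = Q *v y \<longleftrightarrow> x = y" for x y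
    using assms(2) det_nonzero_iff_kernel [of Q] matrix_vector_mult_diff_distrib [of Q x y] by auto
  have inj0: "Q *v x = 0 \<longleftrightarrow> x = 0" for x using inj [of x 0] by simp
  show ?thesis
    using sk unfolding simple_kernel_def matrix_vector_mul_assoc [symmetric] inj0
    by (auto simp: inj)
qed

lemma simple_kernel_mult_right:
  assumes sk: "simple_kernel X W v" and "det P \<noteq> 0" and v': "P *v v' = v"
  shows "simple_kernel (X ** P) (W ** P) v'"
  unfolding simple_kernel_def matrix_vector_mul_assoc [symmetric] v'
proof (intro conjI allI impI)
  show "v' \<noteq> 0" using sk v' by (auto simp: simple_kernel_def)
  show "X *v v = 0" using sk by (simp add: simple_kernel_def)
  show "W *v v \<notin> range (\<lambda>x. X *v (P *v x))" using sk by (auto simp: simple_kernel_def)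
  fix u assume "X *v (P *v u) = 0"
  then obtain r where "P *v u = r *\<^sub>R v" using sk by (auto simp: simple_kernel_def)
  then have "P *v (u - r *\<^sub>R v') = 0"
    by (simp add: matrix_vector_mult_diff_distrib matrix_vector_mult_scaleR v')
  then show "\<exists>r. u = r *\<^sub>R v'" using assms(2) det_nonzero_iff_kernel [of P] by auto
qed

lemma det_hat_kernel:
  assumes "simple_kernel X W v" "v $ b \<noteq> 0" "axis b 1 \<notin> range ((*v) X)"
  shows "det (hat b X) \<noteq> 0"
  unfolding hat_def
  by (rule det_replace_col_kernel [where v = v]) (use assms in \<open>auto simp: simple_kernel_def\<close>)

text \<open>With \<open>v\<close> scaled to have entry 1 at \<open>b\<close>, \<open>X v = 0\<close>
  expresses column \<open>b\<close> through the other columns, and invertibility of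
  \<open>hat b X\<close> makes the coefficients unique.\<close>

lemma kernel_col_coords:
  assumes "v \<noteq> 0" "X *v v = 0" and h: "det (hat b X) \<noteq> 0"
  shows "v $ b \<noteq> 0" "axis b 1 - col_coords b X = (1 / v $ b) *\<^sub>R v"
proof -
  show vb: "v $ b \<noteq> 0"
  proof
    assume "v $ b = 0"
    then have "hat b X *v v = 0" using assms(2) by (simp add: hat_mult_vec)
    then show False using h assms(1) det_nonzero_iff_kernel [of "hat b X"] by blast
  qed
  define v' where "v' = (1 / v $ b) *\<^sub>R v"
  have "X *v v' = 0" using assms(2) by (simp add: v'_def matrix_vector_mult_scaleR)
  moreover have "v' $ b = 1" using vb by (simp add: v'_def)
  ultimately have "hat b X *v (axis b 1 - v') = column b X"
    unfolding matrix_vector_mult_diff_distrib matrix_vector_mult_basis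
    by (simp add: hat_mult_vec) (simp add: hat_def)
  then have "axis b 1 - v' = col_coords b X" using hat_mult_eq_iff [OF h] by blast
  then show "axis b 1 - col_coords b X = (1 / v $ b) *\<^sub>R v" by (simp add: v'_def algebra_simps)
qed

lemma simple_kernel_in_R_odd:
  assumes "nonsingular_pencil X W" and sk: "simple_kernel X W v" and h: "det (hat b X) \<noteq> 0"
    and "X $ a $ a \<noteq> 0"
  shows "(X, W, 0) \<in> R_odd a b"
proof -
  have vb: "v $ b \<noteq> 0" and c: "axis b 1 - col_coords b X = (1 / v $ b) *\<^sub>R v"
    using kernel_col_coords [OF _ _ h] sk by (auto simp: simple_kernel_def)
  have "det (replace_col b (W *v v) X) \<noteq> 0"
    by (rule det_replace_col_kernel [where v = v]) (use sk vb in \<open>auto simp: simple_kernel_def\<close>)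
  then have "det (replace_col b (W *v (axis b 1 - col_coords b X)) X) \<noteq> 0"
    unfolding c matrix_vector_mult_scaleR det_replace_col_scaleR using vb by simp
  then show ?thesis using assms by (simp add: R_odd_def R_par_z0)
qed

text \<open>Three generic conditions are secured on top of the simple kernel:
  \<open>v $ b \<noteq> 0\<close> in \<open>N1\<close>, \<open>axis b 1\<close> outside the range of
  \<open>X\<close> in \<open>N2\<close>, and \<open>X $ a $ a \<noteq> 0\<close> in
  \<open>N3\<close>. Each is produced by a multiplicative perturbation, so \<open>N1\<close> reduces
  to \<open>N2\<close> and \<open>N2\<close> to \<open>N3\<close> through closures.\<close>

lemma z0_in_closure_R_odd:
  fixes X W :: "real ^ 'k::finite ^ 'k"
  assumes ns: "nonsingular_pencil X W" and "odd CARD('k)" and "a \<noteq> b"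
  shows "(X, W, 0) \<in> closure (R_odd a b)"
proof -
  have N3: "(X, W, 0) \<in> closure (R_odd a b)"
    if X: "nonsingular_pencil X W" "simple_kernel X W v" "det (hat b X) \<noteq> 0" for X W v
  proof (cases "X $ a $ a = 0")
    case False
    then show ?thesis using simple_kernel_in_R_odd [OF X] closure_subset by blast
  next
    case True
    have "hat b X *v axis a 1 \<noteq> 0"
      using X(3) det_nonzero_iff_kernel [of "hat b X"] by (metis axis_eq_0_iff zero_neq_one)
    \<comment> \<open>For \<open>a \<noteq> b\<close> the matrix \<open>hat b X\<close> shares
      column \<open>a\<close> with \<open>X\<close>.\<close>
    then have "column a X \<noteq> 0"
      unfolding matrix_vector_mult_basis using \<open>a \<noteq> b\<close>
      by (auto simp: hat_def replace_col_def column_def vec_eq_iff)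
    then obtain i where i: "X $ i $ a \<noteq> 0" by (auto simp: vec_eq_iff column_def)
    then have "i \<noteq> a" using True by auto
    \<comment> \<open>The row operation adding \<open>\<eta>\<close> times row \<open>i\<close> to
      row \<open>a\<close>.\<close>
    define Q where "Q \<eta> = mat 1 + outer (\<eta> *\<^sub>R axis a 1) (axis i 1)" for \<eta> :: real
    have Qc: "continuous_on UNIV Q" unfolding Q_def by (intro continuous_intros)
    have Qd: "det (Q \<eta>) = 1" for \<eta>
      unfolding Q_def det_mat_1_plus_outer using \<open>i \<noteq> a\<close> by (simp add: inner_axis_axis)
    have Q0: "Q 0 ** A = A" for A :: "real ^ 'k ^ 'k"
      by (simp add: Q_def outer_def flip: zero_vec_def)
    define \<gamma> :: "real \<Rightarrow> 'k par" where "\<gamma> \<eta> = (Q \<eta> ** X, Q \<eta> ** W, 0)" for \<eta>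
    have "\<gamma> 0 \<in> closure (R_odd a b)"
    proof (rule curve_start_in_closure)
      show "continuous_on UNIV \<gamma>" unfolding \<gamma>_def by (intro continuous_intros Qc)
      have "\<forall>\<^sub>F \<eta> in at_right 0. det (hat b (Q \<eta> ** X)) \<noteq> 0"
        by (rule eventually_at_right_nonzero)
           (use X(3) in \<open>auto simp: hat_def Q0 intro!: continuous_intros Qc\<close>)
      then show "\<forall>\<^sub>F \<eta> in at_right 0. \<gamma> \<eta> \<in> R_odd a b"
        using eventually_at_right_pos
      proof eventually_elim
        case (elim \<eta>)
        have "(Q \<eta> ** X) $ a $ a = ((Q \<eta> ** X) *v axis a 1) $ a"
          by (simp add: matrix_vector_mult_basis column_def)
        also have "\<dots> = (Q \<eta> *v column a X) $ a"
          by (metis matrix_vector_mult_basis matrix_vector_mul_assoc)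
        also have "\<dots> = \<eta> * X $ i $ a"
          using True by (simp add: Q_def matrix_vector_mult_add_rdistrib outer_mult_vec inner_axis' column_def)
        finally have "(Q \<eta> ** X) $ a $ a \<noteq> 0" using elim i by simp
        then show ?case
          unfolding \<gamma>_def using elim Qd X
          by (intro simple_kernel_in_R_odd [of _ _ v] nonsingular_pencil_mult_left simple_kernel_mult_left) auto
      qed
    qed
    then show ?thesis by (simp add: \<gamma>_def Q0)
  qed
  have N2: "(X, W, 0) \<in> closure (R_odd a b)"
    if X: "nonsingular_pencil X W" "simple_kernel X W v" "v $ b \<noteq> 0" for X W v
  proof (cases "axis b 1 \<in> range ((*v) X)")
    case False
    then show ?thesis using N3 X det_hat_kernel by blast
  next
    case True
    \<comment> \<open>Tilts the range of \<open>X\<close> towards \<open>W v\<close>, which lies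
      outside it: \<open>X u\<close> moves to \<open>X u - \<eta> ((X u) $ b) W v\<close>, so
      \<open>axis b 1\<close>, formerly in the range, leaves it.\<close>
    define Q where "Q \<eta> = mat 1 + outer ((- \<eta>) *\<^sub>R (W *v v)) (axis b 1)" for \<eta> :: real
    have Qc: "continuous_on UNIV Q" unfolding Q_def by (intro continuous_intros)
    have Q0: "Q 0 ** A = A" for A :: "real ^ 'k ^ 'k"
      by (simp add: Q_def outer_def flip: zero_vec_def)
    define \<gamma> :: "real \<Rightarrow> 'k par" where "\<gamma> \<eta> = (Q \<eta> ** X, Q \<eta> ** W, 0)" for \<eta>
    have "\<gamma> 0 \<in> closure (closure (R_odd a b))"
    proof (rule curve_start_in_closure)
      show "continuous_on UNIV \<gamma>" unfolding \<gamma>_def by (intro continuous_intros Qc)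
      have "\<forall>\<^sub>F \<eta> in at_right 0. det (Q \<eta>) \<noteq> 0"
        by (rule eventually_at_right_nonzero)
           (auto simp: Q_def det_mat_1_plus_outer intro!: continuous_intros Qc)
      then show "\<forall>\<^sub>F \<eta> in at_right 0. \<gamma> \<eta> \<in> closure (R_odd a b)"
        using eventually_at_right_pos
      proof eventually_elim
        case (elim \<eta>)
        have "axis b 1 \<noteq> (Q \<eta> ** X) *v u" for u
        proof
          assume "axis b 1 = (Q \<eta> ** X) *v u"
          then have e: "axis b 1 = X *v u - (\<eta> * (X *v u) $ b) *\<^sub>R (W *v v)"
            by (simp add: Q_def matrix_vector_mult_add_rdistrib outer_mult_vec inner_axis' mult.commute
                flip: matrix_vector_mul_assoc)
          obtain w where w: "axis b 1 = X *v w" using True by auto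
          define r where "r = \<eta> * (X *v u) $ b"
          have rW: "r *\<^sub>R (W *v v) = X *v (u - w)"
            using e w by (simp add: r_def matrix_vector_mult_diff_distrib)
          have "r = 0"
          proof (rule ccontr)
            assume "r \<noteq> 0"
            then have "W *v v = X *v ((1 / r) *\<^sub>R (u - w))"
              by (simp add: matrix_vector_mult_scaleR flip: rW)
            then show False using X(2) by (auto simp: simple_kernel_def)
          qed
          then have "axis b 1 = X *v u" using e by (simp flip: r_def)
          then have "(X *v u) $ b = 1" by (metis axis_nth)
          then show False using \<open>r = 0\<close> elim by (simp add: r_def)
        qed
        then have "axis b 1 \<notin> range ((*v) (Q \<eta> ** X))" by auto
        then show ?case
          unfolding \<gamma>_def using elim X
          by (intro N3 [of _ _ v] det_hat_kernel [of _ "Q \<eta> ** W" v] nonsingular_pencil_mult_left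
              simple_kernel_mult_left) auto
      qed
    qed
    then show ?thesis by (simp add: \<gamma>_def Q0)
  qed
  have N1: "(X, W, 0) \<in> closure (R_odd a b)"
    if X: "nonsingular_pencil X W" "simple_kernel X W v" for X W v
  proof (cases "v $ b = 0")
    case False
    then show ?thesis using N2 X by blast
  next
    case True
    define f where "f = (1 / (v \<bullet> v)) *\<^sub>R v"
    have "v \<noteq> 0" using X by (simp add: simple_kernel_def)
    then have fv: "f \<bullet> v = 1" "f $ b = 0" using True by (simp_all add: f_def)
    \<comment> \<open>Multiplication on the right moves the kernel vector from \<open>v\<close> to
      \<open>v + \<eta> axis b 1\<close>; \<open>f $ b = 0\<close> keeps the determinant equal to
      1.\<close>
    define P where "P \<eta> = mat 1 + outer ((- \<eta>) *\<^sub>R axis b 1) f" for \<eta> :: real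
    have Pc: "continuous_on UNIV P" unfolding P_def by (intro continuous_intros)
    have Pd: "det (P \<eta>) = 1" for \<eta>
      unfolding P_def det_mat_1_plus_outer using fv by (simp add: inner_axis)
    have P0: "A ** P 0 = A" for A :: "real ^ 'k ^ 'k"
      by (simp add: P_def outer_def flip: zero_vec_def)
    define \<gamma> :: "real \<Rightarrow> 'k par" where "\<gamma> \<eta> = (X ** P \<eta>, W ** P \<eta>, 0)" for \<eta>
    have "\<gamma> 0 \<in> closure (closure (R_odd a b))"
    proof (rule curve_start_in_closure)
      show "continuous_on UNIV \<gamma>" unfolding \<gamma>_def by (intro continuous_intros Pc)
      show "\<forall>\<^sub>F \<eta> in at_right 0. \<gamma> \<eta> \<in> closure (R_odd a b)"
        using eventually_at_right_pos
      proof eventually_elim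
        case (elim \<eta>)
        define v' where "v' = v + \<eta> *\<^sub>R axis b 1"
        have "P \<eta> *v v' = v"
          using fv by (simp add: P_def v'_def matrix_vector_mult_add_rdistrib outer_mult_vec
              inner_add_right inner_axis)
        moreover have "v' $ b \<noteq> 0" using elim True by (simp add: v'_def)
        ultimately show ?case
          unfolding \<gamma>_def using Pd X
          by (intro N2 [of _ _ v'] nonsingular_pencil_mult_right simple_kernel_mult_right [of _ _ v]) auto
      qed
    qed
    then show ?thesis by (simp add: \<gamma>_def P0)
  qed
  have "(X, W, 0) \<in> closure (closure (R_odd a b))"
    unfolding closure_approachable
  proof (intro allI impI)
    fix e :: real assume "e > 0"
    then obtain X' where X': "dist X' X < e" "nonsingular_pencil X' W"
      "det X' \<noteq> 0 \<or> (\<exists>v. simple_kernel X' W v)"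
      using generic_pencils_dense [OF ns] by blast
    then obtain v where "simple_kernel X' W v" using odd_pencil_singular \<open>odd CARD('k)\<close> by blast
    then have "(X', W, 0) \<in> closure (R_odd a b)" using N1 X' by blast
    moreover have "dist (X', W, 0 :: real ^ 'k) (X, W, 0) < e" using X'(1) by (simp add: dist_Pair_Pair)
    ultimately show "\<exists>y\<in>closure (R_odd a b). dist y (X, W, 0) < e" by blast
  qed
  then show ?thesis by simp
qed

section \<open>Charts of the deformation space\<close>

lemma orbit_of_z0_eq_iff:
  "orbit_of (X, W, 0) = orbit_of (X', W', 0) \<longleftrightarrow> X' = X \<and> (\<exists>c. W' = W - c *\<^sub>R X)"
proof -
  have "outer a 0 = 0" for a :: "real ^ 'a" by (simp add: outer_def vec_eq_iff)
  then show ?thesis by (simp add: orbit_of_eq_iff)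
qed

lemma nonsingular_pencil_shift:
  assumes "nonsingular_pencil X W"
  shows "nonsingular_pencil X (W - c *\<^sub>R X)"
proof -
  have "W - c *\<^sub>R X + t *\<^sub>R X = W + (t - c) *\<^sub>R X" for t by (simp add: scaleR_diff_left)
  then show ?thesis using assms unfolding nonsingular_pencil_def by metis
qed

section \<open>Chart on the piece with nonzero z\<close>

lemma R_z_nonzero_openin: "openin (top_of_set R_par) (R_z_nonzero b)"
proof -
  have "open {p :: 'a par. snd (snd p) $ b \<noteq> 0}" by (intro open_Collect_neq continuous_intros)
  then have "openin (top_of_set R_par) (R_par \<inter> {p. snd (snd p) $ b \<noteq> 0})" by (rule openin_open_Int)
  moreover have "R_par \<inter> {p. snd (snd p) $ b \<noteq> 0} = R_z_nonzero b" by (auto simp: R_z_nonzero_def)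
  ultimately show ?thesis by simp
qed

text \<open>For \<open>X = x z^T\<close> conjugation adds \<open>(a - c x) z^T\<close> to
  \<open>W\<close>, so \<open>c\<close> is absorbed by \<open>a\<close>, and
  \<open>z $ b \<noteq> 0\<close> determines the translation that clears column \<open>b\<close>.
  What remains is \<open>w\<close> with \<open>k^2 - k\<close> free entries, \<open>x\<close> and
  \<open>z\<close>.\<close>

lemma R_z_nonzero_chart:
  fixes b :: "'k::finite"
  shows "\<exists>\<phi>. is_chart deformation_space (CARD('k)\<^sup>2 + CARD('k), orbit_of ` R_z_nonzero b, \<phi>)"
proof -
  define K :: "((real ^ 'k ^ 'k) \<times> (real ^ 'k) \<times> (real ^ 'k)) set"
    where "K = (\<lambda>i. (axis i (axis b 1), 0)) ` UNIV"
  define inj :: "real ^ 'k ^ 'k \<Rightarrow> real ^ 'k \<Rightarrow> bool"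
    where "inj w z \<longleftrightarrow> (\<forall>v. w *v v = 0 \<and> z \<bullet> v = 0 \<longrightarrow> v = 0)" for w z
  define V where "V = {(w, x :: real ^ 'k, z). column b w = 0 \<and> z $ b \<noteq> 0 \<and> inj w z}"
  define F where "F = (\<lambda>(X :: real ^ 'k ^ 'k, W, z).
    (W - outer ((1 / z $ b) *\<^sub>R column b W) z, (1 / z $ b) *\<^sub>R column b X, z))"
  define S where "S = (\<lambda>(w :: real ^ 'k ^ 'k, x, z :: real ^ 'k). (outer x z, w, z))"
  have KB: "K \<subseteq> Basis" by (auto simp: K_def Basis_prod_def axis_in_Basis_iff)
  have "inj_on (\<lambda>i :: 'k. (axis i (axis b (1 :: real)), 0 :: (real ^ 'k) \<times> (real ^ 'k))) UNIV"
    by (auto simp: inj_on_def axis_eq_axis)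
  then have "card K = CARD('k)" unfolding K_def by (simp add: card_image)
  then have dim: "DIM((real ^ 'k ^ 'k) \<times> (real ^ 'k) \<times> (real ^ 'k)) - card K = CARD('k)\<^sup>2 + CARD('k)"
    by (simp add: power2_eq_square)
  have L: "(\<forall>i\<in>K. p \<bullet> i = 0) \<longleftrightarrow> column b (fst p) = 0" for p
    by (cases p) (simp add: K_def inner_axis vec_eq_iff column_def)
  have R: "X = outer ((1 / z $ b) *\<^sub>R column b X) z \<and> inj W z" if "(X, W, z) \<in> R_z_nonzero b" for X W z
  proof -
    have p: "(X, W, z) \<in> R_par" "z $ b \<noteq> 0" using that by (auto simp: R_z_nonzero_def)
    then have X: "X = outer ((1 / z $ b) *\<^sub>R column b X) z"
      using commuting_rank_one [of X z b] by (simp add: R_par_def)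
    moreover have "inj W z" using p(1) R_par_outer [of "(1 / z $ b) *\<^sub>R column b X" z W] X by (simp add: inj_def)
    ultimately show ?thesis by blast
  qed
  have diff: "outer (x - y) z = outer x z - outer y z" "outer (x + y) z = outer x z + outer y z"
    "outer (r *\<^sub>R x) z = r *\<^sub>R outer x z" "column b (outer x z) = z $ b *\<^sub>R x"
    "column b (r *\<^sub>R A) = r *\<^sub>R column b A"
    "column b (A + B) = column b A + column b B" "column b (A - B) = column b A - column b B"
    for x y z :: "real ^ 'k" and r and A B :: "real ^ 'k ^ 'k"
    by (auto simp: outer_def vec_eq_iff column_def algebra_simps)
  have "\<exists>\<phi>. is_chart deformation_space
      (DIM((real ^ 'k ^ 'k) \<times> (real ^ 'k) \<times> (real ^ 'k)) - card K, orbit_of ` R_z_nonzero b, \<phi>)"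
  proof (rule chart_of_section [OF quotient_map_orbit_of R_z_nonzero_openin, where F = F and S = S and V = V])
    have "(outer 0 (axis b 1), mat 1, axis b 1) \<in> R_par" unfolding R_par_outer by simp
    then have "(outer 0 (axis b 1), mat 1, axis b 1) \<in> R_z_nonzero b" by (simp add: R_z_nonzero_def)
    then show "R_z_nonzero b \<noteq> {}" by blast
    show "p' \<in> R_z_nonzero b" if "p \<in> R_z_nonzero b" "p' \<in> R_par" "orbit_of p = orbit_of p'" for p p'
      using that by (cases p; cases p') (auto simp: R_z_nonzero_def orbit_of_eq_iff)
    show "K \<subseteq> Basis" by (rule KB)
    \<comment> \<open>The joint kernel condition can be tested on the compact unit sphere, whence it
      is open.\<close>
    have "open {p :: (real ^ 'k ^ 'k) \<times> (real ^ 'k) \<times> (real ^ 'k).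
        \<forall>u\<in>sphere 0 1. norm (fst p *v u) + \<bar>snd (snd p) \<bullet> u\<bar> \<noteq> 0}"
      by (intro open_nonzero_on_compact compact_sphere)
         (simp add: case_prod_beta, intro continuous_intros)
    moreover have "(\<forall>u\<in>sphere 0 1. norm (w *v u) + \<bar>z \<bullet> u\<bar> \<noteq> 0) \<longleftrightarrow> inj w z" for w z
    proof
      assume a: "\<forall>u\<in>sphere 0 1. norm (w *v u) + \<bar>z \<bullet> u\<bar> \<noteq> 0"
      show "inj w z"
        unfolding inj_def
      proof (intro allI impI, rule ccontr)
        fix v assume v: "w *v v = 0 \<and> z \<bullet> v = 0" "v \<noteq> 0"
        then have "v /\<^sub>R norm v \<in> sphere 0 1" by simp
        moreover have "norm (w *v (v /\<^sub>R norm v)) + \<bar>z \<bullet> (v /\<^sub>R norm v)\<bar> = 0"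
          using v by (simp add: matrix_vector_mult_scaleR)
        ultimately show False using a by blast
      qed
    next
      assume i: "inj w z"
      show "\<forall>u\<in>sphere 0 1. norm (w *v u) + \<bar>z \<bullet> u\<bar> \<noteq> 0"
      proof
        fix u :: "real ^ 'k" assume "u \<in> sphere 0 1"
        then have "u \<noteq> 0" by auto
        then have "w *v u \<noteq> 0 \<or> z \<bullet> u \<noteq> 0" using i by (auto simp: inj_def)
        then show "norm (w *v u) + \<bar>z \<bullet> u\<bar> \<noteq> 0"
          by (metis abs_ge_zero abs_eq_0 add_nonneg_eq_0_iff norm_eq_zero norm_ge_zero)
      qed
    qed
    ultimately have "open {p :: (real ^ 'k ^ 'k) \<times> (real ^ 'k) \<times> (real ^ 'k). inj (fst p) (snd (snd p))}"
      by simp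
    moreover have "open {p :: (real ^ 'k ^ 'k) \<times> (real ^ 'k) \<times> (real ^ 'k). snd (snd p) $ b \<noteq> 0}"
      by (intro open_Collect_neq continuous_intros)
    ultimately have "openin (top_of_set {x. \<forall>i\<in>K. x \<bullet> i = 0}) ({x. \<forall>i\<in>K. x \<bullet> i = 0} \<inter>
        ({p. inj (fst p) (snd (snd p))} \<inter> {p. snd (snd p) $ b \<noteq> 0}))"
      by (intro openin_open_Int open_Int)
    moreover have "{x. \<forall>i\<in>K. x \<bullet> i = 0} \<inter> ({p. inj (fst p) (snd (snd p))} \<inter> {p. snd (snd p) $ b \<noteq> 0}) = V"
      unfolding L V_def by auto
    ultimately show "openin (top_of_set {x. \<forall>i\<in>K. x \<bullet> i = 0}) V" by simp
    show "continuous_on (R_z_nonzero b) F"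
      unfolding F_def case_prod_beta
      by (intro continuous_intros) (auto simp: R_z_nonzero_def)
    show "F ` R_z_nonzero b \<subseteq> V"
    proof (intro image_subsetI)
      fix p assume p: "p \<in> R_z_nonzero b"
      obtain X W z where q: "p = (X, W, z)" by (metis surj_pair)
      have zb: "z $ b \<noteq> 0" and iW: "inj W z" using p R [of X W z] by (auto simp: q R_z_nonzero_def)
      have "inj (W - outer ((1 / z $ b) *\<^sub>R column b W) z) z"
        using iW by (auto simp: inj_def matrix_vector_mult_diff_rdistrib outer_mult_vec)
      then show "F p \<in> V" using zb by (simp add: F_def V_def q diff)
    qed
    show "F p = F p'" if pp: "p \<in> R_z_nonzero b" "p' \<in> R_z_nonzero b" "orbit_of p = orbit_of p'" for p p'
    proof -
      obtain X W z X' W' z' where q: "p = (X, W, z)" "p' = (X', W', z')" by (metis surj_pair)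
      obtain a c where o: "X' = X" "z' = z" "W' = W + outer a z - c *\<^sub>R X"
        using pp(3) unfolding q orbit_of_eq_iff by blast
      define x where "x = (1 / z $ b) *\<^sub>R column b X"
      have X: "X = outer x z" using R pp(1) by (auto simp: q x_def)
      have zb: "z $ b \<noteq> 0" using pp(1) by (simp add: q R_z_nonzero_def)
      define a' where "a' = a - c *\<^sub>R x"
      have W': "W' = W + outer a' z" unfolding o a'_def by (subst X) (simp add: diff)
      have "column b W' = column b W + z $ b *\<^sub>R a'" by (simp add: W' diff)
      then have "(1 / z $ b) *\<^sub>R column b W' = (1 / z $ b) *\<^sub>R column b W + a'"
        using zb by (simp add: scaleR_add_right)
      then have "W' - outer ((1 / z $ b) *\<^sub>R column b W') z = W - outer ((1 / z $ b) *\<^sub>R column b W) z"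
        by (simp only: diff(2)) (simp add: W')
      then show ?thesis by (simp add: F_def q o(1,2))
    qed
    show "continuous_on V S" unfolding S_def case_prod_beta by (intro continuous_intros)
    show "S ` V \<subseteq> R_z_nonzero b"
      by (auto simp: S_def V_def R_z_nonzero_def R_par_outer inj_def)
    show "F (S v) = v" if "v \<in> V" for v
      using that by (auto simp: F_def S_def V_def diff) (simp add: outer_def vec_eq_iff)
    show "orbit_of (S (F p)) = orbit_of p" if p: "p \<in> R_z_nonzero b" for p
    proof -
      obtain X W z where q: "p = (X, W, z)" by (metis surj_pair)
      have "S (F p) = (X, W - outer ((1 / z $ b) *\<^sub>R column b W) z, z)"
        using R p by (simp add: q S_def F_def)
      moreover have "W = W - outer ((1 / z $ b) *\<^sub>R column b W) z + outer ((1 / z $ b) *\<^sub>R column b W) z - 0 *\<^sub>R X"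
        by simp
      ultimately show ?thesis unfolding q by (metis orbit_of_eq_iff)
    qed
  qed
  then show ?thesis by (simp only: dim)
qed

section \<open>Chart for even k: invertible X\<close>

lemma R_even_z0:
  fixes X W :: "real ^ 'k::finite ^ 'k"
  assumes p: "(X, W, z) \<in> R_even b" and card: "CARD('k) \<ge> 2"
  shows "z = 0"
proof (rule ccontr)
  assume "z \<noteq> 0"
  then obtain i where i: "z $ i \<noteq> 0" by (auto simp: vec_eq_iff)
  obtain j where j: "j \<noteq> i"
    using card by (metis (full_types) One_nat_def UNIV_eq_I card_1_singleton_iff insertI1 not_less_eq_eq numeral_2_eq_2 order_refl)
  \<comment> \<open>Orthogonal to \<open>z\<close>, hence in the kernel of the rank-one
    \<open>X\<close>; nonzero because its entry at \<open>j\<close> is \<open>z $ i\<close>.\<close>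
  define v :: "real ^ 'k" where "v = z $ i *\<^sub>R axis j 1 - z $ j *\<^sub>R axis i 1"
  define x where "x = (1 / z $ i) *\<^sub>R column i X"
  have "commuting X z" "det X \<noteq> 0" using p by (auto simp: R_even_def R_par_def)
  then have X: "X = outer x z" using commuting_rank_one i by (simp add: x_def)
  have "z \<bullet> v = 0" by (simp add: v_def inner_diff_right inner_axis)
  then have "X *v v = 0" by (subst X) (simp add: outer_mult_vec)
  moreover have "v $ j = z $ i" using j by (simp add: v_def axis_def)
  ultimately show False using \<open>det X \<noteq> 0\<close> i det_nonzero_iff_kernel [of X] by auto
qed

lemma R_even_openin: "openin (top_of_set R_par) (R_even b)"
proof -
  have "open ({p :: 'a par. det (fst p) \<noteq> 0} \<inter> {p. fst p $ b $ b \<noteq> 0})"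
    by (intro open_Int open_Collect_neq continuous_intros)
  then have "openin (top_of_set R_par) (R_par \<inter> ({p. det (fst p) \<noteq> 0} \<inter> {p. fst p $ b $ b \<noteq> 0}))"
    by (rule openin_open_Int)
  moreover have "R_par \<inter> ({p. det (fst p) \<noteq> 0} \<inter> {p. fst p $ b $ b \<noteq> 0}) = R_even b"
    by (auto simp: R_even_def)
  ultimately show ?thesis by simp
qed

text \<open>The orbit of \<open>(X, W, 0)\<close> is the line of all \<open>W - c X\<close>, and the
  pivot \<open>X $ b $ b\<close> selects exactly one point of it with
  \<open>W $ b $ b = 0\<close>.\<close>

lemma R_even_chart:
  fixes b :: "'k::finite"
  assumes card: "CARD('k) \<ge> 2" and ne: "R_even b \<noteq> {}"
  shows "\<exists>\<phi>. is_chart deformation_space (2 * CARD('k)\<^sup>2 - 1, orbit_of ` R_even b, \<phi>)"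
proof -
  define K :: "((real ^ 'k ^ 'k) \<times> (real ^ 'k ^ 'k)) set"
    where "K = {(0, axis b (axis b 1))}"
  define V where "V = {(X :: real ^ 'k ^ 'k, W). W $ b $ b = 0 \<and> X $ b $ b \<noteq> 0 \<and>
    nonsingular_pencil X W \<and> det X \<noteq> 0}"
  define F where "F = (\<lambda>(X :: real ^ 'k ^ 'k, W, z :: real ^ 'k). (X, W - (W $ b $ b / X $ b $ b) *\<^sub>R X))"
  define S where "S = (\<lambda>(X :: real ^ 'k ^ 'k, W :: real ^ 'k ^ 'k). (X, W, 0 :: real ^ 'k))"
  have KB: "K \<subseteq> Basis" by (auto simp: K_def Basis_prod_def axis_in_Basis_iff)
  have dim: "DIM((real ^ 'k ^ 'k) \<times> (real ^ 'k ^ 'k)) - card K = 2 * CARD('k)\<^sup>2 - 1"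
    by (simp add: power2_eq_square K_def)
  have L: "(\<forall>i\<in>K. p \<bullet> i = 0) \<longleftrightarrow> snd p $ b $ b = 0" for p
    by (cases p) (simp add: K_def inner_axis)
  have R: "\<exists>X W. p = (X, W, 0) \<and> nonsingular_pencil X W \<and> det X \<noteq> 0 \<and> X $ b $ b \<noteq> 0"
    if "p \<in> R_even b" for p
  proof -
    obtain X W z where q: "p = (X, W, z)" by (metis surj_pair)
    have "z = 0" using R_even_z0 that card unfolding q by blast
    then show ?thesis using that by (auto simp: q R_even_def R_par_z0)
  qed
  have "\<exists>\<phi>. is_chart deformation_space
      (DIM((real ^ 'k ^ 'k) \<times> (real ^ 'k ^ 'k)) - card K, orbit_of ` R_even b, \<phi>)"
  proof (rule chart_of_section [OF quotient_map_orbit_of R_even_openin ne, where F = F and S = S and V = V])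
    show "p' \<in> R_even b" if "p \<in> R_even b" "p' \<in> R_par" "orbit_of p = orbit_of p'" for p p'
      using that by (cases p; cases p') (auto simp: R_even_def orbit_of_eq_iff)
    show "K \<subseteq> Basis" by (rule KB)
    have "open {p :: (real ^ 'k ^ 'k) \<times> (real ^ 'k ^ 'k). fst p $ b $ b \<noteq> 0}"
      by (intro open_Collect_neq continuous_intros)
    then have "openin (top_of_set {x. \<forall>i\<in>K. x \<bullet> i = 0}) ({x. \<forall>i\<in>K. x \<bullet> i = 0} \<inter>
        ({(X, W). nonsingular_pencil X W \<and> det X \<noteq> 0} \<inter> {p. fst p $ b $ b \<noteq> 0}))"
      by (intro openin_open_Int open_Int open_nonsingular_pencils)
    moreover have "{x. \<forall>i\<in>K. x \<bullet> i = 0} \<inter>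
        ({(X, W). nonsingular_pencil X W \<and> det X \<noteq> 0} \<inter> {p. fst p $ b $ b \<noteq> 0}) = V"
      unfolding L V_def by auto
    ultimately show "openin (top_of_set {x. \<forall>i\<in>K. x \<bullet> i = 0}) V" by simp
    show "continuous_on (R_even b) F"
      unfolding F_def case_prod_beta
      by (intro continuous_intros) (auto simp: R_even_def)
    show "F ` R_even b \<subseteq> V"
      using R by (fastforce simp: F_def V_def nonsingular_pencil_shift)
    show "F p = F p'" if pp: "p \<in> R_even b" "p' \<in> R_even b" "orbit_of p = orbit_of p'" for p p'
    proof -
      obtain X W X' W' where q: "p = (X, W, 0)" "p' = (X', W', 0)" and "X $ b $ b \<noteq> 0"
        using R pp(1,2) by metis
      moreover from this pp(3) obtain c where "X' = X" "W' = W - c *\<^sub>R X"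
        by (auto simp: orbit_of_z0_eq_iff)
      ultimately show ?thesis by (simp add: F_def diff_divide_distrib scaleR_diff_left)
    qed
    show "continuous_on V S" unfolding S_def case_prod_beta by (intro continuous_intros)
    show "S ` V \<subseteq> R_even b"
      by (auto simp: S_def V_def R_even_def R_par_z0)
    show "F (S v) = v" if "v \<in> V" for v
      using that by (auto simp: F_def S_def V_def)
    show "orbit_of (S (F p)) = orbit_of p" if p: "p \<in> R_even b" for p
    proof -
      obtain X W where q: "p = (X, W, 0)" using R p by blast
      have "W = W - (W $ b $ b / X $ b $ b) *\<^sub>R X - (- (W $ b $ b / X $ b $ b)) *\<^sub>R X" by simp
      then show ?thesis unfolding q S_def F_def prod.case orbit_of_z0_eq_iff by blast
    qed
  qed
  then show ?thesis by (simp only: dim)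
qed

section \<open>Chart for odd k: singular X with simple kernel\<close>

lemma hat_replace_col [simp]: "hat b (replace_col b u X) = hat b X"
  by (simp add: hat_def)

lemma continuous_on_hat [continuous_intros]:
  "continuous_on S f \<Longrightarrow> continuous_on S (\<lambda>x. hat b (f x))"
  unfolding hat_def by (intro continuous_intros)

lemma continuous_on_col_coords [continuous_intros]:
  assumes "continuous_on S f" "\<And>x. x \<in> S \<Longrightarrow> det (hat b (f x)) \<noteq> 0"
  shows "continuous_on S (\<lambda>x. col_coords b (f x))"
  unfolding col_coords_def using assms by (intro continuous_intros) auto

lemma ex_not_in_small_set:
  fixes A :: "'k::finite set"
  assumes "card A < CARD('k)"
  obtains i where "i \<notin> A"
proof -
  have "A \<noteq> UNIV" using assms by auto
  then show ?thesis using that by blast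
qed

text \<open>For \<open>z \<noteq> 0\<close> the rank of \<open>X\<close> is at most one;
  \<open>hat b X\<close> differs from it in one column, so its rank is at most two.\<close>

lemma R_odd_z0:
  fixes X W :: "real ^ 'k::finite ^ 'k"
  assumes p: "(X, W, z) \<in> R_odd a b" and card: "CARD('k) \<ge> 3"
  shows "z = 0"
proof (rule ccontr)
  assume "z \<noteq> 0"
  then obtain i where i: "z $ i \<noteq> 0" by (auto simp: vec_eq_iff)
  define x where "x = (1 / z $ i) *\<^sub>R column i X"
  have "commuting X z" and h: "det (hat b X) \<noteq> 0" using p by (auto simp: R_odd_def R_par_def)
  then have X: "X = outer x z" using commuting_rank_one i by (simp add: x_def)
  have ker: "v = 0" if "v $ b = 0" "z \<bullet> v = 0" for v
  proof -
    have "X *v v = 0" by (subst X) (simp add: outer_mult_vec that)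
    then have "hat b X *v v = 0" by (simp add: hat_mult_vec that)
    then show ?thesis using h det_nonzero_iff_kernel [of "hat b X"] by blast
  qed
  obtain j where "j \<notin> {b}" by (rule ex_not_in_small_set [of "{b}"]) (use card in auto)
  moreover obtain l where "l \<notin> {b, j}"
    by (rule ex_not_in_small_set [of "{b, j}"]) (use card card_insert_le_m1 [of 2 "{j}" b] in auto)
  ultimately have jl: "j \<noteq> l" "j \<noteq> b" "l \<noteq> b" by auto
  \<comment> \<open>Orthogonal to \<open>z\<close> and zero at \<open>b\<close>, so it vanishes;
    then \<open>z $ j = 0\<close>, and \<open>axis j 1\<close> is such a vector too, a
    contradiction. \<open>k \<ge> 3\<close> provides the two indices besides
    \<open>b\<close>.\<close>
  define v :: "real ^ 'k" where "v = z $ l *\<^sub>R axis j 1 - z $ j *\<^sub>R axis l 1"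
  have "z \<bullet> v = 0" by (simp add: v_def inner_diff_right inner_axis)
  moreover have "v $ b = 0" using jl by (simp add: v_def axis_def)
  ultimately have "v = 0" by (rule ker [rotated])
  moreover have "v $ l = - z $ j" using jl by (simp add: v_def axis_def)
  ultimately have "z \<bullet> axis j 1 = 0" by (simp add: inner_axis)
  then have "axis j (1 :: real) = (0 :: real ^ 'k)" using jl by (intro ker) (auto simp: axis_def)
  then show False by (simp add: axis_eq_0_iff)
qed

lemma R_odd_openin: "openin (top_of_set R_par) (R_odd a b)"
proof -
  define A where "A = {p :: 'a par. det (hat b (fst p)) \<noteq> 0}"
  define f where "f p = det (replace_col b (fst (snd p) *v (axis b 1 - col_coords b (fst p))) (fst p))" for p :: "'a par"
  have "open A" unfolding A_def by (intro open_Collect_neq continuous_intros)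
  moreover have "continuous_on A f" unfolding f_def by (intro continuous_intros) (simp add: A_def)
  ultimately have "open (A \<inter> f -` (- {0}))" by (intro continuous_open_preimage open_Compl) auto
  moreover have "open {p :: 'a par. fst p $ a $ a \<noteq> 0}" by (intro open_Collect_neq continuous_intros)
  ultimately have "openin (top_of_set R_par) (R_par \<inter> ((A \<inter> f -` (- {0})) \<inter> {p. fst p $ a $ a \<noteq> 0}))"
    by (intro openin_open_Int open_Int [of "A \<inter> f -` (- {0})"])
  moreover have "R_par \<inter> ((A \<inter> f -` (- {0})) \<inter> {p. fst p $ a $ a \<noteq> 0}) = R_odd a b"
    by (auto simp: R_odd_def A_def f_def)
  ultimately show ?thesis by simp
qed

lemma singular_col_coords:
  assumes "det X = 0" "det (hat b X) \<noteq> 0"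
  shows "col_coords b X $ b = 0" "X *v (axis b 1 - col_coords b X) = 0"
proof -
  obtain v where v: "v \<noteq> 0" "X *v v = 0" using assms(1) det_nonzero_iff_kernel [of X] by blast
  note c = kernel_col_coords [OF v assms(2)]
  have "(axis b 1 - col_coords b X) $ b = 1" using c by simp
  then show "col_coords b X $ b = 0" by simp
  show "X *v (axis b 1 - col_coords b X) = 0" unfolding c(2) matrix_vector_mult_scaleR v(2) by simp
qed

text \<open>If \<open>hat b Y\<close> is invertible and \<open>Y $ b $ b = 0\<close> then this is the singular matrix with the columns
  of \<open>Y\<close> away from \<open>b\<close> and with kernel vector \<open>axis b 1 - column b Y\<close>.\<close>

definition singular_of :: "'k::finite \<Rightarrow> real ^ 'k ^ 'k \<Rightarrow> real ^ 'k ^ 'k" where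
  "singular_of b Y = replace_col b (hat b Y *v column b Y) Y"

lemma singular_of_kernel:
  assumes "Y $ b $ b = 0"
  shows "singular_of b Y *v (axis b 1 - column b Y) = 0"
proof -
  have "column b Y $ b = 0" using assms by (simp add: column_def)
  then show ?thesis
    unfolding matrix_vector_mult_diff_distrib matrix_vector_mult_basis
    by (simp add: singular_of_def replace_col_mult_vec hat_mult_vec)
qed

lemma col_coords_singular_of:
  assumes "det (hat b Y) \<noteq> 0"
  shows "col_coords b (singular_of b Y) = column b Y"
  using hat_mult_eq_iff [of b "singular_of b Y" "column b Y"] assms by (simp add: singular_of_def)

lemma singular_of_col_coords:
  assumes "det (hat b X) \<noteq> 0"
  shows "singular_of b (replace_col b (col_coords b X) X) = X"
proof -
  have "hat b X *v col_coords b X = column b X" using hat_mult_eq_iff [OF assms] by blast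
  then show ?thesis by (simp add: singular_of_def)
qed

text \<open>Away from \<open>s = 0\<close> the determinant on the right is \<open>det (s W + t X) / s\<close>, because \<open>X\<close> is singular.\<close>

lemma nonsingular_pencil_half_circle_kernel:
  fixes X W :: "real ^ 'k::finite ^ 'k"
  assumes v: "X *v v = 0" "v $ b = 1"
  shows "nonsingular_pencil X W \<and> det (replace_col b (W *v v) X) \<noteq> 0 \<longleftrightarrow>
    (\<forall>(s, t)\<in>half_circle. det (replace_col b (W *v v) (s *\<^sub>R W + t *\<^sub>R X)) \<noteq> 0)"
proof -
  have eq: "det (s *\<^sub>R W + t *\<^sub>R X) = s * det (replace_col b (W *v v) (s *\<^sub>R W + t *\<^sub>R X))" for s t
    using det_homogeneous_pencil_kernel [OF v(1), of b s W t] v(2) by simp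
  show ?thesis
  proof (intro iffI conjI)
    assume ns: "nonsingular_pencil X W \<and> det (replace_col b (W *v v) X) \<noteq> 0"
    have "det (replace_col b (W *v v) (s *\<^sub>R W + t *\<^sub>R X)) \<noteq> 0" if "(s, t) \<in> half_circle" for s t
    proof (cases "s = 0")
      case True
      then show ?thesis using that ns by (simp add: half_circle_0)
    next
      case False
      then have "det (s *\<^sub>R W + t *\<^sub>R X) \<noteq> 0"
        using ns by (simp add: det_homogeneous_pencil nonsingular_pencil_def)
      then show ?thesis unfolding eq by simp
    qed
    then show "\<forall>(s, t)\<in>half_circle. det (replace_col b (W *v v) (s *\<^sub>R W + t *\<^sub>R X)) \<noteq> 0" by auto
  next
    assume h: "\<forall>(s, t)\<in>half_circle. det (replace_col b (W *v v) (s *\<^sub>R W + t *\<^sub>R X)) \<noteq> 0"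
    then show "det (replace_col b (W *v v) X) \<noteq> 0" using half_circle_0 [of 1] by fastforce
    show "nonsingular_pencil X W"
      unfolding nonsingular_pencil_def
    proof
      fix t
      obtain s' where s': "s' \<noteq> 0" "(s', t * s') \<in> half_circle" by (rule half_circle_slope)
      then have "det (s' *\<^sub>R W + (t * s') *\<^sub>R X) \<noteq> 0" unfolding eq using h by auto
      then show "det (W + t *\<^sub>R X) \<noteq> 0"
        using \<open>s' \<noteq> 0\<close> by (simp add: det_homogeneous_pencil)
    qed
  qed
qed

text \<open>Singular matrices are straightened by storing in column \<open>b\<close> the
  coefficients \<open>col_coords b X\<close> instead of the column itself: singularity becomes the
  linear equation \<open>Y $ b $ b = 0\<close>. The other normalised coordinate is
  \<open>W $ a $ a\<close>; \<open>a \<noteq> b\<close> keeps the pivot outside the rewritten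
  column.\<close>

lemma R_odd_chart:
  fixes a b :: "'k::finite"
  assumes card: "CARD('k) \<ge> 3" "odd CARD('k)" and ab: "a \<noteq> b" and ne: "R_odd a b \<noteq> {}"
  shows "\<exists>\<phi>. is_chart deformation_space (2 * CARD('k)\<^sup>2 - 2, orbit_of ` R_odd a b, \<phi>)"
proof -
  define K :: "((real ^ 'k ^ 'k) \<times> (real ^ 'k ^ 'k)) set"
    where "K = {(axis b (axis b 1), 0), (0, axis a (axis a 1))}"
  \<comment> \<open>Nonsingularity is stated on the half circle with the factor \<open>s\<close>
    divided out, which makes \<open>V\<close> open in the coordinate subspace.\<close>
  define V where "V = {(Y :: real ^ 'k ^ 'k, W). Y $ b $ b = 0 \<and> W $ a $ a = 0 \<and> Y $ a $ a \<noteq> 0 \<and>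
    det (hat b Y) \<noteq> 0 \<and> (\<forall>(s, t)\<in>half_circle.
      det (replace_col b (W *v (axis b 1 - column b Y)) (s *\<^sub>R W + t *\<^sub>R singular_of b Y)) \<noteq> 0)}"
  define F where "F = (\<lambda>(X :: real ^ 'k ^ 'k, W, z :: real ^ 'k).
    (replace_col b (col_coords b X) X, W - (W $ a $ a / X $ a $ a) *\<^sub>R X))"
  define S where "S = (\<lambda>(Y :: real ^ 'k ^ 'k, W :: real ^ 'k ^ 'k). (singular_of b Y, W, 0 :: real ^ 'k))"
  have KB: "K \<subseteq> Basis" by (auto simp: K_def Basis_prod_def axis_in_Basis_iff)
  have "(axis b (axis b 1), 0) \<noteq> (0 :: real ^ 'k ^ 'k, axis a (axis a (1 :: real)) :: real ^ 'k ^ 'k)"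
    by (auto simp: axis_eq_0_iff)
  then have "card K = 2" by (simp add: K_def)
  then have dim: "DIM((real ^ 'k ^ 'k) \<times> (real ^ 'k ^ 'k)) - card K = 2 * CARD('k)\<^sup>2 - 2"
    by (simp add: power2_eq_square)
  have L: "(\<forall>i\<in>K. p \<bullet> i = 0) \<longleftrightarrow> fst p $ b $ b = 0 \<and> snd p $ a $ a = 0" for p
    by (cases p) (simp add: K_def inner_axis)
  have R: "\<exists>X W. p = (X, W, 0) \<and> nonsingular_pencil X W \<and> det (hat b X) \<noteq> 0 \<and> X $ a $ a \<noteq> 0 \<and>
      det (replace_col b (W *v (axis b 1 - col_coords b X)) X) \<noteq> 0 \<and>
      col_coords b X $ b = 0 \<and> X *v (axis b 1 - col_coords b X) = 0"
    if "p \<in> R_odd a b" for p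
  proof -
    obtain X W z where q: "p = (X, W, z)" by (metis surj_pair)
    have "z = 0" using R_odd_z0 that card unfolding q by blast
    then have "nonsingular_pencil X W" "det (hat b X) \<noteq> 0" using that by (auto simp: q R_odd_def R_par_z0)
    moreover from this have "det X = 0" using odd_pencil_singular card(2) by blast
    ultimately show ?thesis
      using that \<open>z = 0\<close> singular_col_coords [of X b] by (auto simp: q R_odd_def)
  qed
  have "\<exists>\<phi>. is_chart deformation_space
      (DIM((real ^ 'k ^ 'k) \<times> (real ^ 'k ^ 'k)) - card K, orbit_of ` R_odd a b, \<phi>)"
  proof (rule chart_of_section [OF quotient_map_orbit_of R_odd_openin ne, where F = F and S = S and V = V])
    show "p' \<in> R_odd a b" if pp: "p \<in> R_odd a b" "p' \<in> R_par" "orbit_of p = orbit_of p'" for p p'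
    proof -
      obtain X W where q: "p = (X, W, 0)" and r: "det (hat b X) \<noteq> 0" "X $ a $ a \<noteq> 0"
        "det (replace_col b (W *v (axis b 1 - col_coords b X)) X) \<noteq> 0"
        "X *v (axis b 1 - col_coords b X) = 0"
        using R [OF pp(1)] by blast
      obtain X' W' z' where q': "p' = (X', W', z')" by (metis surj_pair)
      have o: "X' = X" "z' = 0" using pp(3) by (auto simp: q q' orbit_of_eq_iff)
      then obtain c where "W' = W - c *\<^sub>R X" using pp(3) by (auto simp: q q' orbit_of_z0_eq_iff)
      \<comment> \<open>Shifting \<open>W\<close> along \<open>X\<close> does not change its value
        at a kernel vector of \<open>X\<close>.\<close>
      then have "W' *v (axis b 1 - col_coords b X) = W *v (axis b 1 - col_coords b X)"
        using r(4) by (simp add: matrix_vector_mult_diff_rdistrib flip: scaleR_matrix_vector_assoc)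
      then show ?thesis using pp(2) r by (simp add: q' o R_odd_def)
    qed
    show "K \<subseteq> Basis" by (rule KB)
    define O1 where "O1 = {p :: (real ^ 'k ^ 'k) \<times> (real ^ 'k ^ 'k). fst p $ a $ a \<noteq> 0}"
    define O2 where "O2 = {p :: (real ^ 'k ^ 'k) \<times> (real ^ 'k ^ 'k). det (hat b (fst p)) \<noteq> 0}"
    define O3 where "O3 = {p :: (real ^ 'k ^ 'k) \<times> (real ^ 'k ^ 'k). \<forall>k\<in>half_circle.
        det (replace_col b (snd p *v (axis b 1 - column b (fst p)))
          (fst k *\<^sub>R snd p + snd k *\<^sub>R singular_of b (fst p))) \<noteq> 0}"
    have "open O1" "open O2" unfolding O1_def O2_def by (intro open_Collect_neq continuous_intros)+
    moreover have "open O3"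
      unfolding O3_def singular_of_def
      by (intro open_nonzero_on_compact compact_half_circle)
         (simp add: case_prod_beta, intro continuous_intros)
    ultimately have "openin (top_of_set {x. \<forall>i\<in>K. x \<bullet> i = 0})
        ({x. \<forall>i\<in>K. x \<bullet> i = 0} \<inter> (O1 \<inter> O2 \<inter> O3))"
      by (intro openin_open_Int open_Int)
    moreover have "{x. \<forall>i\<in>K. x \<bullet> i = 0} \<inter> (O1 \<inter> O2 \<inter> O3) = V"
      unfolding L V_def O1_def O2_def O3_def by auto
    ultimately show "openin (top_of_set {x. \<forall>i\<in>K. x \<bullet> i = 0}) V" by simp
    show "continuous_on (R_odd a b) F"
      unfolding F_def case_prod_beta
      by (intro continuous_intros) (auto simp: R_odd_def)
    show "F ` R_odd a b \<subseteq> V"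
    proof (intro image_subsetI)
      fix p assume "p \<in> R_odd a b"
      then obtain X W where q: "p = (X, W, 0)" and ns: "nonsingular_pencil X W"
        and h: "det (hat b X) \<noteq> 0" and Xa: "X $ a $ a \<noteq> 0"
        and d: "det (replace_col b (W *v (axis b 1 - col_coords b X)) X) \<noteq> 0"
        and c: "col_coords b X $ b = 0" "X *v (axis b 1 - col_coords b X) = 0"
        using R by blast
      define v where "v = axis b 1 - col_coords b X"
      define W' where "W' = W - (W $ a $ a / X $ a $ a) *\<^sub>R X"
      have v: "X *v v = 0" "v $ b = 1" using c by (simp_all add: v_def)
      have "W' *v v = W *v v"
        using v by (simp add: W'_def matrix_vector_mult_diff_rdistrib flip: scaleR_matrix_vector_assoc)
      then have "\<forall>(s, t)\<in>half_circle. det (replace_col b (W' *v v) (s *\<^sub>R W' + t *\<^sub>R X)) \<noteq> 0"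
        unfolding nonsingular_pencil_half_circle_kernel [OF v, symmetric]
        using nonsingular_pencil_shift [OF ns] d by (simp add: W'_def v_def)
      moreover have "W' $ a $ a = 0" using Xa by (simp add: W'_def)
      moreover have "replace_col b (col_coords b X) X $ a $ a = X $ a $ a"
        "replace_col b (col_coords b X) X $ b $ b = 0"
        using ab c(1) by (simp_all add: replace_col_def)
      ultimately show "F p \<in> V"
        using h Xa by (simp add: F_def V_def q singular_of_col_coords flip: v_def W'_def)
    qed
    show "F p = F p'" if pp: "p \<in> R_odd a b" "p' \<in> R_odd a b" "orbit_of p = orbit_of p'" for p p'
    proof -
      obtain X W X' W' where q: "p = (X, W, 0)" "p' = (X', W', 0)" and "X $ a $ a \<noteq> 0"
        using R [OF pp(1)] R [OF pp(2)] by blast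
      moreover from this pp(3) obtain c where "X' = X" "W' = W - c *\<^sub>R X"
        by (auto simp: orbit_of_z0_eq_iff)
      ultimately show ?thesis by (simp add: F_def diff_divide_distrib scaleR_diff_left)
    qed
    show "continuous_on V S" unfolding S_def singular_of_def case_prod_beta by (intro continuous_intros)
    show "S ` V \<subseteq> R_odd a b"
    proof (intro image_subsetI)
      fix p assume p: "p \<in> V"
      obtain Y W where q: "p = (Y, W)" by fastforce
      have Y: "Y $ b $ b = 0" "Y $ a $ a \<noteq> 0" "det (hat b Y) \<noteq> 0" and
        h: "\<forall>(s, t)\<in>half_circle.
          det (replace_col b (W *v (axis b 1 - column b Y)) (s *\<^sub>R W + t *\<^sub>R singular_of b Y)) \<noteq> 0"
        using p by (auto simp: q V_def)
      have "(axis b 1 - column b Y) $ b = 1" using Y(1) by (simp add: column_def)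
      then have "nonsingular_pencil (singular_of b Y) W \<and>
          det (replace_col b (W *v (axis b 1 - column b Y)) (singular_of b Y)) \<noteq> 0"
        using nonsingular_pencil_half_circle_kernel [OF singular_of_kernel [OF Y(1)]] h by blast
      moreover have "hat b (singular_of b Y) = hat b Y" by (simp add: singular_of_def)
      moreover have "singular_of b Y $ a $ a = Y $ a $ a" using ab by (simp add: singular_of_def replace_col_def)
      ultimately show "S p \<in> R_odd a b"
        using Y by (simp add: q S_def R_odd_def R_par_z0 col_coords_singular_of)
    qed
    show "F (S v) = v" if "v \<in> V" for v
    proof -
      obtain Y W where q: "v = (Y, W)" by fastforce
      have "det (hat b Y) \<noteq> 0" "W $ a $ a = 0" using that by (auto simp: q V_def)
      moreover have "replace_col b u (singular_of b Y) = replace_col b u Y" for u by (simp add: singular_of_def)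
      ultimately show ?thesis by (simp add: q F_def S_def col_coords_singular_of)
    qed
    show "orbit_of (S (F p)) = orbit_of p" if p: "p \<in> R_odd a b" for p
    proof -
      obtain X W where q: "p = (X, W, 0)" and h: "det (hat b X) \<noteq> 0" using R p by blast
      have "W = W - (W $ a $ a / X $ a $ a) *\<^sub>R X - (- (W $ a $ a / X $ a $ a)) *\<^sub>R X" by simp
      then show ?thesis
        unfolding q S_def F_def prod.case singular_of_col_coords [OF h] orbit_of_z0_eq_iff by blast
    qed
  qed
  then show ?thesis by (simp only: dim)
qed

section \<open>Density of orbits and assembly of the manifold\<close>

lemma dense_orbits:
  assumes "R' \<subseteq> R_par" "R_par \<subseteq> closure R'"
  shows "deformation_space closure_of (orbit_of ` R') = topspace deformation_space"
proof -
  have "top_of_set R_par closure_of R' = R_par"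
    using assms by (simp add: closure_of_subtopology inf.absorb1 inf.absorb2)
  then have "orbit_of ` R_par \<subseteq> deformation_space closure_of (orbit_of ` R')"
    using continuous_map_image_closure_subset [OF quotient_imp_continuous_map [OF quotient_map_orbit_of], of R']
    by simp
  moreover have "orbit_of ` R_par = topspace deformation_space"
    using quotient_imp_surjective_map [OF quotient_map_orbit_of] by simp
  ultimately show ?thesis
    by (metis closure_of_subset_topspace subset_antisym)
qed

text \<open>\<open>z\<close> is an orbit invariant, so the pieces with \<open>z = 0\<close> and
  \<open>z $ b \<noteq> 0\<close> stay disjoint in the quotient.\<close>

lemma deformation_space_of_charts:
  fixes A :: "'k::finite par set"
  assumes A: "is_chart deformation_space (d, orbit_of ` A, \<phi>)" "A \<subseteq> R_par" "\<And>X W z. (X, W, z) \<in> A \<Longrightarrow> z = 0"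
    and d: "CARD('k)\<^sup>2 + CARD('k) \<le> d" and dense: "\<And>X W. (X, W, 0) \<in> R_par \<Longrightarrow> (X, W, 0) \<in> closure A"
  shows "\<exists>T' :: (int ^ 'k \<Rightarrow> 'k sqmat) set set. openin deformation_space T' \<and>
    deformation_space closure_of T' = topspace deformation_space \<and>
    smooth_manifold_of_dim (subtopology deformation_space T') d"
proof -
  fix b :: 'k
  obtain \<psi> where B: "is_chart deformation_space (CARD('k)\<^sup>2 + CARD('k), orbit_of ` R_z_nonzero b, \<psi>)"
    using R_z_nonzero_chart by blast
  define T' where "T' = orbit_of ` (A \<union> R_z_nonzero b)"
  have T': "T' = orbit_of ` A \<union> orbit_of ` R_z_nonzero b" by (simp add: T'_def image_Un)
  have "openin deformation_space T'"
    unfolding T' using A(1) B by (intro openin_Un) (simp_all add: is_chart_def)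
  have "R_par \<subseteq> closure (A \<union> R_z_nonzero b)"
  proof
    fix p :: "'k par" assume p: "p \<in> R_par"
    obtain X W z where q: "p = (X, W, z)" by (metis surj_pair)
    show "p \<in> closure (A \<union> R_z_nonzero b)"
    proof (cases "z = 0")
      case True
      then show ?thesis using dense p unfolding q closure_Un by blast
    next
      case False
      then show ?thesis using R_par_in_closure_R_z_nonzero p unfolding q closure_Un by blast
    qed
  qed
  moreover have "A \<union> R_z_nonzero b \<subseteq> R_par" using A(2) by (auto simp: R_z_nonzero_def)
  ultimately have "deformation_space closure_of T' = topspace deformation_space"
    unfolding T'_def by (intro dense_orbits)
  moreover have "orbit_of ` A \<inter> orbit_of ` R_z_nonzero b = {}"
  proof -
    have "orbit_of p \<noteq> orbit_of p'" if "p \<in> A" "p' \<in> R_z_nonzero b" for p p'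
    proof -
      obtain X W z X' W' z' where q: "p = (X, W, z)" "p' = (X', W', z')" by (metis surj_pair)
      have "z = 0" "z' $ b \<noteq> 0" using that A(3) by (auto simp: q R_z_nonzero_def)
      then show ?thesis unfolding q orbit_of_eq_iff by auto
    qed
    then show ?thesis by blast
  qed
  then have "smooth_manifold_of_dim (subtopology deformation_space T') d"
    using d is_chart_subtopology [OF A(1), of T'] is_chart_subtopology [OF B, of T'] openin_subset [OF \<open>openin deformation_space T'\<close>]
    by (intro smooth_manifold_of_disjoint_charts
        [of "{(d, orbit_of ` A, \<phi>), (CARD('k)\<^sup>2 + CARD('k), orbit_of ` R_z_nonzero b, \<psi>)}" _ d "orbit_of ` A" \<phi>])
       (auto simp: T' inf.absorb2)
  ultimately show ?thesis using \<open>openin deformation_space T'\<close> by blast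
qed

theorem corollary5p1p1:
  shows "\<exists>T' :: (int ^ 'k::finite \<Rightarrow> 'k sqmat) set set.
    openin deformation_space T' \<and>
    deformation_space closure_of T' = topspace deformation_space \<and>
    smooth_manifold_of_dim (subtopology deformation_space T')
      (if CARD('k) = 1 then 2
       else if even CARD('k) then 2 * CARD('k)\<^sup>2 - 1
       else 2 * CARD('k)\<^sup>2 - 2)"
proof -
  have pos: "CARD('k) > 0" by simp
  \<comment> \<open>A base point: as the closure of the empty set is empty, density at this point
    makes the pieces with \<open>z = 0\<close> nonempty.\<close>
  have unit: "(0 :: real ^ 'k ^ 'k, mat 1, 0) \<in> R_par"
    by (simp add: R_par_z0 nonsingular_pencil_def)
  fix b :: 'k
  consider "CARD('k) = 1" | "CARD('k) \<ge> 2" "even CARD('k)" | "CARD('k) \<ge> 3" "odd CARD('k)"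
  proof -
    have "CARD('k) = 1 \<or> (CARD('k) \<ge> 2 \<and> even CARD('k)) \<or> (CARD('k) \<ge> 3 \<and> odd CARD('k))"
    proof -
      have "n = 1 \<or> (n \<ge> 2 \<and> even n) \<or> (n \<ge> 3 \<and> odd n)" if "n > 0" for n :: nat
        using that by presburger
      then show ?thesis using pos .
    qed
    then show ?thesis using that by blast
  qed
  then show ?thesis
  proof cases
    case 1
    \<comment> \<open>For \<open>k = 1\<close> the points with \<open>z = 0\<close> lie in the
      closure of this piece, which alone gives the dimension \<open>1 + 1\<close>.\<close>
    obtain \<psi> where B: "is_chart deformation_space (CARD('k)\<^sup>2 + CARD('k), orbit_of ` R_z_nonzero b, \<psi>)"
      using R_z_nonzero_chart by blast
    define T' where "T' = orbit_of ` R_z_nonzero b"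
    have "openin deformation_space T'" using B by (simp add: T'_def is_chart_def)
    moreover have "R_par \<subseteq> closure (R_z_nonzero b)"
    proof
      fix p :: "'k par" assume p: "p \<in> R_par"
      obtain X W z where q: "p = (X, W, z)" by (metis surj_pair)
      show "p \<in> closure (R_z_nonzero b)"
        using p z0_in_closure_R_z_nonzero [OF _ 1] R_par_in_closure_R_z_nonzero
        unfolding q by (cases "z = 0") (auto simp: R_par_z0)
    qed
    then have "deformation_space closure_of T' = topspace deformation_space"
      unfolding T'_def by (intro dense_orbits) (auto simp: R_z_nonzero_def)
    moreover have "smooth_manifold_of_dim (subtopology deformation_space T') 2"
      using 1 is_chart_subtopology [OF B, of T'] openin_subset [OF \<open>openin deformation_space T'\<close>]
      by (intro smooth_manifold_of_disjoint_charts
          [of "{(CARD('k)\<^sup>2 + CARD('k), orbit_of ` R_z_nonzero b, \<psi>)}" _ 2 "orbit_of ` R_z_nonzero b" \<psi>])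
         (auto simp: T'_def inf.absorb2)
    ultimately show ?thesis using 1 by auto
  next
    case 2
    have dense: "(X, W, 0) \<in> closure (R_even b)" if "(X, W, 0) \<in> R_par" for X W
      using that z0_in_closure_R_even 2(2) by (simp add: R_par_z0)
    from dense [OF unit] have "R_even b \<noteq> {}" by auto
    then obtain \<phi> where \<phi>: "is_chart deformation_space (2 * CARD('k)\<^sup>2 - 1, orbit_of ` R_even b, \<phi>)"
      using R_even_chart 2(1) by blast
    \<comment> \<open>The piece with \<open>z $ b \<noteq> 0\<close> must not exceed the claimed
      dimension.\<close>
    have "2 * CARD('k) \<le> CARD('k)\<^sup>2" using 2(1) by (simp add: power2_eq_square)
    then have "CARD('k)\<^sup>2 + CARD('k) \<le> 2 * CARD('k)\<^sup>2 - 1" using 2(1) by linarith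
    moreover have "R_even b \<subseteq> R_par" by (auto simp: R_even_def)
    ultimately show ?thesis
      using deformation_space_of_charts [OF \<phi> _ R_even_z0 [OF _ 2(1)] _ dense] 2 by simp
  next
    case 3
    obtain a :: 'k where "a \<noteq> b"
      using ex_not_in_small_set [of "{b}"] 3(1) by auto
    have dense: "(X, W, 0) \<in> closure (R_odd a b)" if "(X, W, 0) \<in> R_par" for X W
      using that z0_in_closure_R_odd [OF _ 3(2) \<open>a \<noteq> b\<close>] by (simp add: R_par_z0)
    from dense [OF unit] have "R_odd a b \<noteq> {}" by auto
    then obtain \<phi> where \<phi>: "is_chart deformation_space (2 * CARD('k)\<^sup>2 - 2, orbit_of ` R_odd a b, \<phi>)"
      using R_odd_chart 3 \<open>a \<noteq> b\<close> by blast
    have "3 * CARD('k) \<le> CARD('k)\<^sup>2" using 3(1) by (simp add: power2_eq_square)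
    then have "CARD('k)\<^sup>2 + CARD('k) \<le> 2 * CARD('k)\<^sup>2 - 2" using 3(1) by linarith
    moreover have "R_odd a b \<subseteq> R_par" by (auto simp: R_odd_def)
    ultimately show ?thesis
      using deformation_space_of_charts [OF \<phi> _ R_odd_z0 [OF _ 3(1)] _ dense] 3 by simp
  qed
qed

end
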